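(* Assume that the limit $\ell:=\lim_{s\uparrow+\infty}-\frac1s\ln\mathbb{P}[S_1>s]$ exists in $[0,+\infty]$. The area $F_t:=\int_0^t Z_\tau\,d\tau$ of the reset Brownian motion satisfies a full large deviation principle with the rate function $I(w):=\sup_{k\in\mathbb{R}}\{wk+\varphi(k)\}$, $w\in\mathbb{R}$, for any resetting protocol (i.e. any law of the waiting times as in the context). Moreover, its asymptotic logarithmic moment generating function $g(k):=\lim_{t\uparrow+\infty}\frac1t\ln\mathbb{E}[e^{kF_t}]$ exists for every $k\in\mathbb{R}$ (as an extended real number) and $g=-\varphi$.
   Context: Let $(\Omega,\mathcal{F},\mathbb{P})$ be a probability space with expectation $\mathbb{E}$. Let $S_1,S_2,\ldots$ (waiting times) be i.i.d. non-negative real random variables with $\mathbb{P}[S_1=0]<1$; put $T_0:=0$, $T_n:=S_1+\cdots+S_n$, and $N_t:=\sup\{n\ge 0:T_n\le t\}$ for $t\ge 0$ (almost surely finite for all $t$). Let $\{B_{1,t}\}_{t\ge 0},\{B_{2,t}\}_{t\ge 0},\ldots$ be independent standard Brownian motions (started at $0$), independent of the waiting times. The reset Brownian motion is $Z_t:=B_{N_t+1,\,t-T_{N_t}}$, $t\ge 0$. Set $X_1:=\int_0^{S_1}B_{1,\tau}\,d\tau$ and, for $k\in\mathbb{R}$, $$\varphi(k):=\sup\Big\{\zeta\in\mathbb{R}:\ \mathbb{E}\big[e^{\zeta S_1+kX_1}\big]\le 1\Big\}$$ (extended real valued, $\sup\emptyset=-\infty$). Also $\ln 0=-\infty$, $\ln(+\infty)=+\infty$,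 $\inf\emptyset=+\infty$. $F_t$ satisfies a full large deviation principle with rate function $I$ if $I$ is lower semicontinuous on $\mathbb{R}$ and $\liminf_{t\uparrow+\infty}\frac1t\ln\mathbb{P}[F_t/t\in G]\ge-\inf_{w\in G}I(w)$ for each open $G\subseteq\mathbb{R}$, and $\limsup_{t\uparrow+\infty}\frac1t\ln\mathbb{P}[F_t/t\in K]\le-\inf_{w\in K}I(w)$ for each closed $K\subseteq\mathbb{R}$. *)

theory Defs
  imports "HOL-Probability.Probability"
begin

text \<open>The logarithm on \<open>[0, +\<infinity>]\<close>, with \<open>ln 0 = -\<infinity>\<close> and \<open>ln (+\<infinity>) = +\<infinity>\<close>.\<close>

definition eln :: "ennreal \<Rightarrow> ereal" where
  "eln x = (if x = 0 then -\<infinity> else if x = \<infinity> then \<infinity> else ereal (ln (enn2real x)))"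

definition lower_semicont :: "('a::topological_space \<Rightarrow> ereal) \<Rightarrow> bool" where
  "lower_semicont I \<longleftrightarrow> (\<forall>w. I w \<le> Liminf (at w) I)"

definition full_ldp :: "'a measure \<Rightarrow> (real \<Rightarrow> 'a \<Rightarrow> real) \<Rightarrow> (real \<Rightarrow> ereal) \<Rightarrow> bool" where
  "full_ldp M F I \<longleftrightarrow>
     lower_semicont I \<and>
     (\<forall>G. open G \<longrightarrow>
        - (INF w\<in>G. I w)
          \<le> Liminf at_top (\<lambda>t. eln (emeasure M {\<omega> \<in> space M. F t \<omega> / t \<in> G}) / ereal t)) \<and>
     (\<forall>K. closed K \<longrightarrow>
        Limsup at_top (\<lambda>t. eln (emeasure M {\<omega> \<in> space M. F t \<omega> / t \<in> K}) / ereal t)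
          \<le> - (INF w\<in>K. I w))"

text \<open>The \<open>\<sigma>\<close>-algebra generated by the real-valued family \<open>(X i)\<close>, \<open>i \<in> J\<close>.
  The independence notions \<open>indep_vars\<close> and \<open>indep_var\<close> require a common value type, so
  independence of whole processes and sequences is expressed through generated \<open>\<sigma>\<close>-algebras.\<close>

definition generated_sets :: "'a measure \<Rightarrow> ('i \<Rightarrow> 'a \<Rightarrow> real) \<Rightarrow> 'i set \<Rightarrow> 'a set set" where
  "generated_sets M X J =
     sigma_sets (space M) {X i -` A \<inter> space M | i A. i \<in> J \<and> A \<in> sets borel}"

text \<open>Standard Brownian motion with time set \<open>[0, \<infinity>)\<close>; values at negative times are irrelevant.
  Every path is continuous and starts at 0, not just almost every one: on a space that need not be
  complete this is what makes the time integrals of the paths random variables.\<close>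

definition (in prob_space) standard_brownian_motion :: "(real \<Rightarrow> 'a \<Rightarrow> real) \<Rightarrow> bool" where
  "standard_brownian_motion W \<longleftrightarrow>
     (\<forall>t\<ge>0. random_variable borel (W t)) \<and>
     (\<forall>\<omega>\<in>space M. W 0 \<omega> = 0) \<and>
     (\<forall>\<omega>\<in>space M. continuous_on {0..} (\<lambda>t. W t \<omega>)) \<and>
     (\<forall>s t. 0 \<le> s \<longrightarrow> s < t \<longrightarrow>
        distributed M lborel (\<lambda>\<omega>. W t \<omega> - W s \<omega>) (normal_density 0 (sqrt (t - s)))) \<and>
     (\<forall>n (t :: nat \<Rightarrow> real). 0 \<le> t 0 \<longrightarrow> (\<forall>i<n. t i \<le> t (Suc i)) \<longrightarrow>
        indep_vars (\<lambda>_. borel) (\<lambda>i \<omega>. W (t (Suc i)) \<omega> - W (t i) \<omega>) {..<n})"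

text \<open>Waiting times \<open>S i\<close> and Brownian motions \<open>B i\<close> are indexed by \<open>i \<ge> 1\<close>; \<open>S 0\<close> and \<open>B 0\<close>
  play no role.\<close>

locale resetting = prob_space M for M :: "'a measure" +
  fixes S :: "nat \<Rightarrow> 'a \<Rightarrow> real"
    and B :: "nat \<Rightarrow> real \<Rightarrow> 'a \<Rightarrow> real"
  assumes S_nonneg: "\<And>i \<omega>. i \<ge> 1 \<Longrightarrow> \<omega> \<in> space M \<Longrightarrow> S i \<omega> \<ge> 0"
    and S_indep: "indep_vars (\<lambda>_. borel) S {1..}"
    and S_ident: "\<And>i. i \<ge> 1 \<Longrightarrow> distr M borel (S i) = distr M borel (S 1)"
    and S_nonzero: "prob {\<omega> \<in> space M. S 1 \<omega> = 0} < 1"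
    and B_brownian: "\<And>i. i \<ge> 1 \<Longrightarrow> standard_brownian_motion (B i)"
    and B_indep: "indep_sets (\<lambda>i. generated_sets M (B i) {0..}) {1..}"
    and B_S_indep:
      "indep_set (generated_sets M (\<lambda>(i, t). B i t) ({1..} \<times> {0..})) (generated_sets M S {1..})"

definition renewal_time :: "(nat \<Rightarrow> 'a \<Rightarrow> real) \<Rightarrow> nat \<Rightarrow> 'a \<Rightarrow> real" where
  "renewal_time S n \<omega> = (\<Sum>i=1..n. S i \<omega>)"

text \<open>On the null event that the set below is infinite, the supremum is an unspecified constant.\<close>

definition num_renewals :: "(nat \<Rightarrow> 'a \<Rightarrow> real) \<Rightarrow> real \<Rightarrow> 'a \<Rightarrow> nat" where
  "num_renewals S t \<omega> = Sup {n. renewal_time S n \<omega> \<le> t}"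

definition reset_bm :: "(nat \<Rightarrow> 'a \<Rightarrow> real) \<Rightarrow> (nat \<Rightarrow> real \<Rightarrow> 'a \<Rightarrow> real) \<Rightarrow> real \<Rightarrow> 'a \<Rightarrow> real" where
  "reset_bm S B t \<omega> =
     (let n = num_renewals S t \<omega> in B (n + 1) (t - renewal_time S n \<omega>) \<omega>)"

definition reset_area :: "(nat \<Rightarrow> 'a \<Rightarrow> real) \<Rightarrow> (nat \<Rightarrow> real \<Rightarrow> 'a \<Rightarrow> real) \<Rightarrow> real \<Rightarrow> 'a \<Rightarrow> real" where
  "reset_area S B t \<omega> = (LBINT \<tau>:{0..t}. reset_bm S B \<tau> \<omega>)"

definition first_area :: "(nat \<Rightarrow> 'a \<Rightarrow> real) \<Rightarrow> (nat \<Rightarrow> real \<Rightarrow> 'a \<Rightarrow> real) \<Rightarrow> 'a \<Rightarrow> real" where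
  "first_area S B \<omega> = (LBINT \<tau>:{0..S 1 \<omega>}. B 1 \<tau> \<omega>)"

definition phi ::
  "'a measure \<Rightarrow> (nat \<Rightarrow> 'a \<Rightarrow> real) \<Rightarrow> (nat \<Rightarrow> real \<Rightarrow> 'a \<Rightarrow> real) \<Rightarrow> real \<Rightarrow> ereal" where
  "phi M S B k =
     Sup (ereal ` {\<zeta>. (\<integral>\<^sup>+ \<omega>. ennreal (exp (\<zeta> * S 1 \<omega> + k * first_area S B \<omega>)) \<partial>M) \<le> 1})"

definition rate ::
  "'a measure \<Rightarrow> (nat \<Rightarrow> 'a \<Rightarrow> real) \<Rightarrow> (nat \<Rightarrow> real \<Rightarrow> 'a \<Rightarrow> real) \<Rightarrow> real \<Rightarrow> ereal" where
  "rate M S B w = (SUP k. ereal (w * k) + phi M S B k)"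

end

theory Submission
  imports Defs "HOL-Real_Asymp.Real_Asymp"
begin

text \<open>Conditionally on the waiting times the area \<open>F\<^sub>t\<close> is a centred Gaussian variable: the area of a Brownian
path over a cycle of length \<open>r\<close> is \<open>N(0, r\<^sup>3/3)\<close>, and different cycles use independent motions.
Its conditional variance is one third of the sum of the cubes of the cycle lengths up to time \<open>t\<close>, the
unfinished cycle included (\<open>nn_integral_reset_area\<close>). Hence with \<open>\<theta> = k\<^sup>2/2\<close>
the moment generating function of \<open>F\<^sub>t\<close> at \<open>k\<close> is the one of the variance at \<open>\<theta>\<close>,
and \<open>\<phi>(k)\<close> is the supremum of the \<open>\<zeta>\<close> with
\<open>E[exp (\<zeta> S + \<theta> S\<^sup>3/3)] \<le> 1\<close> (\<open>phi_eq\<close>). What remains is a problem about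
sums of independent pairs \<open>(S, S\<^sup>3/3)\<close>.

\<^bold>\<open>Upper bounds.\<close> For \<open>\<zeta> < \<phi>(k)\<close> the weights \<open>exp (\<zeta> S + \<theta> S\<^sup>3/3)\<close>
have mean less than 1. If \<open>k \<noteq> 0\<close>, then \<open>\<zeta> s + \<theta> s\<^sup>3/3\<close> is increasing for large \<open>s\<close>, so the
unfinished cycle may be replaced by the full cycle that contains \<open>t\<close> at the cost of a constant factor, and
a geometric series bounds \<open>E[exp (k F\<^sub>t)]\<close> by a multiple of \<open>exp (-\<zeta> t)\<close>
(\<open>mgf_upper_bound\<close>). Since \<open>\<phi>\<close> is even, the rate function is even and nondecreasing
in \<open>\<bar>w\<bar>\<close>, so the exponential Markov inequality at the point of a closed set closest to 0
gives the upper bound of the large deviation principle.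

\<^bold>\<open>Lower bounds.\<close> Truncate \<open>S\<close> at a level \<open>A\<close> such that the weight
\<open>D = exp (\<zeta> S + \<theta> S\<^sup>3/3)\<close> still has mean at least 1. Under the law tilted by \<open>D\<close>,
\<open>n\<close> cycles typically last \<open>n m\<^sub>1\<close> and contribute variance \<open>n m\<^sub>2\<close>.
Undoing the tilt, the variance up to time \<open>t\<close> exceeds about \<open>v t\<close>, where
\<open>v = m\<^sub>2/m\<^sub>1\<close>, with probability at least about \<open>exp (-(\<zeta> + \<theta> v) t)\<close>
(\<open>block_event_lower_bound\<close>). For every \<open>\<zeta> > \<phi>(k)\<close> this yields
\<open>E[exp (k F\<^sub>t)] \<ge> exp (-\<zeta> t)\<close> up to arbitrarily small errors in the rate.

For the large deviation lower bound at \<open>w\<close> take \<open>c > I(w)\<close> and \<open>\<zeta> = c - k w\<close>, so that the weight has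
mean greater than 1 for every \<open>k\<close>. A compactness argument finds one truncation level that works for all
\<open>k\<close> (\<open>uniform_truncation\<close>), and at a minimiser in \<open>k\<close> of the truncated mean the derivative vanishes,
which says exactly that \<open>w = k v\<close> (\<open>exists_optimal_tilt\<close>). A Gaussian variable of variance \<open>v t\<close> is close to
\<open>w t\<close> with probability about \<open>exp (-t w\<^sup>2/(2 v))\<close>, and the total cost is
\<open>w\<^sup>2/(2 v) + \<zeta> + \<theta> v = c\<close>. The truncation makes every mean finite and the minimum attained, so that the
argument covers the laws for which \<open>\<phi>\<close> takes the value \<open>-\<infinity>\<close> or is not smooth.\<close>

section \<open>Exponential rates\<close>

lemma eln_mono: "x \<le> y \<Longrightarrow> eln x \<le> eln y"
proof -
  assume le: "x \<le> y"
  show ?thesis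
  proof (cases "x = 0 \<or> y = \<infinity>")
    case True
    then show ?thesis by (auto simp: eln_def)
  next
    case False
    then have x: "x \<noteq> 0" "y \<noteq> \<infinity>" by auto
    with le have "x \<noteq> \<infinity>" "y \<noteq> 0" by (auto simp: top_unique)
    then show ?thesis using x le
      by (auto simp: eln_def enn2real_mono enn2real_positive_iff less_top top.not_eq_extremum zero_less_iff_neq_zero)
  qed
qed

lemma eln_exp: "c > 0 \<Longrightarrow> eln (ennreal (c * exp x)) = ereal (ln c + x)"
  by (simp add: eln_def ln_mult)

lemma Limsup_eln_le:
  assumes "\<forall>\<^sub>F t in at_top. f t \<le> ennreal (C * exp (a * t))" and "C > 0"
  shows "Limsup at_top (\<lambda>t::real. eln (f t) / ereal t) \<le> ereal a"
proof -
  have lim: "((\<lambda>t. (ln C + a * t) / t) \<longlongrightarrow> a) at_top"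
    by real_asymp
  have "Limsup at_top (\<lambda>t::real. eln (f t) / ereal t) \<le> Limsup at_top (\<lambda>t. ereal ((ln C + a * t) / t))"
  proof (rule Limsup_mono)
    show "\<forall>\<^sub>F t in at_top. eln (f t) / ereal t \<le> ereal ((ln C + a * t) / t)"
      using assms(1) eventually_gt_at_top[of 0]
    proof eventually_elim
      case (elim t)
      then have "eln (f t) \<le> ereal (ln C + a * t)"
        using eln_mono[OF elim(1)] \<open>C > 0\<close> by (simp add: eln_exp)
      then have "eln (f t) / ereal t \<le> ereal (ln C + a * t) / ereal t"
        using elim by (intro ereal_divide_right_mono) auto
      then show ?case using elim by simp
    qed
  qed
  also have "\<dots> = ereal a"
    using lim by (intro lim_imp_Limsup) auto
  finally show ?thesis .
qed

lemma Liminf_eln_ge: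
  assumes "\<forall>\<^sub>F t in at_top. ennreal (exp (a * t)) \<le> f t"
  shows "ereal a \<le> Liminf at_top (\<lambda>t::real. eln (f t) / ereal t)"
proof (rule Liminf_bounded)
  show "\<forall>\<^sub>F t in at_top. ereal a \<le> eln (f t) / ereal t"
    using assms eventually_gt_at_top[of 0]
  proof eventually_elim
    case (elim t)
    then have "ereal (a * t) \<le> eln (f t)"
      using eln_mono[OF elim(1)] eln_exp[of 1 "a * t"] by simp
    then have "ereal (a * t) / ereal t \<le> eln (f t) / ereal t"
      using elim by (intro ereal_divide_right_mono) auto
    then show ?case using elim by simp
  qed
qed

section \<open>Areas of continuous paths\<close>

definition path_area :: "(real \<Rightarrow> 'a \<Rightarrow> real) \<Rightarrow> real \<Rightarrow> 'a \<Rightarrow> real" where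
  "path_area W r \<omega> = (LBINT \<tau>:{0..r}. W \<tau> \<omega>)"

lemma riemann_sums_tendsto:
  fixes f :: "real \<Rightarrow> real"
  assumes cont: "continuous_on {0..r} f" and r: "r \<ge> 0"
  shows "(\<lambda>n. \<Sum>j<Suc n. r / Suc n * f (r * Suc j / Suc n)) \<longlonglongrightarrow> (LBINT \<tau>:{0..r}. f \<tau>)"
proof (rule LIMSEQ_I)
  fix e :: real assume e: "e > 0"
  define e' where "e' = e / (2 * (r + 1))"
  have e': "e' > 0" using e r by (simp add: e'_def)
  have "uniformly_continuous_on {0..r} f"
    by (rule compact_uniformly_continuous[OF cont]) simp
  then obtain d where d: "d > 0" "\<And>x y. x \<in> {0..r} \<Longrightarrow> y \<in> {0..r} \<Longrightarrow> dist y x < d \<Longrightarrow> dist (f y) (f x) < e'"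
    unfolding uniformly_continuous_on_def using e' by metis
  obtain N where N: "r / d < real N" using reals_Archimedean2 by blast
  have "norm ((\<Sum>j<Suc n. r / Suc n * f (r * Suc j / Suc n)) - (LBINT \<tau>:{0..r}. f \<tau>)) < e" if n: "n \<ge> N" for n
  proof -
    define x where "x j = r * real j / Suc n" for j :: nat
    have mono: "x i \<le> x j" if "i \<le> j" for i j
      using that r by (auto simp: x_def divide_right_mono mult_left_mono)
    have step: "x (Suc j) - x j = r / Suc n" for j
      by (simp add: x_def distrib_left add_divide_distrib)
    have "r / d < Suc n" using N n by linarith
    then have small: "r / Suc n < d" using d(1) by (simp add: field_simps)
    have x0: "x 0 = 0" "x (Suc n) = r" by (auto simp: x_def)
    have rng: "{x j..x (Suc j)} \<subseteq> {0..r}" if "j < Suc n" for j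
      using mono[of 0 j] mono[of "Suc j" "Suc n"] x0 that by auto
    have int: "f integrable_on {x j..x (Suc j)}" if "j < Suc n" for j
      by (rule integrable_continuous_real, rule continuous_on_subset[OF cont rng[OF that]])
    have split: "integral {x 0..x m} f = (\<Sum>j<m. integral {x j..x (Suc j)} f)" if "m \<le> Suc n" for m
      using that
    proof (induction m)
      case (Suc m)
      have "{x 0..x (Suc m)} \<subseteq> {0..r}" using mono[of "Suc m" "Suc n"] x0 Suc.prems by auto
      then have "f integrable_on {x 0..x (Suc m)}"
        by (intro integrable_continuous_real continuous_on_subset[OF cont])
      then have "integral {x 0..x (Suc m)} f = integral {x 0..x m} f + integral {x m..x (Suc m)} f"
        using mono[of 0 m] mono[of m "Suc m"]
        by (simp add: Henstock_Kurzweil_Integration.integral_combine)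
      then show ?case using Suc by simp
    qed simp
    have "set_integrable lborel {0..r} f"
      by (rule borel_integrable_atLeastAtMost') (rule cont)
    then have "(LBINT \<tau>:{0..r}. f \<tau>) = integral {0..r} f"
      by (rule set_borel_integral_eq_integral)
    also have "\<dots> = (\<Sum>j<Suc n. integral {x j..x (Suc j)} f)"
      using split[of "Suc n"] x0 by simp
    finally have eq: "(LBINT \<tau>:{0..r}. f \<tau>) = (\<Sum>j<Suc n. integral {x j..x (Suc j)} f)" .
    have bd: "\<bar>r / Suc n * f (x (Suc j)) - integral {x j..x (Suc j)} f\<bar> \<le> e' * (r / Suc n)" if j: "j < Suc n" for j
    proof -
      have c: "((\<lambda>_. f (x (Suc j))) has_integral (r / Suc n * f (x (Suc j)))) {x j..x (Suc j)}"
        using has_integral_const_real[of "f (x (Suc j))" "x j" "x (Suc j)"] mono[of j "Suc j"] step[of j]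
        by simp
      have "((\<lambda>y. f (x (Suc j)) - f y) has_integral (r / Suc n * f (x (Suc j)) - integral {x j..x (Suc j)} f)) {x j..x (Suc j)}"
        by (intro has_integral_diff c integrable_integral int j)
      moreover have "norm (f (x (Suc j)) - f y) \<le> e'" if y: "y \<in> {x j..x (Suc j)}" for y
      proof -
        have "x (Suc j) \<in> {x j..x (Suc j)}" using mono[of j "Suc j"] by simp
        then have "dist (f (x (Suc j))) (f y) < e'"
          using y rng[OF j] step[of j] small by (intro d(2)) (auto simp: dist_real_def)
        then show ?thesis by (simp add: dist_real_def)
      qed
      ultimately have "norm (r / Suc n * f (x (Suc j)) - integral {x j..x (Suc j)} f) \<le> e' * measure lborel {x j..x (Suc j)}"
        using e' by (intro has_integral_bound_real[where S = "{}" and f = "\<lambda>y. f (x (Suc j)) - f y"]) auto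
      then show ?thesis using mono[of j "Suc j"] step[of j] by simp
    qed
    have "norm ((\<Sum>j<Suc n. r / Suc n * f (r * Suc j / Suc n)) - (LBINT \<tau>:{0..r}. f \<tau>))
       = \<bar>\<Sum>j<Suc n. r / Suc n * f (x (Suc j)) - integral {x j..x (Suc j)} f\<bar>"
      unfolding eq sum_subtractf x_def by simp
    also have "\<dots> \<le> (\<Sum>j<Suc n. \<bar>r / Suc n * f (x (Suc j)) - integral {x j..x (Suc j)} f\<bar>)"
      by (rule sum_abs)
    also have "\<dots> \<le> (\<Sum>j<Suc n. e' * (r / Suc n))"
      by (rule sum_mono) (use bd in auto)
    also have "\<dots> = e' * r"
      by (subst sum_constant) (simp del: of_nat_Suc)
    also have "\<dots> < e" using e r by (simp add: e'_def field_simps add_nonneg_pos)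
    finally show ?thesis .
  qed
  then show "\<exists>no. \<forall>n\<ge>no. norm ((\<Sum>j<Suc n. r / Suc n * f (r * Suc j / Suc n)) - (LBINT \<tau>:{0..r}. f \<tau>)) < e"
    by blast
qed

lemma measurable_path_area:
  assumes "\<And>t. t \<ge> 0 \<Longrightarrow> W t \<in> borel_measurable N"
    and "\<And>\<omega>. \<omega> \<in> space N \<Longrightarrow> continuous_on {0..} (\<lambda>t. W t \<omega>)" and "r \<ge> 0"
  shows "path_area W r \<in> borel_measurable N"
proof (rule borel_measurable_LIMSEQ_real)
  show "(\<lambda>n. \<Sum>j<Suc n. r / Suc n * W (r * Suc j / Suc n) \<omega>) \<longlonglongrightarrow> path_area W r \<omega>"
    if "\<omega> \<in> space N" for \<omega>
    unfolding path_area_def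
    by (rule riemann_sums_tendsto[OF continuous_on_subset[OF assms(2)[OF that]] assms(3)]) auto
  show "(\<lambda>\<omega>. \<Sum>j<Suc n. r / Suc n * W (r * Suc j / Suc n) \<omega>) \<in> borel_measurable N" for n
    by (intro borel_measurable_sum borel_measurable_times borel_measurable_const assms(1)) (use assms(3) in auto)
qed

text \<open>A path evaluated at a random time is the limit of the path at the rational
times \<open>\<lfloor>(n + 1) R\<rfloor> / (n + 1)\<close>; the maximum with 0 keeps the times in the range where the paths are
continuous.\<close>

lemma measurable_eval_continuous:
  fixes W :: "real \<Rightarrow> 'a \<Rightarrow> real"
  assumes W: "\<And>t. t \<ge> 0 \<Longrightarrow> W t \<in> borel_measurable N"
    and cont: "\<And>\<omega>. \<omega> \<in> space N \<Longrightarrow> continuous_on {0..} (\<lambda>t. W t \<omega>)"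
    and R[measurable]: "R \<in> borel_measurable L" and g[measurable]: "g \<in> measurable L N"
  shows "(\<lambda>x. W (max 0 (R x)) (g x)) \<in> borel_measurable L"
proof (rule borel_measurable_LIMSEQ_real)
  define q where "q n s = real_of_int \<lfloor>real (Suc n) * s\<rfloor> / real (Suc n)" for n s
  have q: "(\<lambda>n. q n s) \<longlonglongrightarrow> s" for s
  proof (rule real_tendsto_sandwich[where f = "\<lambda>n. s - 1 / real (Suc n)" and h = "\<lambda>n. s"])
    show "\<forall>\<^sub>F n in sequentially. s - 1 / real (Suc n) \<le> q n s"
    proof (rule always_eventually, rule allI)
      fix n
      have "real (Suc n) * s - 1 \<le> \<lfloor>real (Suc n) * s\<rfloor>" by linarith
      then have "(real (Suc n) * s - 1) / real (Suc n) \<le> q n s"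
        unfolding q_def by (rule divide_right_mono) simp
      then show "s - 1 / real (Suc n) \<le> q n s" by (simp add: diff_divide_distrib del: of_nat_Suc)
    qed
    show "\<forall>\<^sub>F n in sequentially. q n s \<le> s"
    proof (rule always_eventually, rule allI)
      fix n
      have "\<lfloor>real (Suc n) * s\<rfloor> \<le> real (Suc n) * s" by linarith
      then show "q n s \<le> s" by (simp add: q_def field_simps)
    qed
    show "(\<lambda>n. s - 1 / real (Suc n)) \<longlonglongrightarrow> s" by real_asymp
  qed simp
  show "(\<lambda>n. W (max 0 (q n (R x))) (g x)) \<longlonglongrightarrow> W (max 0 (R x)) (g x)" if "x \<in> space L" for x
  proof (rule continuous_on_tendsto_compose[OF cont])
    show "g x \<in> space N" using g that by (rule measurable_space)
    show "(\<lambda>n. max 0 (q n (R x))) \<longlonglongrightarrow> max 0 (R x)"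
      by (intro tendsto_max tendsto_const q)
  qed auto
  show "(\<lambda>x. W (max 0 (q n (R x))) (g x)) \<in> borel_measurable L" for n
  proof -
    have "(\<lambda>x. W (max 0 (real_of_int i / real (Suc n))) (g x)) \<in> borel_measurable L" for i
      by (rule measurable_compose[OF g W]) simp
    moreover have "(\<lambda>x. \<lfloor>real (Suc n) * R x\<rfloor>) \<in> measurable L (count_space UNIV)" by measurable
    ultimately show ?thesis unfolding q_def
      by (rule measurable_compose_countable)
  qed
qed

section \<open>The area of a Brownian path is Gaussian\<close>

text \<open>Law\<close>

text \<open>An image of the standard normal law, and not a density, so that variance 0 gives the point mass at 0: cycles of
length 0 may occur with positive probability.\<close>

definition gauss :: "real \<Rightarrow> real measure" where
  "gauss v = distr std_normal_distribution borel (\<lambda>z. sqrt v * z)"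

lemma real_distribution_gauss: "real_distribution (gauss v)"
proof -
  interpret real_distribution std_normal_distribution by (rule real_dist_normal_dist)
  show ?thesis unfolding gauss_def by (rule real_distribution_distr) simp
qed

lemma char_gauss:
  assumes "v \<ge> 0" shows "char (gauss v) u = complex_of_real (exp (- (v * u\<^sup>2) / 2))"
proof -
  have "char (gauss v) u = char std_normal_distribution (sqrt v * u)"
    unfolding gauss_def char_def
    by (subst integral_distr) (auto simp: ac_simps)
  then show ?thesis using assms by (simp add: char_std_normal_distribution power_mult_distrib)
qed

lemma gauss_eqI:
  assumes "real_distribution D" "v \<ge> 0"
    and "\<And>u. char D u = complex_of_real (exp (- (v * u\<^sup>2) / 2))"
  shows "D = gauss v"
  by (rule Levy_uniqueness) (use assms real_distribution_gauss in \<open>auto simp: char_gauss fun_eq_iff\<close>)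

lemma (in prob_space) distr_normal_gauss:
  assumes "distributed M lborel X (normal_density 0 \<sigma>)" "\<sigma> > 0"
  shows "distr M borel X = gauss (\<sigma>\<^sup>2)"
proof -
  have d: "distributed M lborel (\<lambda>x. X x / \<sigma>) std_normal_density"
    using assms normal_standard_normal_convert[OF assms(2), of X 0] by simp
  have m: "(\<lambda>x. X x / \<sigma>) \<in> borel_measurable M"
    using distributed_measurable[OF d] by simp
  have "distr M borel (\<lambda>x. X x / \<sigma>) = distr M lborel (\<lambda>x. X x / \<sigma>)"
    by (rule distr_cong) auto
  then have "distr M borel (\<lambda>x. X x / \<sigma>) = std_normal_distribution"
    using distributed_distr_eq_density[OF d] by simp
  then have "gauss (\<sigma>\<^sup>2) = distr (distr M borel (\<lambda>x. X x / \<sigma>)) borel (\<lambda>z. \<sigma> * z)"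
    using assms(2) by (simp add: gauss_def)
  also have "\<dots> = distr M borel X"
    using assms(2) m by (subst distr_distr) (auto simp: comp_def)
  finally show ?thesis ..
qed

lemma sum_squares_asymptotic:
  "(\<lambda>n. (\<Sum>m\<le>n. (real m)\<^sup>2) / (real n)^3) \<longlonglongrightarrow> 1/3"
proof -
  have "(\<Sum>m\<le>n. (real m)\<^sup>2) = (2 * real n ^ 3 + 3 * (real n)\<^sup>2 + real n) / 6" for n
    by (induction n) (auto simp: power2_eq_square power3_eq_cube field_simps)
  moreover have "(\<lambda>n. (2 * real n ^ 3 + 3 * (real n)\<^sup>2 + real n) / 6 / (real n)^3) \<longlonglongrightarrow> 1/3"
    by real_asymp
  ultimately show ?thesis by (simp only:)
qed

lemma path_area_0: "path_area W 0 \<omega> = 0"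
proof -
  have "AE \<tau> in lborel. indicat_real {0} \<tau> *\<^sub>R W \<tau> \<omega> = 0"
    using AE_lborel_singleton[of 0] by eventually_elim auto
  then show ?thesis
    by (simp add: path_area_def set_lebesgue_integral_def integral_eq_zero_AE)
qed

text \<open>The Riemann sums of the area are, after summation by parts, weighted sums of independent normal increments.
Their variances are \<open>r\<^sup>3/n\<^sup>3\<close> times a sum of squares and tend to \<open>r\<^sup>3/3\<close>, so their characteristic functions
converge to that of \<open>gauss (r\<^sup>3/3)\<close>; as the sums converge pointwise, this is the characteristic function of the area.\<close>

lemma (in prob_space) distr_path_area:
  assumes W: "standard_brownian_motion W" and r: "r \<ge> 0"
  shows "distr M borel (path_area W r) = gauss (r ^ 3 / 3)"
proof -
  have meas: "\<And>t. t \<ge> 0 \<Longrightarrow> W t \<in> borel_measurable M"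
    and zero: "\<And>\<omega>. \<omega> \<in> space M \<Longrightarrow> W 0 \<omega> = 0"
    and cont: "\<And>\<omega>. \<omega> \<in> space M \<Longrightarrow> continuous_on {0..} (\<lambda>t. W t \<omega>)"
    and norm: "\<And>s t. 0 \<le> s \<Longrightarrow> s < t \<Longrightarrow>
        distributed M lborel (\<lambda>\<omega>. W t \<omega> - W s \<omega>) (normal_density 0 (sqrt (t - s)))"
    and ind: "\<And>n (t :: nat \<Rightarrow> real). 0 \<le> t 0 \<Longrightarrow> (\<And>i. i<n \<Longrightarrow> t i \<le> t (Suc i)) \<Longrightarrow>
        indep_vars (\<lambda>_. borel) (\<lambda>i \<omega>. W (t (Suc i)) \<omega> - W (t i) \<omega>) {..<n}"
    using W unfolding standard_brownian_motion_def by auto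
  have am[measurable]: "path_area W r \<in> borel_measurable M"
    by (rule measurable_path_area[OF meas cont r])
  show ?thesis
  proof (cases "r = 0")
    case True
    have z: "path_area W 0 = (\<lambda>_. 0)"
      by (rule ext) (rule path_area_0)
    have d: "distr M borel (path_area W r) = return borel 0"
      by (simp add: True z)
    have "real_distribution (return borel (0::real))"
      unfolding d[symmetric] by (rule real_distribution_distr) (rule am)
    then show ?thesis
      unfolding d by (rule gauss_eqI) (simp_all add: True char_def integral_return)
  next
    case False
    with r have r: "r > 0" by simp
    define x where "x n j = r * real j / real (Suc n)" for n j
    define R where "R n \<omega> = (\<Sum>j<Suc n. r / Suc n * W (x n (Suc j)) \<omega>)" for n \<omega>
    define I where "I n j \<omega> = W (x n (Suc j)) \<omega> - W (x n j) \<omega>" for n j \<omega>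
    have x_nn: "x n j \<ge> 0" for n j using r by (simp add: x_def)
    have x_step: "x n (Suc j) = x n j + r / Suc n" for n j
      by (simp add: x_def distrib_left add_divide_distrib)
    have I_meas[measurable]: "I n j \<in> borel_measurable M" for n j
      unfolding I_def using meas x_nn by auto
    \<comment> \<open>Summation by parts: the increment over the \<open>i\<close>-th step enters the values at all later grid points.\<close>
    have R_eq: "R n \<omega> = (\<Sum>i<Suc n. (r / Suc n * real (Suc n - i)) * I n i \<omega>)" if w: "\<omega> \<in> space M" for n \<omega>
    proof -
      have "(\<Sum>j<m. W (x n (Suc j)) \<omega>) = (\<Sum>i<m. real (m - i) * I n i \<omega>)" for m
      proof (induction m)
        case (Suc m)
        have "(\<Sum>i<Suc m. real (Suc m - i) * I n i \<omega>) = (\<Sum>i<Suc m. real (m - i) * I n i \<omega> + I n i \<omega>)"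
          by (rule sum.cong) (auto simp: Suc_diff_le algebra_simps)
        also have "\<dots> = (\<Sum>i<m. real (m - i) * I n i \<omega>) + (\<Sum>i<Suc m. I n i \<omega>)"
          by (simp add: sum.distrib)
        also have "(\<Sum>i<Suc m. I n i \<omega>) = W (x n (Suc m)) \<omega> - W (x n 0) \<omega>"
          unfolding I_def by (rule sum_lessThan_telescope)
        also have "W (x n 0) \<omega> = 0" using zero[OF w] by (simp add: x_def)
        finally show ?case using Suc by simp
      qed simp
      then show ?thesis
        unfolding R_def by (simp only: sum_distrib_left[symmetric] mult.assoc)
    qed
    define s where "s n = (\<Sum>i<Suc n. (r / Suc n * real (Suc n - i))\<^sup>2 * (r / Suc n))" for n
    have char_R: "char (distr M borel (R n)) u = complex_of_real (exp (- (s n * u\<^sup>2) / 2))" for n u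
    proof -
      define c where "c i = r / Suc n * real (Suc n - i)" for i
      have "indep_vars (\<lambda>_. borel) (I n) {..<Suc n}"
        unfolding I_def using ind[of "x n" "Suc n"] x_nn x_step r by (auto simp: x_def)
      then have "indep_vars (\<lambda>_. borel) (\<lambda>i. (\<lambda>y. c i * y) \<circ> I n i) {..<Suc n}"
        by (rule indep_vars_compose) auto
      then have iv: "indep_vars (\<lambda>_. borel) (\<lambda>i \<omega>. c i * I n i \<omega>) {..<Suc n}"
        by (simp add: comp_def)
      have "char (distr M borel (R n)) u = char (distr M borel (\<lambda>\<omega>. \<Sum>i<Suc n. c i * I n i \<omega>)) u"
        by (rule arg_cong[of _ _ "\<lambda>D. char D u"], rule distr_cong) (auto simp: R_eq c_def)
      also have "\<dots> = (\<Prod>i<Suc n. char (distr M borel (\<lambda>\<omega>. c i * I n i \<omega>)) u)"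
        by (rule char_distr_sum[OF iv])
      also have "\<dots> = (\<Prod>i<Suc n. complex_of_real (exp (- ((r / Suc n) * (c i * u)\<^sup>2) / 2)))"
      proof (rule prod.cong[OF refl])
        fix i
        have "distr M borel (I n i) = gauss ((sqrt (x n (Suc i) - x n i))\<^sup>2)"
          unfolding I_def using x_step[of n i] r x_nn[of n i]
          by (intro distr_normal_gauss norm) auto
        then have g: "distr M borel (I n i) = gauss (r / Suc n)"
          using x_step[of n i] r by simp
        have "char (distr M borel (\<lambda>\<omega>. c i * I n i \<omega>)) u = char (distr M borel (I n i)) (c i * u)"
          unfolding char_def by (simp add: integral_distr ac_simps)
        also have "\<dots> = complex_of_real (exp (- ((r / Suc n) * (c i * u)\<^sup>2) / 2))"
          unfolding g by (rule char_gauss) (use r in auto)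
        finally show "char (distr M borel (\<lambda>\<omega>. c i * I n i \<omega>)) u = complex_of_real (exp (- ((r / Suc n) * (c i * u)\<^sup>2) / 2))" .
      qed
      also have "\<dots> = complex_of_real (exp (\<Sum>i<Suc n. - ((r / Suc n) * (c i * u)\<^sup>2) / 2))"
        by (simp only: of_real_prod[symmetric] exp_sum[OF finite_lessThan])
      also have "(\<Sum>i<Suc n. - ((r / Suc n) * (c i * u)\<^sup>2) / 2) = - (s n * u\<^sup>2) / 2"
        unfolding s_def c_def[symmetric] sum_distrib_right sum_divide_distrib sum_negf[symmetric]
        by (rule sum.cong) (auto simp: power_mult_distrib)
      finally show ?thesis .
    qed
    have s_lim: "s \<longlonglongrightarrow> r^3 / 3"
    proof -
      have "s n = r^3 * ((\<Sum>m\<le>Suc n. (real m)\<^sup>2) / (real (Suc n))^3)" for n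
      proof -
        have "(\<Sum>i<Suc n. (real (Suc n - i))\<^sup>2) = (\<Sum>i<Suc n. (real (Suc (Suc n - Suc i)))\<^sup>2)"
          by (rule sum.cong) (auto simp: Suc_diff_Suc)
        also have "\<dots> = (\<Sum>i<Suc n. (real (Suc i))\<^sup>2)"
          by (rule sum.nat_diff_reindex)
        also have "\<dots> = (\<Sum>m\<le>Suc n. (real m)\<^sup>2)"
          unfolding sum.atMost_shift lessThan_Suc_atMost by simp
        finally have e: "(\<Sum>i<Suc n. (real (Suc n - i))\<^sup>2) = (\<Sum>m\<le>Suc n. (real m)\<^sup>2)" .
        have "s n = (\<Sum>i<Suc n. (r^3 / real (Suc n)^3) * (real (Suc n - i))\<^sup>2)"
          unfolding s_def by (rule sum.cong) (auto simp: power_mult_distrib power_divide power2_eq_square power3_eq_cube)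
        then show ?thesis unfolding sum_distrib_left[symmetric] e by simp
      qed
      then have "s = (\<lambda>n. r^3 * ((\<Sum>m\<le>Suc n. (real m)\<^sup>2) / (real (Suc n))^3))" by auto
      then show ?thesis
        using tendsto_mult_left[OF LIMSEQ_Suc[OF sum_squares_asymptotic], of "r^3"] by simp
    qed
    have R_lim: "(\<lambda>n. R n \<omega>) \<longlonglongrightarrow> path_area W r \<omega>" if "\<omega> \<in> space M" for \<omega>
      unfolding R_def path_area_def x_def
      by (rule riemann_sums_tendsto[OF continuous_on_subset[OF cont[OF that]]]) (use r in auto)
    have R_meas[measurable]: "R n \<in> borel_measurable M" for n
      unfolding R_def using meas x_nn by auto
    show ?thesis
    proof (rule gauss_eqI)
      show "real_distribution (distr M borel (path_area W r))" by (rule real_distribution_distr) simp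
      fix u
      have "(\<lambda>n. (CLINT \<omega>|M. iexp (u * R n \<omega>))) \<longlonglongrightarrow> (CLINT \<omega>|M. iexp (u * path_area W r \<omega>))"
      proof (rule integral_dominated_convergence[where w="\<lambda>_. 1"])
        show "AE \<omega> in M. (\<lambda>n. iexp (u * R n \<omega>)) \<longlonglongrightarrow> iexp (u * path_area W r \<omega>)"
          by (intro AE_I2 tendsto_intros R_lim)
      qed auto
      then have "(\<lambda>n. char (distr M borel (R n)) u) \<longlonglongrightarrow> char (distr M borel (path_area W r)) u"
        unfolding char_def by (simp add: integral_distr)
      moreover have "(\<lambda>n. char (distr M borel (R n)) u) \<longlonglongrightarrow> complex_of_real (exp (- (r^3 / 3 * u\<^sup>2) / 2))"
        unfolding char_R by (intro tendsto_intros s_lim) auto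
      ultimately show "char (distr M borel (path_area W r)) u = complex_of_real (exp (- (r^3 / 3 * u\<^sup>2) / 2))"
        by (rule LIMSEQ_unique)
    qed (use r in auto)
  qed
qed

section \<open>The area of the reset path\<close>

lemma renewal_time_0: "renewal_time S 0 \<omega> = 0"
  by (simp add: renewal_time_def)

lemma renewal_time_Suc: "renewal_time S (Suc n) \<omega> = renewal_time S n \<omega> + S (Suc n) \<omega>"
  by (simp add: renewal_time_def)

lemma renewal_time_mono:
  assumes "\<And>i. i \<ge> 1 \<Longrightarrow> S i \<omega> \<ge> 0" "m \<le> n"
  shows "renewal_time S m \<omega> \<le> renewal_time S n \<omega>"
  using assms(2) by (rule lift_Suc_mono_le[rotated]) (simp add: renewal_time_Suc assms(1))

lemma num_renewals_eq:
  assumes nn: "\<And>i. i \<ge> 1 \<Longrightarrow> S i \<omega> \<ge> 0"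
    and "renewal_time S n \<omega> \<le> \<tau>" "\<tau> < renewal_time S (Suc n) \<omega>"
  shows "num_renewals S \<tau> \<omega> = n"
proof -
  have "{m. renewal_time S m \<omega> \<le> \<tau>} = {..n}"
  proof (intro set_eqI iffI)
    fix m assume "m \<in> {m. renewal_time S m \<omega> \<le> \<tau>}"
    then show "m \<in> {..n}"
      using renewal_time_mono[of S \<omega> "Suc n" m, OF nn] assms(3) by force
  next
    fix m assume "m \<in> {..n}"
    then show "m \<in> {m. renewal_time S m \<omega> \<le> \<tau>}"
      using renewal_time_mono[of S \<omega> m n, OF nn] assms(2) by force
  qed
  then show ?thesis
    by (simp add: num_renewals_def cSup_eq_maximum)
qed

lemma renewal_index_exists:
  assumes "0 \<le> \<tau>" "\<not> (\<forall>n. renewal_time S n \<omega> \<le> \<tau>)"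
  obtains n where "renewal_time S n \<omega> \<le> \<tau>" "\<tau> < renewal_time S (Suc n) \<omega>"
    "n = (LEAST n. \<tau> < renewal_time S (Suc n) \<omega>)"
proof -
  define n where "n = (LEAST n. \<tau> < renewal_time S (Suc n) \<omega>)"
  from assms(2) obtain m where m: "\<tau> < renewal_time S m \<omega>" by (meson not_le)
  with assms(1) have "m \<noteq> 0" by (cases m) (auto simp: renewal_time_0)
  with m have "\<tau> < renewal_time S (Suc (m - 1)) \<omega>" by simp
  then have 1: "\<tau> < renewal_time S (Suc n) \<omega>" unfolding n_def by (rule LeastI)
  have "renewal_time S n \<omega> \<le> \<tau>"
  proof (cases n)
    case 0
    then show ?thesis using assms by (simp add: renewal_time_0)
  next
    case (Suc k)
    have "\<not> \<tau> < renewal_time S (Suc k) \<omega>"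
      using not_less_Least[of k "\<lambda>n. \<tau> < renewal_time S (Suc n) \<omega>"] Suc by (simp add: n_def)
    then show ?thesis using Suc by simp
  qed
  then show ?thesis using 1 n_def that by blast
qed

lemma measurable_renewal_time [measurable (raw)]:
  assumes "\<And>i. i \<ge> 1 \<Longrightarrow> S i \<in> borel_measurable N"
  shows "renewal_time S n \<in> borel_measurable N"
  unfolding renewal_time_def[abs_def] using assms by auto

text \<open>Stated for an arbitrary measurable space because it is applied to the product of the \<open>\<sigma>\<close>-algebras of the
Brownian motions and of the waiting times. On the event of infinitely many renewals before some time the renewal
count is the unspecified constant \<open>Sup UNIV\<close>, which is treated as a third case of the count.\<close>

lemma measurable_reset_area:
  fixes S :: "nat \<Rightarrow> 'a \<Rightarrow> real" and B :: "nat \<Rightarrow> real \<Rightarrow> 'a \<Rightarrow> real"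
  assumes S: "\<And>i. i \<ge> 1 \<Longrightarrow> S i \<in> borel_measurable N"
    and nn: "\<And>i \<omega>. i \<ge> 1 \<Longrightarrow> \<omega> \<in> space N \<Longrightarrow> S i \<omega> \<ge> 0"
    and B: "\<And>i t. i \<ge> 1 \<Longrightarrow> t \<ge> 0 \<Longrightarrow> B i t \<in> borel_measurable N"
    and cont: "\<And>i \<omega>. i \<ge> 1 \<Longrightarrow> \<omega> \<in> space N \<Longrightarrow> continuous_on {0..} (\<lambda>t. B i t \<omega>)"
  shows "reset_area S B t \<in> borel_measurable N"
proof -
  define T where "T = renewal_time S"
  have T[measurable]: "T n \<in> borel_measurable N" for n
    unfolding T_def by (rule measurable_renewal_time) (rule S)
  define K where "K x = (if \<forall>n. T n (fst x) \<le> snd x then Sup UNIV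
     else if snd x < 0 then 0 else (LEAST n. snd x < T (Suc n) (fst x)))" for x :: "'a \<times> real"
  have K[measurable]: "K \<in> measurable (N \<Otimes>\<^sub>M lborel) (count_space UNIV)"
    unfolding K_def[abs_def] by measurable
  have K_eq: "num_renewals S \<tau> \<omega> = K (\<omega>, \<tau>)" and K_le: "T (K (\<omega>, \<tau>)) \<omega> \<le> \<tau>"
    if w: "\<omega> \<in> space N" and tau: "\<tau> \<ge> 0" for \<omega> \<tau>
  proof -
    have "num_renewals S \<tau> \<omega> = K (\<omega>, \<tau>) \<and> T (K (\<omega>, \<tau>)) \<omega> \<le> \<tau>"
    proof (cases "\<forall>n. T n \<omega> \<le> \<tau>")
      case True
      then show ?thesis by (simp add: K_def num_renewals_def T_def)
    next
      case False
      then obtain n where n: "T n \<omega> \<le> \<tau>" "\<tau> < T (Suc n) \<omega>" "n = (LEAST n. \<tau> < T (Suc n) \<omega>)"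
        using renewal_index_exists[OF tau] unfolding T_def by metis
      have "num_renewals S \<tau> \<omega> = n"
        using n nn[OF _ w] unfolding T_def by (intro num_renewals_eq) auto
      moreover have "K (\<omega>, \<tau>) = n" 
        unfolding K_def fst_conv snd_conv by (subst if_not_P[OF False]) (use tau n(3) in simp)
      ultimately show ?thesis using n(1) by simp
    qed
    then show "num_renewals S \<tau> \<omega> = K (\<omega>, \<tau>)" "T (K (\<omega>, \<tau>)) \<omega> \<le> \<tau>" by auto
  qed
  define G where "G x = B (K x + 1) (max 0 (snd x - T (K x) (fst x))) (fst x)" for x
  have "(\<lambda>x. B (n + 1) (max 0 (snd x - T n (fst x))) (fst x)) \<in> borel_measurable (N \<Otimes>\<^sub>M lborel)" for n
    by (rule measurable_eval_continuous[where N = N]) (use B cont in auto)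
  then have [measurable]: "G \<in> borel_measurable (N \<Otimes>\<^sub>M lborel)"
    unfolding G_def[abs_def] by (rule measurable_compose_countable) (rule K)
  have "(\<lambda>\<omega>. \<integral>\<tau>. indicat_real {0..t} \<tau> *\<^sub>R G (\<omega>, \<tau>) \<partial>lborel) \<in> borel_measurable N"
    by measurable
  moreover have "reset_area S B t \<omega> = (\<integral>\<tau>. indicat_real {0..t} \<tau> *\<^sub>R G (\<omega>, \<tau>) \<partial>lborel)"
    if w: "\<omega> \<in> space N" for \<omega>
    unfolding reset_area_def set_lebesgue_integral_def
  proof (rule Bochner_Integration.integral_cong[OF refl])
    fix \<tau>
    show "indicat_real {0..t} \<tau> *\<^sub>R reset_bm S B \<tau> \<omega> = indicat_real {0..t} \<tau> *\<^sub>R G (\<omega>, \<tau>)"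
      using K_eq[OF w, of \<tau>] K_le[OF w, of \<tau>]
      by (auto simp: indicator_def reset_bm_def G_def T_def Let_def max_def)
  qed
  ultimately show ?thesis
    by (subst measurable_cong) auto
qed

lemma has_bochner_integral_shifted_path:
  assumes cont: "continuous_on {0..} (\<lambda>t. W t \<omega>)" and "r \<ge> 0"
  shows "has_bochner_integral lborel (\<lambda>\<tau>. indicat_real {a..a+r} \<tau> *\<^sub>R W (\<tau> - a) \<omega>) (path_area W r \<omega>)"
    and "has_bochner_integral lborel (\<lambda>\<tau>. indicat_real {a..<a+r} \<tau> *\<^sub>R W (\<tau> - a) \<omega>) (path_area W r \<omega>)"
proof -
  have "set_integrable lborel {0..r} (\<lambda>t. W t \<omega>)"
    by (rule borel_integrable_atLeastAtMost', rule continuous_on_subset[OF cont]) auto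
  then have "has_bochner_integral lborel (\<lambda>\<tau>. indicat_real {0..r} \<tau> *\<^sub>R W \<tau> \<omega>) (path_area W r \<omega>)"
    unfolding set_integrable_def path_area_def set_lebesgue_integral_def
    by (rule has_bochner_integral_integrable)
  then have "has_bochner_integral lborel (\<lambda>\<tau>. indicat_real {0..r} (-a + 1 * \<tau>) *\<^sub>R W (-a + 1 * \<tau>) \<omega>) (path_area W r \<omega> /\<^sub>R \<bar>1\<bar>)"
    by (subst (asm) lborel_has_bochner_integral_real_affine_iff[of 1 _ _ "-a"]) auto
  moreover have "indicat_real {0..r} (-a + 1 * \<tau>) = indicat_real {a..a+r} \<tau>" for \<tau>
    by (auto simp: indicator_def)
  ultimately show 1: "has_bochner_integral lborel (\<lambda>\<tau>. indicat_real {a..a+r} \<tau> *\<^sub>R W (\<tau> - a) \<omega>) (path_area W r \<omega>)"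
    by simp
  then have m[measurable]: "(\<lambda>\<tau>. indicat_real {a..a+r} \<tau> *\<^sub>R W (\<tau> - a) \<omega>) \<in> borel_measurable lborel"
    by (auto simp: has_bochner_integral_iff)
  have e: "(\<lambda>\<tau>. indicat_real {a..<a+r} \<tau> *\<^sub>R W (\<tau> - a) \<omega>) =
      (\<lambda>\<tau>. indicat_real {..<a+r} \<tau> *\<^sub>R (indicat_real {a..a+r} \<tau> *\<^sub>R W (\<tau> - a) \<omega>))"
    by (auto simp: indicator_def fun_eq_iff)
  have "AE \<tau> in lborel. indicat_real {a..a+r} \<tau> *\<^sub>R W (\<tau> - a) \<omega> = indicat_real {a..<a+r} \<tau> *\<^sub>R W (\<tau> - a) \<omega>"
    using AE_lborel_singleton[of "a + r"] by eventually_elim (auto simp: indicator_def)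
  moreover have "(\<lambda>\<tau>. indicat_real {a..<a+r} \<tau> *\<^sub>R W (\<tau> - a) \<omega>) \<in> borel_measurable lborel"
    unfolding e by measurable
  ultimately show "has_bochner_integral lborel (\<lambda>\<tau>. indicat_real {a..<a+r} \<tau> *\<^sub>R W (\<tau> - a) \<omega>) (path_area W r \<omega>)"
    using 1 m by (subst (asm) has_bochner_integral_cong_AE) auto
qed

text \<open>The waiting times are taken at \<open>\<omega>\<close> and the paths at \<open>\<omega>'\<close>: the two are varied independently later on.\<close>

lemma reset_area_eq:
  assumes nn: "\<And>i. i \<ge> 1 \<Longrightarrow> S i \<omega> \<ge> 0"
    and cont: "\<And>i. i \<ge> 1 \<Longrightarrow> continuous_on {0..} (\<lambda>t. B i t \<omega>')"
    and n: "renewal_time S n \<omega> \<le> t" "t < renewal_time S (Suc n) \<omega>"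
  shows "reset_area (\<lambda>i _. S i \<omega>) B t \<omega>' =
    (\<Sum>i=1..n. path_area (B i) (S i \<omega>) \<omega>') + path_area (B (n + 1)) (t - renewal_time S n \<omega>) \<omega>'"
proof -
  define f where "f \<tau> = reset_bm (\<lambda>i _. S i \<omega>) B \<tau> \<omega>'" for \<tau>
  define T where "T n = renewal_time S n \<omega>" for n
  have T': "renewal_time (\<lambda>i _. S i \<omega>) n \<omega>' = T n" for n
    by (simp add: renewal_time_def T_def)
  have f: "f \<tau> = B (n + 1) (\<tau> - T n) \<omega>'" if "T n \<le> \<tau>" "\<tau> < T (Suc n)" for n \<tau>
    using num_renewals_eq[of "\<lambda>i _. S i \<omega>" \<omega>' n \<tau>] nn that
    by (simp add: f_def reset_bm_def T')
  have Tm: "0 \<le> T n" for n using renewal_time_mono[of S \<omega> 0 n, OF nn] by (simp add: T_def renewal_time_0)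
  have *: "has_bochner_integral lborel (\<lambda>\<tau>. indicat_real {0..<T j} \<tau> *\<^sub>R f \<tau>) (\<Sum>i=1..j. path_area (B i) (S i \<omega>) \<omega>')" for j
  proof (induction j)
    case 0
    then show ?case by (simp add: T_def renewal_time_0 has_bochner_integral_zero)
  next
    case (Suc j)
    have S: "S (Suc j) \<omega> \<ge> 0" using nn by simp
    have T: "T (Suc j) = T j + S (Suc j) \<omega>" by (simp add: T_def renewal_time_Suc)
    have e: "(\<lambda>\<tau>. indicat_real {0..<T (Suc j)} \<tau> *\<^sub>R f \<tau>) =
      (\<lambda>\<tau>. indicat_real {0..<T j} \<tau> *\<^sub>R f \<tau> + indicat_real {T j..<T j + S (Suc j) \<omega>} \<tau> *\<^sub>R B (Suc j) (\<tau> - T j) \<omega>')"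
      using Tm[of j] S f[of j] unfolding T by (auto simp: indicator_def fun_eq_iff)
    show ?case unfolding e
      using has_bochner_integral_add[OF Suc has_bochner_integral_shifted_path(2)[of "B (Suc j)" \<omega>' _ "T j", OF cont S]]
      by simp
  qed
  have r: "t - T n \<ge> 0" using n by (simp add: T_def)
  have e: "(\<lambda>\<tau>. indicat_real {0..t} \<tau> *\<^sub>R f \<tau>) =
      (\<lambda>\<tau>. indicat_real {0..<T n} \<tau> *\<^sub>R f \<tau> + indicat_real {T n..T n + (t - T n)} \<tau> *\<^sub>R B (n + 1) (\<tau> - T n) \<omega>')"
    using Tm[of n] r n(2) f[of n] unfolding T_def[symmetric] by (auto simp: indicator_def fun_eq_iff)
  have "has_bochner_integral lborel (\<lambda>\<tau>. indicat_real {0..t} \<tau> *\<^sub>R f \<tau>)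
      ((\<Sum>i=1..n. path_area (B i) (S i \<omega>) \<omega>') + path_area (B (n + 1)) (t - T n) \<omega>')"
    unfolding e
    by (rule has_bochner_integral_add[OF * has_bochner_integral_shifted_path(1)[of "B (n + 1)" \<omega>' _ "T n", OF cont r]]) simp
  then show ?thesis
    unfolding reset_area_def set_lebesgue_integral_def f_def T_def
    by (rule has_bochner_integral_integral_eq)
qed

section \<open>The law of the area given the waiting times\<close>

text \<open>The waiting times are indexed from 1, and facts about \<open>S 1\<close> should not be rewritten to \<open>S (Suc 0)\<close>.\<close>

declare One_nat_def [simp del]

lemma generated_sets_into_space: "generated_sets M X J \<subseteq> Pow (space M)"
proof
  fix A assume "A \<in> generated_sets M X J"
  then have "A \<subseteq> space M"
    unfolding generated_sets_def by (rule sigma_sets_into_sp[rotated]) auto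
  then show "A \<in> Pow (space M)" by simp
qed

lemma measurable_generated_sets:
  assumes "j \<in> J"
  shows "X j \<in> borel_measurable (sigma (space M) (generated_sets M X J))"
proof (rule measurableI)
  fix A :: "real set" assume "A \<in> sets borel"
  with assms have "X j -` A \<inter> space M \<in> generated_sets M X J"
    unfolding generated_sets_def by (intro sigma_sets.Basic) auto
  then show "X j -` A \<inter> space (sigma (space M) (generated_sets M X J))
      \<in> sets (sigma (space M) (generated_sets M X J))"
    using generated_sets_into_space[of M X J] by (simp add: sets_measure_of)
qed auto

lemma sets_sigma_generated_sets:
  "sets (sigma (space M) (generated_sets M X J)) = generated_sets M X J"
proof -
  have "sets (sigma (space M) (generated_sets M X J)) = sigma_sets (space M) (generated_sets M X J)"
    by (simp add: sets_measure_of generated_sets_into_space)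
  also have "\<dots> = generated_sets M X J"
    unfolding generated_sets_def by (rule sigma_sets_sigma_sets_eq) auto
  finally show ?thesis .
qed

lemma generated_sets_subset:
  assumes "\<And>j. j \<in> J \<Longrightarrow> X j \<in> borel_measurable M"
  shows "generated_sets M X J \<subseteq> sets M"
  unfolding generated_sets_def
  by (rule sets.sigma_sets_subset) (use assms in \<open>auto dest: measurable_sets\<close>)

context resetting
begin

abbreviation "sigma_B \<equiv> sigma (space M) (generated_sets M (\<lambda>(i, t). B i t) ({1..} \<times> {0..}))"
abbreviation "sigma_S \<equiv> sigma (space M) (generated_sets M S {1..})"

lemma S_measurable: "i \<ge> 1 \<Longrightarrow> S i \<in> borel_measurable M"
  using S_indep by (auto simp: indep_vars_def)

lemma B_measurable: "i \<ge> 1 \<Longrightarrow> t \<ge> 0 \<Longrightarrow> B i t \<in> borel_measurable M"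
  using B_brownian by (auto simp: standard_brownian_motion_def)

lemma B_continuous: "i \<ge> 1 \<Longrightarrow> \<omega> \<in> space M \<Longrightarrow> continuous_on {0..} (\<lambda>t. B i t \<omega>)"
  using B_brownian by (auto simp: standard_brownian_motion_def)

lemma B_measurable_sigma_B: "i \<ge> 1 \<Longrightarrow> t \<ge> 0 \<Longrightarrow> B i t \<in> borel_measurable sigma_B"
  using measurable_generated_sets[of "(i, t)" "{1..} \<times> {0..}" "\<lambda>(i, t). B i t" M] by simp

lemma S_measurable_sigma_S: "i \<ge> 1 \<Longrightarrow> S i \<in> borel_measurable sigma_S"
  using measurable_generated_sets[of i "{1..}" S M] by simp

text \<open>Freezing the waiting times: the map \<open>\<omega> \<mapsto> (\<omega>, \<omega>)\<close> sends \<open>M\<close> to the product measure on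
\<open>sigma_B \<Otimes>\<^sub>M sigma_S\<close>, because its two components are independent. This replaces conditional expectations
given the waiting times by an iterated integral.\<close>

lemma nn_integral_freeze_S:
  assumes f: "f \<in> borel_measurable (sigma_B \<Otimes>\<^sub>M sigma_S)"
  shows "(\<integral>\<^sup>+\<omega>. f (\<omega>, \<omega>) \<partial>M) = (\<integral>\<^sup>+\<omega>'. (\<integral>\<^sup>+\<omega>. f (\<omega>, \<omega>') \<partial>M) \<partial>M)"
proof -
  have sub: "generated_sets M X J \<subseteq> Pow (space M)" for X :: "'i \<Rightarrow> 'a \<Rightarrow> real" and J
    by (rule generated_sets_into_space)
  have id: "(\<lambda>x. x) \<in> measurable M (sigma (space M) (generated_sets M X J))"
    if "generated_sets M X J \<subseteq> sets M" for X :: "'i \<Rightarrow> 'a \<Rightarrow> real" and J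
    using that sub[of X J] by (intro measurable_measure_of) (auto simp: Int_absorb2)
  have B: "(\<lambda>x. x) \<in> measurable M sigma_B"
    by (rule id, rule generated_sets_subset) (auto simp: B_measurable)
  have S: "(\<lambda>x. x) \<in> measurable M sigma_S"
    by (rule id, rule generated_sets_subset) (auto simp: S_measurable)
  have *: "sigma_sets (space M) {(\<lambda>x. x) -` A \<inter> space M |A. A \<in> generated_sets M X J} = generated_sets M X J"
    for X :: "'i \<Rightarrow> 'a \<Rightarrow> real" and J
  proof -
    have "{(\<lambda>x. x) -` A \<inter> space M |A. A \<in> generated_sets M X J} = generated_sets M X J"
    proof (intro set_eqI iffI)
      fix A assume A: "A \<in> generated_sets M X J"
      then have "A = (\<lambda>x. x) -` A \<inter> space M" using sub[of X J] by auto
      with A show "A \<in> {(\<lambda>x. x) -` A \<inter> space M |A. A \<in> generated_sets M X J}" by blast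
    next
      fix A assume "A \<in> {(\<lambda>x. x) -` A \<inter> space M |A. A \<in> generated_sets M X J}"
      then obtain A' where "A = A' \<inter> space M" "A' \<in> generated_sets M X J" by auto
      then show "A \<in> generated_sets M X J" using sub[of X J] by (auto simp: Int_absorb2 subset_eq)
    qed
    then show ?thesis
      using sets.sigma_sets_eq[of "sigma (space M) (generated_sets M X J)"]
      by (simp add: sets_sigma_generated_sets space_measure_of_conv)
  qed
  have "indep_var sigma_B (\<lambda>x. x) sigma_S (\<lambda>x. x)"
    unfolding indep_var_eq sets_sigma_generated_sets * using B S B_S_indep by simp
  then have d: "distr M sigma_B (\<lambda>x. x) \<Otimes>\<^sub>M distr M sigma_S (\<lambda>x. x) =
      distr M (sigma_B \<Otimes>\<^sub>M sigma_S) (\<lambda>x. (x, x))"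
    by (simp add: indep_var_distribution_eq)
  interpret PB: prob_space "distr M sigma_B (\<lambda>x. x)" by (rule prob_space_distr[OF B])
  interpret PS: prob_space "distr M sigma_S (\<lambda>x. x)" by (rule prob_space_distr[OF S])
  interpret P: pair_prob_space "distr M sigma_B (\<lambda>x. x)" "distr M sigma_S (\<lambda>x. x)" ..
  have "(\<integral>\<^sup>+\<omega>. f (\<omega>, \<omega>) \<partial>M) = integral\<^sup>N (distr M (sigma_B \<Otimes>\<^sub>M sigma_S) (\<lambda>x. (x, x))) f"
    by (subst nn_integral_distr) (use B S f in \<open>auto intro: measurable_Pair\<close>)
  also have "\<dots> = (\<integral>\<^sup>+\<omega>'. (\<integral>\<^sup>+\<omega>. f (\<omega>, \<omega>') \<partial>distr M sigma_B (\<lambda>x. x)) \<partial>distr M sigma_S (\<lambda>x. x))"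
    unfolding d[symmetric] by (rule P.nn_integral_snd[symmetric]) (use f in \<open>simp cong: measurable_cong_sets\<close>)
  also have "\<dots> = (\<integral>\<^sup>+\<omega>'. (\<integral>\<^sup>+\<omega>. f (\<omega>, \<omega>') \<partial>distr M sigma_B (\<lambda>x. x)) \<partial>M)"
  proof (rule nn_integral_distr[OF S])
    have "(\<lambda>x. f (snd x, fst x)) \<in> borel_measurable (distr M sigma_S (\<lambda>x. x) \<Otimes>\<^sub>M distr M sigma_B (\<lambda>x. x))"
      using measurable_pair_swap[OF f] by (simp add: case_prod_unfold cong: measurable_cong_sets)
    then show "(\<lambda>\<omega>'. \<integral>\<^sup>+\<omega>. f (\<omega>, \<omega>') \<partial>distr M sigma_B (\<lambda>x. x)) \<in> borel_measurable (distr M sigma_S (\<lambda>x. x))"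
      by (intro PB.borel_measurable_nn_integral) (simp add: case_prod_unfold)
  qed
  also have "\<dots> = (\<integral>\<^sup>+\<omega>'. (\<integral>\<^sup>+\<omega>. f (\<omega>, \<omega>') \<partial>M) \<partial>M)"
    by (intro nn_integral_cong nn_integral_distr[OF B])
      (simp add: measurable_compose[OF measurable_Pair2' f] space_measure_of_conv)
  finally show ?thesis .
qed

lemma indep_path_areas:
  assumes "\<And>i. i \<ge> 1 \<Longrightarrow> r i \<ge> 0"
  shows "indep_vars (\<lambda>_. borel) (\<lambda>i. path_area (B i) (r i)) {1..}"
  unfolding indep_vars_def2
proof (intro conjI ballI)
  fix i :: nat assume "i \<in> {1..}"
  then show "random_variable borel (path_area (B i) (r i))"
    using assms by (intro measurable_path_area B_measurable B_continuous) auto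
next
  show "indep_sets (\<lambda>i. {path_area (B i) (r i) -` A \<inter> space M |A. A \<in> sets borel}) {1..}"
  proof (rule indep_sets_mono_sets[OF B_indep])
    fix i :: nat assume i: "i \<in> {1..}"
    have "path_area (B i) (r i) \<in> borel_measurable (sigma (space M) (generated_sets M (B i) {0..}))"
      using i assms by (intro measurable_path_area measurable_generated_sets B_continuous) (auto simp: space_measure_of_conv)
    then show "{path_area (B i) (r i) -` A \<inter> space M |A. A \<in> sets borel} \<subseteq> generated_sets M (B i) {0..}"
      by (auto dest!: measurable_sets simp: sets_sigma_generated_sets space_measure_of_conv)
  qed
qed

lemma distr_sum_path_areas:
  assumes "\<And>i. i \<ge> 1 \<Longrightarrow> r i \<ge> 0"
  shows "distr M borel (\<lambda>\<omega>. \<Sum>i=1..n. path_area (B i) (r i) \<omega>) = gauss ((\<Sum>i=1..n. r i ^ 3) / 3)"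
proof (rule gauss_eqI)
  have "indep_vars (\<lambda>_. borel) (\<lambda>i. path_area (B i) (r i)) {1..}"
    by (rule indep_path_areas) (rule assms)
  then have iv: "indep_vars (\<lambda>_. borel) (\<lambda>i. path_area (B i) (r i)) {1..n}"
    by (rule indep_vars_subset) auto
  then show "real_distribution (distr M borel (\<lambda>\<omega>. \<Sum>i=1..n. path_area (B i) (r i) \<omega>))"
    by (intro real_distribution_distr borel_measurable_sum) (auto simp: indep_vars_def)
  show "0 \<le> (\<Sum>i=1..n. r i ^ 3) / 3" using assms by (auto intro!: sum_nonneg)
  fix u
  have "char (distr M borel (\<lambda>\<omega>. \<Sum>i=1..n. path_area (B i) (r i) \<omega>)) u =
      (\<Prod>i=1..n. char (distr M borel (path_area (B i) (r i))) u)"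
    by (rule char_distr_sum[OF iv])
  also have "\<dots> = (\<Prod>i=1..n. complex_of_real (exp (- (r i ^ 3 / 3 * u\<^sup>2) / 2)))"
    using assms by (intro prod.cong refl) (simp add: distr_path_area[OF B_brownian] char_gauss)
  also have "\<dots> = complex_of_real (exp (\<Sum>i=1..n. - (r i ^ 3 / 3 * u\<^sup>2) / 2))"
    by (simp only: of_real_prod[symmetric] exp_sum[OF finite_atLeastAtMost])
  also have "(\<Sum>i=1..n. - (r i ^ 3 / 3 * u\<^sup>2) / 2) = - ((\<Sum>i=1..n. r i ^ 3) / 3 * u\<^sup>2) / 2"
    unfolding sum_distrib_right sum_divide_distrib sum_negf[symmetric] ..
  finally show "char (distr M borel (\<lambda>\<omega>. \<Sum>i=1..n. path_area (B i) (r i) \<omega>)) u =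
      complex_of_real (exp (- ((\<Sum>i=1..n. r i ^ 3) / 3 * u\<^sup>2) / 2))" .
qed

lemma nn_integral_first_area:
  fixes g :: "real \<times> real \<Rightarrow> ennreal"
  assumes [measurable]: "g \<in> borel_measurable borel"
  shows "(\<integral>\<^sup>+\<omega>. g (S 1 \<omega>, first_area S B \<omega>) \<partial>M) =
    (\<integral>\<^sup>+\<omega>. (\<integral>\<^sup>+x. g (S 1 \<omega>, x) \<partial>gauss (S 1 \<omega> ^ 3 / 3)) \<partial>M)"
proof -
  have [measurable]: "S 1 \<in> borel_measurable sigma_S" by (rule S_measurable_sigma_S) simp
  have [measurable]: "(\<lambda>x. B 1 (max 0 (snd x)) (fst (fst x))) \<in> borel_measurable ((sigma_B \<Otimes>\<^sub>M sigma_S) \<Otimes>\<^sub>M lborel)"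
    by (rule measurable_eval_continuous[where N = sigma_B]) (auto intro!: B_measurable_sigma_B B_continuous simp: space_measure_of_conv)
  define G where "G x = (if 0 \<le> snd x \<and> snd x \<le> S 1 (snd (fst x)) then B 1 (max 0 (snd x)) (fst (fst x)) else 0)" for x
  have [measurable]: "G \<in> borel_measurable ((sigma_B \<Otimes>\<^sub>M sigma_S) \<Otimes>\<^sub>M lborel)"
    unfolding G_def[abs_def] by measurable
  have "(\<lambda>x. \<integral>\<tau>. G (x, \<tau>) \<partial>lborel) \<in> borel_measurable (sigma_B \<Otimes>\<^sub>M sigma_S)"
    by measurable
  moreover have "(\<integral>\<tau>. G (x, \<tau>) \<partial>lborel) = path_area (B 1) (S 1 (snd x)) (fst x)" for x
    unfolding path_area_def set_lebesgue_integral_def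
    by (rule Bochner_Integration.integral_cong) (auto simp: indicator_def G_def)
  ultimately have [measurable]: "(\<lambda>x. path_area (B 1) (S 1 (snd x)) (fst x)) \<in> borel_measurable (sigma_B \<Otimes>\<^sub>M sigma_S)"
    by simp
  have f: "(\<lambda>x. g (S 1 (snd x), path_area (B 1) (S 1 (snd x)) (fst x))) \<in> borel_measurable (sigma_B \<Otimes>\<^sub>M sigma_S)"
    by measurable
  have "(\<integral>\<^sup>+\<omega>. g (S 1 \<omega>, first_area S B \<omega>) \<partial>M) = (\<integral>\<^sup>+\<omega>'. (\<integral>\<^sup>+\<omega>. g (S 1 \<omega>', path_area (B 1) (S 1 \<omega>') \<omega>) \<partial>M) \<partial>M)"
    using nn_integral_freeze_S[OF f] by (simp add: first_area_def path_area_def)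
  also have "\<dots> = (\<integral>\<^sup>+\<omega>'. (\<integral>\<^sup>+x. g (S 1 \<omega>', x) \<partial>gauss (S 1 \<omega>' ^ 3 / 3)) \<partial>M)"
  proof (rule nn_integral_cong)
    fix \<omega>' assume w: "\<omega>' \<in> space M"
    have "path_area (B 1) (S 1 \<omega>') \<in> borel_measurable M"
      using S_nonneg[OF _ w] by (intro measurable_path_area B_measurable B_continuous) auto
    then show "(\<integral>\<^sup>+\<omega>. g (S 1 \<omega>', path_area (B 1) (S 1 \<omega>') \<omega>) \<partial>M) = (\<integral>\<^sup>+x. g (S 1 \<omega>', x) \<partial>gauss (S 1 \<omega>' ^ 3 / 3))"
      using S_nonneg[OF _ w] by (subst distr_path_area[OF B_brownian, symmetric]) (auto simp: nn_integral_distr)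
  qed
  finally show ?thesis .
qed

text \<open>The variance of the area up to time \<open>t\<close> when the waiting times are frozen.\<close>

definition cond_var :: "real \<Rightarrow> 'a \<Rightarrow> real" where
  "cond_var t \<omega> = (let n = num_renewals S t \<omega> in
     ((\<Sum>i=1..n. S i \<omega> ^ 3) + (t - renewal_time S n \<omega>) ^ 3) / 3)"

lemma distr_reset_area_fixed_S:
  assumes w: "\<omega> \<in> space M" and n: "renewal_time S n \<omega> \<le> t" "t < renewal_time S (Suc n) \<omega>"
  shows "distr M borel (reset_area (\<lambda>i _. S i \<omega>) B t) = gauss (cond_var t \<omega>)"
proof -
  define r where "r i = (if i \<le> n then S i \<omega> else t - renewal_time S n \<omega>)" for i
  have "reset_area (\<lambda>i _. S i \<omega>) B t \<omega>' = (\<Sum>i=1..Suc n. path_area (B i) (r i) \<omega>')" if "\<omega>' \<in> space M" for \<omega>'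
  proof -
    have "reset_area (\<lambda>i _. S i \<omega>) B t \<omega>' =
      (\<Sum>i=1..n. path_area (B i) (S i \<omega>) \<omega>') + path_area (B (n + 1)) (t - renewal_time S n \<omega>) \<omega>'"
      using S_nonneg[OF _ w] B_continuous[OF _ that] n by (intro reset_area_eq) auto
    also have "(\<Sum>i=1..n. path_area (B i) (S i \<omega>) \<omega>') = (\<Sum>i=1..n. path_area (B i) (r i) \<omega>')"
      by (rule sum.cong) (auto simp: r_def)
    finally show ?thesis by (simp add: r_def One_nat_def)
  qed
  then have "distr M borel (reset_area (\<lambda>i _. S i \<omega>) B t) = distr M borel (\<lambda>\<omega>'. \<Sum>i=1..Suc n. path_area (B i) (r i) \<omega>')"
    by (intro distr_cong) auto
  also have "\<dots> = gauss ((\<Sum>i=1..Suc n. r i ^ 3) / 3)"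
    by (rule distr_sum_path_areas) (use n S_nonneg[OF _ w] in \<open>auto simp: r_def\<close>)
  also have "(\<Sum>i=1..Suc n. r i ^ 3) = (\<Sum>i=1..n. S i \<omega> ^ 3) + (t - renewal_time S n \<omega>) ^ 3"
    by (simp add: r_def)
  also have "\<dots> / 3 = cond_var t \<omega>"
    using num_renewals_eq[of S \<omega> n t, OF _ n] S_nonneg[OF _ w] by (simp add: cond_var_def)
  finally show ?thesis .
qed

lemma nn_integral_prod_S:
  fixes f :: "real \<Rightarrow> ennreal"
  assumes [measurable]: "f \<in> borel_measurable borel"
  shows "(\<integral>\<^sup>+\<omega>. (\<Prod>i=1..n. f (S i \<omega>)) \<partial>M) = (\<integral>\<^sup>+\<omega>. f (S 1 \<omega>) \<partial>M) ^ n"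
proof -
  have "indep_vars (\<lambda>_. borel) S {1..n}"
    by (rule indep_vars_subset[OF S_indep]) auto
  then have "indep_vars (\<lambda>_. borel) (\<lambda>i \<omega>. f (S i \<omega>)) {1..n}"
    by (rule indep_vars_compose2) simp
  then have "(\<integral>\<^sup>+\<omega>. (\<Prod>i=1..n. f (S i \<omega>)) \<partial>M) = (\<Prod>i=1..n. \<integral>\<^sup>+\<omega>. f (S i \<omega>) \<partial>M)"
    by (intro indep_vars_nn_integral) auto
  also have "\<dots> = (\<Prod>i=1..n. \<integral>\<^sup>+\<omega>. f (S 1 \<omega>) \<partial>M)"
  proof (rule prod.cong[OF refl])
    fix i assume "i \<in> {1..n}"
    then have i: "i \<ge> 1" by simp
    have "(\<integral>\<^sup>+\<omega>. f (S i \<omega>) \<partial>M) = (\<integral>\<^sup>+x. f x \<partial>distr M borel (S i))"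
      using S_measurable[OF i] by (simp add: nn_integral_distr)
    also have "\<dots> = (\<integral>\<^sup>+\<omega>. f (S 1 \<omega>) \<partial>M)"
      unfolding S_ident[OF i] using S_measurable[of 1] by (simp add: nn_integral_distr)
    finally show "(\<integral>\<^sup>+\<omega>. f (S i \<omega>) \<partial>M) = (\<integral>\<^sup>+\<omega>. f (S 1 \<omega>) \<partial>M)" .
  qed
  finally show ?thesis by simp
qed

lemma prob_S_pos: "prob {\<omega>\<in>space M. S 1 \<omega> > 0} > 0"
proof -
  have [measurable]: "S 1 \<in> borel_measurable M" by (rule S_measurable) simp
  have "{\<omega>\<in>space M. S 1 \<omega> > 0} = space M - {\<omega>\<in>space M. S 1 \<omega> = 0}"
    using S_nonneg[of 1] by force
  then have "prob {\<omega>\<in>space M. S 1 \<omega> > 0} = 1 - prob {\<omega>\<in>space M. S 1 \<omega> = 0}"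
    by (simp add: prob_compl)
  then show ?thesis using S_nonzero by simp
qed

lemma nn_integral_S_strict_mono:
  fixes f g :: "real \<Rightarrow> ennreal"
  assumes [measurable]: "f \<in> borel_measurable borel" "g \<in> borel_measurable borel"
    and le: "\<And>s. s \<ge> 0 \<Longrightarrow> f s \<le> g s" and less: "\<And>s. s > 0 \<Longrightarrow> f s < g s"
    and fin: "(\<integral>\<^sup>+\<omega>. f (S 1 \<omega>) \<partial>M) < \<infinity>"
  shows "(\<integral>\<^sup>+\<omega>. f (S 1 \<omega>) \<partial>M) < (\<integral>\<^sup>+\<omega>. g (S 1 \<omega>) \<partial>M)"
proof -
  have [measurable]: "S 1 \<in> borel_measurable M" by (rule S_measurable) simp
  have "\<not> (AE \<omega> in M. g (S 1 \<omega>) \<le> f (S 1 \<omega>))"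
  proof
    assume "AE \<omega> in M. g (S 1 \<omega>) \<le> f (S 1 \<omega>)"
    then have "AE \<omega> in M. \<not> S 1 \<omega> > 0"
      by eventually_elim (use less in \<open>auto simp: not_less[symmetric]\<close>)
    then have "prob {\<omega>\<in>space M. S 1 \<omega> > 0} = 0"
      by (subst prob_eq_0) auto
    then show False using prob_S_pos by simp
  qed
  then show ?thesis
    using le S_nonneg[of 1] fin by (intro nn_integral_less) auto
qed

text \<open>\<open>P[T\<^sub>n \<le> t] \<le> exp t \<sqdot> E[exp (-S)]\<^sup>n\<close>, and \<open>E[exp (-S)] < 1\<close> as \<open>S\<close> does not vanish almost surely.\<close>

lemma AE_finitely_many_renewals: "AE \<omega> in M. \<not> (\<forall>n. renewal_time S n \<omega> \<le> t)"
proof -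
  have S1[measurable]: "S 1 \<in> borel_measurable M" by (rule S_measurable) simp
  have [measurable]: "renewal_time S n \<in> borel_measurable M" for n
    by (rule measurable_renewal_time) (rule S_measurable)
  define m where "m = (\<integral>\<^sup>+\<omega>. ennreal (exp (- S 1 \<omega>)) \<partial>M)"
  have le1: "m \<le> 1"
    using nn_integral_mono[of M "\<lambda>\<omega>. ennreal (exp (- S 1 \<omega>))" "\<lambda>_. 1"] S_nonneg[of 1]
    by (auto simp: m_def emeasure_space_1)
  have "m < \<infinity>" using le1 by (rule le_less_trans) simp
  then have "m < (\<integral>\<^sup>+\<omega>. 1 \<partial>M)"
    unfolding m_def by (intro nn_integral_S_strict_mono) (auto simp: ennreal_less_one_iff)
  then have m: "m < 1" by (simp add: emeasure_space_1)
  let ?N = "{\<omega>\<in>space M. \<forall>n. renewal_time S n \<omega> \<le> t}"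
  have b: "emeasure M ?N \<le> ennreal (exp t) * m ^ n" for n
  proof -
    have "emeasure M ?N = (\<integral>\<^sup>+\<omega>. indicator ?N \<omega> \<partial>M)" by simp
    also have "\<dots> \<le> (\<integral>\<^sup>+\<omega>. ennreal (exp t) * (\<Prod>i=1..n. ennreal (exp (- S i \<omega>))) \<partial>M)"
    proof (rule nn_integral_mono)
      fix \<omega>
      have "ennreal (exp t) * (\<Prod>i=1..n. ennreal (exp (- S i \<omega>))) = ennreal (exp (t - renewal_time S n \<omega>))"
        by (simp add: prod_ennreal exp_sum[symmetric] ennreal_mult'[symmetric] exp_add[symmetric] renewal_time_def sum_negf)
      then show "indicator ?N \<omega> \<le> ennreal (exp t) * (\<Prod>i=1..n. ennreal (exp (- S i \<omega>)))"
        by (auto simp: indicator_def)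
    qed
    also have "\<dots> = ennreal (exp t) * (\<integral>\<^sup>+\<omega>. (\<Prod>i=1..n. ennreal (exp (- S i \<omega>))) \<partial>M)"
      by (rule nn_integral_cmult, rule borel_measurable_prod_ennreal)
        (rule measurable_compose[OF S_measurable], auto)
    also have "\<dots> = ennreal (exp t) * m ^ n"
      unfolding m_def using nn_integral_prod_S[of "\<lambda>s. ennreal (exp (- s))" n] by simp
    finally show ?thesis .
  qed
  have "(\<lambda>n. m ^ n) \<longlonglongrightarrow> 0"
  proof -
    obtain r where r: "m = ennreal r" "0 \<le> r" "r < 1"
      using m by (cases m) (auto simp: ennreal_less_one_iff)
    have "(\<lambda>n. ennreal (r ^ n)) \<longlonglongrightarrow> ennreal 0"
      by (intro tendsto_ennrealI LIMSEQ_realpow_zero r)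
    then show ?thesis by (simp add: r ennreal_power)
  qed
  then have "(\<lambda>n. ennreal (exp t) * m ^ n) \<longlonglongrightarrow> ennreal (exp t) * 0"
    by (intro ennreal_tendsto_cmult) auto
  then have "emeasure M ?N \<le> 0"
    using LIMSEQ_le_const[of "\<lambda>n. ennreal (exp t) * m ^ n" 0 "emeasure M ?N"] b by auto
  then show ?thesis by (intro AE_I[of _ _ ?N]) auto
qed

text \<open>The law of the area is a mixture of centred Gaussian laws; the frozen waiting times are those of \<open>\<omega>\<close>.\<close>

lemma nn_integral_reset_area:
  fixes h :: "real \<Rightarrow> ennreal"
  assumes [measurable]: "h \<in> borel_measurable borel" and t: "t \<ge> 0"
  shows "(\<integral>\<^sup>+\<omega>. h (reset_area S B t \<omega>) \<partial>M) = (\<integral>\<^sup>+\<omega>. (\<integral>\<^sup>+x. h x \<partial>gauss (cond_var t \<omega>)) \<partial>M)"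
proof -
  have [measurable]: "reset_area (\<lambda>i x. S i (snd x)) (\<lambda>i t x. B i t (fst x)) t \<in> borel_measurable (sigma_B \<Otimes>\<^sub>M sigma_S)"
    by (rule measurable_reset_area)
      (auto intro!: measurable_compose[OF measurable_snd S_measurable_sigma_S]
        measurable_compose[OF measurable_fst B_measurable_sigma_B] B_continuous S_nonneg simp: space_pair_measure space_measure_of_conv)
  have e: "reset_area (\<lambda>i x. S i (snd x)) (\<lambda>i t x. B i t (fst x)) t (\<omega>, \<omega>') = reset_area (\<lambda>i _. S i \<omega>') B t \<omega>" for \<omega> \<omega>'
    by (simp add: reset_area_def reset_bm_def num_renewals_def renewal_time_def Let_def)
  have e': "reset_area (\<lambda>i _. S i \<omega>) B t \<omega> = reset_area S B t \<omega>" for \<omega>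
    by (simp add: reset_area_def reset_bm_def num_renewals_def renewal_time_def Let_def)
  have f: "(\<lambda>x. h (reset_area (\<lambda>i x. S i (snd x)) (\<lambda>i t x. B i t (fst x)) t x)) \<in> borel_measurable (sigma_B \<Otimes>\<^sub>M sigma_S)"
    by measurable
  have "(\<integral>\<^sup>+\<omega>. h (reset_area S B t \<omega>) \<partial>M) = (\<integral>\<^sup>+\<omega>'. (\<integral>\<^sup>+\<omega>. h (reset_area (\<lambda>i _. S i \<omega>') B t \<omega>) \<partial>M) \<partial>M)"
    using nn_integral_freeze_S[OF f] by (simp only: e e')
  also have "\<dots> = (\<integral>\<^sup>+\<omega>'. (\<integral>\<^sup>+x. h x \<partial>gauss (cond_var t \<omega>')) \<partial>M)"
  proof (rule nn_integral_cong_AE)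
    show "AE \<omega>' in M. (\<integral>\<^sup>+\<omega>. h (reset_area (\<lambda>i _. S i \<omega>') B t \<omega>) \<partial>M) = (\<integral>\<^sup>+x. h x \<partial>gauss (cond_var t \<omega>'))"
      using AE_finitely_many_renewals[of t] AE_space
    proof eventually_elim
      case (elim \<omega>')
      then obtain n where n: "renewal_time S n \<omega>' \<le> t" "t < renewal_time S (Suc n) \<omega>'"
        using renewal_index_exists[OF t] by metis
      have "reset_area (\<lambda>i _. S i \<omega>') B t \<in> borel_measurable M"
        using elim by (intro measurable_reset_area B_measurable B_continuous S_nonneg) auto
      then show ?case
        unfolding distr_reset_area_fixed_S[OF elim(2) n, symmetric] by (simp add: nn_integral_distr)
    qed
  qed
  finally show ?thesis .
qed

end

section \<open>Gaussian estimates\<close>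

lemma nn_integral_exp_gauss:
  assumes "v \<ge> 0"
  shows "(\<integral>\<^sup>+x. ennreal (exp (k * x)) \<partial>gauss v) = ennreal (exp (k\<^sup>2 / 2 * v))"
proof -
  define c where "c = k * sqrt v"
  have c2: "c\<^sup>2 = k\<^sup>2 * v" using assms by (simp add: c_def power_mult_distrib)
  interpret P: prob_space "density lborel (normal_density c 1)"
    by (rule prob_space_normal_density) simp
  have one: "(\<integral>\<^sup>+z. ennreal (normal_density c 1 z) \<partial>lborel) = 1"
    using P.emeasure_space_1 by (simp add: emeasure_density)
  have "(\<integral>\<^sup>+x. ennreal (exp (k * x)) \<partial>gauss v) = (\<integral>\<^sup>+z. ennreal (exp (c * z)) \<partial>std_normal_distribution)"
    unfolding gauss_def by (subst nn_integral_distr) (auto simp: c_def mult.assoc)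
  also have "\<dots> = (\<integral>\<^sup>+z. ennreal (std_normal_density z) * ennreal (exp (c * z)) \<partial>lborel)"
    by (subst nn_integral_density) auto
  also have "\<dots> = (\<integral>\<^sup>+z. ennreal (exp (c\<^sup>2 / 2)) * ennreal (normal_density c 1 z) \<partial>lborel)"
  proof (rule nn_integral_cong)
    fix z
    have "- z\<^sup>2 / 2 + c * z = c\<^sup>2 / 2 + - (z - c)\<^sup>2 / 2"
      by (simp add: power2_eq_square field_simps)
    then have "exp (- z\<^sup>2 / 2) * exp (c * z) = exp (c\<^sup>2 / 2) * exp (- (z - c)\<^sup>2 / 2)"
      by (simp only: exp_add[symmetric])
    then show "ennreal (std_normal_density z) * ennreal (exp (c * z)) = ennreal (exp (c\<^sup>2 / 2)) * ennreal (normal_density c 1 z)"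
      by (simp add: ennreal_mult'[symmetric] ennreal_mult''[symmetric] normal_density_def)
  qed
  also have "\<dots> = ennreal (exp (c\<^sup>2 / 2))"
    by (subst nn_integral_cmult) (auto simp: one)
  finally show ?thesis by (simp add: c2)
qed

text \<open>On the ball \<open>\<bar>y / t\<bar>\<close> is at most \<open>\<bar>w\<bar> + \<epsilon>\<close>, which bounds the density from below, and a variance larger than
\<open>x t\<close> only improves the exponent. The upper bound \<open>t\<^sup>3/3\<close> on the variance, which holds for the area up to
time \<open>t\<close>, keeps the prefactor polynomial in \<open>t\<close>.\<close>

lemma gauss_ball_lower_bound:
  assumes x: "x > 0" and t: "t \<ge> 1" and e: "\<epsilon> > 0" and v: "x * t \<le> v" "v \<le> t ^ 3 / 3"
  shows "ennreal (2 * \<epsilon> / t / sqrt (2 * pi) * exp (- (t * (\<bar>w\<bar> + \<epsilon>)\<^sup>2 / (2 * x)))) \<le>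
    emeasure (gauss v) {y. \<bar>y / t - w\<bar> < \<epsilon>}"
proof -
  have "0 < x * t" using x t by simp
  then have v0: "v > 0" using v(1) by linarith
  define s where "s = sqrt v"
  have s: "s > 0" "s\<^sup>2 = v" using v0 by (auto simp: s_def)
  have "t ^ 3 / 3 \<le> t\<^sup>2 * t\<^sup>2"
    using t mult_left_mono[of 1 t "t^3"] by (simp add: power2_eq_square power3_eq_cube)
  then have "s\<^sup>2 \<le> (t\<^sup>2)\<^sup>2" using v(2) s(2) by (simp add: power2_eq_square)
  then have st: "s \<le> t\<^sup>2" by (rule power2_le_imp_le) simp
  define a b where "a = (w - \<epsilon>) * t / s" and "b = (w + \<epsilon>) * t / s"
  have ab: "a \<le> b" using e t s by (auto simp: a_def b_def intro!: divide_right_mono mult_right_mono)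
  define d where "d = 1 / sqrt (2 * pi) * exp (- (t * (\<bar>w\<bar> + \<epsilon>)\<^sup>2 / (2 * x)))"
  have d0: "d \<ge> 0" by (simp add: d_def)
  have dens: "d \<le> std_normal_density z" if z: "z \<in> {a<..<b}" for z
  proof -
    have "\<bar>z * s / t - w\<bar> < \<epsilon>"
      using z s t by (auto simp: a_def b_def abs_less_iff field_simps)
    then have "\<bar>z * s / t\<bar> \<le> \<bar>w\<bar> + \<epsilon>" by linarith
    then have "(z * s / t)\<^sup>2 \<le> (\<bar>w\<bar> + \<epsilon>)\<^sup>2"
      using e by (subst abs_le_square_iff[symmetric]) auto
    then have "z\<^sup>2 * v \<le> t\<^sup>2 * (\<bar>w\<bar> + \<epsilon>)\<^sup>2"
      using t s by (simp add: power_mult_distrib power_divide field_simps)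
    moreover have "z\<^sup>2 * (x * t) \<le> z\<^sup>2 * v"
      by (rule mult_left_mono[OF v(1)]) simp
    ultimately have "t * (z\<^sup>2 * x) \<le> t * (t * (\<bar>w\<bar> + \<epsilon>)\<^sup>2)"
      by (simp add: power2_eq_square algebra_simps)
    then have "z\<^sup>2 * x \<le> t * (\<bar>w\<bar> + \<epsilon>)\<^sup>2"
      by (rule mult_left_le_imp_le) (use t in simp)
    then have "z\<^sup>2 / 2 \<le> t * (\<bar>w\<bar> + \<epsilon>)\<^sup>2 / (2 * x)"
      using x by (simp add: field_simps)
    then show ?thesis
      unfolding d_def std_normal_density_def by (intro mult_left_mono) auto
  qed
  have "2 * \<epsilon> / t \<le> 2 * \<epsilon> * t / s"
    using st s t e by (simp add: field_simps power2_eq_square)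
  also have "\<dots> = b - a" by (simp add: a_def b_def diff_divide_distrib[symmetric] algebra_simps)
  finally have len: "2 * \<epsilon> / t \<le> b - a" .
  have "ennreal (2 * \<epsilon> / t * d) \<le> ennreal (d * (b - a))"
    using mult_left_mono[OF len d0] by (intro ennreal_leI) (simp add: mult.commute)
  also have "\<dots> = (\<integral>\<^sup>+z. ennreal d * indicator {a<..<b} z \<partial>lborel)"
    using ab d0 by (subst nn_integral_cmult_indicator) (auto simp: ennreal_mult')
  also have "\<dots> \<le> (\<integral>\<^sup>+z. ennreal (std_normal_density z) * indicator {a<..<b} z \<partial>lborel)"
    using dens by (intro nn_integral_mono) (auto simp: indicator_def intro!: ennreal_leI)
  also have "\<dots> = emeasure std_normal_distribution {a<..<b}"
    by (subst emeasure_density) auto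
  also have "\<dots> \<le> emeasure std_normal_distribution ((\<lambda>z. s * z) -` {y. \<bar>y / t - w\<bar> < \<epsilon>} \<inter> space std_normal_distribution)"
  proof (rule emeasure_mono)
    show "{a<..<b} \<subseteq> (\<lambda>z. s * z) -` {y. \<bar>y / t - w\<bar> < \<epsilon>} \<inter> space std_normal_distribution"
      using s t by (auto simp: a_def b_def abs_less_iff field_simps)
  qed measurable
  also have "\<dots> = emeasure (gauss v) {y. \<bar>y / t - w\<bar> < \<epsilon>}"
    unfolding gauss_def s_def by (subst emeasure_distr) auto
  finally show ?thesis by (simp add: d_def)
qed

section \<open>The moment generating function from above\<close>

context resetting
begin

text \<open>With \<open>\<theta> = k\<^sup>2/2\<close> this is the conditional expectation of \<open>exp (\<zeta> S\<^sub>1 + k X\<^sub>1)\<close> given \<open>S\<^sub>1 = s\<close>.\<close>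

definition tilt :: "real \<Rightarrow> real \<Rightarrow> real \<Rightarrow> real" where
  "tilt \<zeta> \<theta> s = exp (\<zeta> * s + \<theta> * (s ^ 3 / 3))"

lemma measurable_tilt [measurable]: "tilt \<zeta> \<theta> \<in> borel_measurable borel"
  unfolding tilt_def[abs_def] by measurable

lemma tilt_pos [simp]: "tilt \<zeta> \<theta> s > 0"
  by (simp add: tilt_def)

lemma prod_tilt:
  "(\<Prod>i=1..n. tilt \<zeta> \<theta> (S i \<omega>)) = exp (\<zeta> * renewal_time S n \<omega> + \<theta> * ((\<Sum>i=1..n. S i \<omega> ^ 3) / 3))"
  by (simp add: tilt_def exp_sum[symmetric] sum.distrib sum_distrib_left sum_divide_distrib renewal_time_def)

lemma phi_eq:
  "phi M S B k = Sup (ereal ` {\<zeta>. (\<integral>\<^sup>+ \<omega>. ennreal (tilt \<zeta> (k\<^sup>2 / 2) (S 1 \<omega>)) \<partial>M) \<le> 1})"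
proof -
  have "(\<integral>\<^sup>+ \<omega>. ennreal (exp (\<zeta> * S 1 \<omega> + k * first_area S B \<omega>)) \<partial>M) =
      (\<integral>\<^sup>+ \<omega>. ennreal (tilt \<zeta> (k\<^sup>2 / 2) (S 1 \<omega>)) \<partial>M)" for \<zeta>
  proof -
    have "(\<lambda>p. ennreal (exp (\<zeta> * fst p + k * snd p))) \<in> borel_measurable (borel :: (real \<times> real) measure)"
      unfolding borel_prod[symmetric] by measurable
    then have "(\<integral>\<^sup>+ \<omega>. ennreal (exp (\<zeta> * S 1 \<omega> + k * first_area S B \<omega>)) \<partial>M) =
        (\<integral>\<^sup>+ \<omega>. (\<integral>\<^sup>+x. ennreal (exp (\<zeta> * S 1 \<omega> + k * x)) \<partial>gauss (S 1 \<omega> ^ 3 / 3)) \<partial>M)"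
      using nn_integral_first_area by fastforce
    also have "\<dots> = (\<integral>\<^sup>+ \<omega>. ennreal (tilt \<zeta> (k\<^sup>2 / 2) (S 1 \<omega>)) \<partial>M)"
    proof (rule nn_integral_cong)
      fix \<omega> assume "\<omega> \<in> space M"
      then have "S 1 \<omega> ^ 3 / 3 \<ge> 0" using S_nonneg[of 1] by simp
      moreover have [measurable]: "(\<lambda>x. x) \<in> borel_measurable (gauss v)" for v
        by (simp add: gauss_def)
      ultimately show "(\<integral>\<^sup>+x. ennreal (exp (\<zeta> * S 1 \<omega> + k * x)) \<partial>gauss (S 1 \<omega> ^ 3 / 3)) = ennreal (tilt \<zeta> (k\<^sup>2 / 2) (S 1 \<omega>))"
        by (simp add: exp_add ennreal_mult' nn_integral_cmult nn_integral_exp_gauss tilt_def)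
    qed
    finally show ?thesis .
  qed
  then show ?thesis by (simp add: phi_def)
qed

lemma phi_even: "phi M S B (- k) = phi M S B k"
  by (simp add: phi_eq)

lemma AE_current_renewal:
  assumes "t \<ge> 0"
  shows "AE \<omega> in M. \<omega> \<in> space M \<and> (\<exists>n. renewal_time S n \<omega> \<le> t \<and> t < renewal_time S (Suc n) \<omega>)"
  using AE_finitely_many_renewals[of t] AE_space
  by eventually_elim (use renewal_index_exists[OF assms] in metis)

lemma cond_var_eq:
  assumes "\<omega> \<in> space M" "renewal_time S n \<omega> \<le> t" "t < renewal_time S (Suc n) \<omega>"
  shows "cond_var t \<omega> = ((\<Sum>i=1..n. S i \<omega> ^ 3) + (t - renewal_time S n \<omega>) ^ 3) / 3"
  using num_renewals_eq[of S \<omega> n t, OF _ assms(2,3)] S_nonneg[OF _ assms(1)] by (simp add: cond_var_def)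

lemma cond_var_ge:
  assumes w: "\<omega> \<in> space M" and n: "renewal_time S n \<omega> \<le> t" "t < renewal_time S (Suc n) \<omega>"
    and m: "renewal_time S m \<omega> \<le> t"
  shows "(\<Sum>i=1..m. S i \<omega> ^ 3) / 3 \<le> cond_var t \<omega>"
proof -
  have "m \<le> n"
    using renewal_time_mono[of S \<omega> "Suc n" m] S_nonneg[OF _ w] m n by force
  then have "(\<Sum>i=1..m. S i \<omega> ^ 3) \<le> (\<Sum>i=1..n. S i \<omega> ^ 3)"
    using S_nonneg[OF _ w] by (intro sum_mono2) auto
  moreover have "0 \<le> (t - renewal_time S n \<omega>) ^ 3" using n by simp
  ultimately have "(\<Sum>i=1..m. S i \<omega> ^ 3) \<le> (\<Sum>i=1..n. S i \<omega> ^ 3) + (t - renewal_time S n \<omega>) ^ 3"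
    by (rule add_increasing2[rotated])
  then show ?thesis unfolding cond_var_eq[OF w n] by (rule divide_right_mono) simp
qed

lemma cube_add_le: "a \<ge> 0 \<Longrightarrow> b \<ge> 0 \<Longrightarrow> a ^ 3 + b ^ 3 \<le> (a + b) ^ 3" for a b :: real
  by (simp add: power3_eq_cube algebra_simps)

text \<open>The cycles have total length \<open>t\<close> and cubing is superadditive.\<close>

lemma cond_var_le:
  assumes w: "\<omega> \<in> space M" and n: "renewal_time S n \<omega> \<le> t" "t < renewal_time S (Suc n) \<omega>"
  shows "cond_var t \<omega> \<le> t ^ 3 / 3"
proof -
  have nn: "renewal_time S j \<omega> \<ge> 0" for j
    using renewal_time_mono[of S \<omega> 0 j] S_nonneg[OF _ w] by (auto simp: renewal_time_0)
  have "(\<Sum>i=1..j. S i \<omega> ^ 3) \<le> renewal_time S j \<omega> ^ 3" for j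
  proof (induction j)
    case (Suc j)
    then show ?case
      using cube_add_le[OF nn[of j] S_nonneg[OF _ w, of "Suc j"]] by (simp add: renewal_time_Suc)
  qed (simp add: renewal_time_0)
  from this[of n] show ?thesis
    using cube_add_le[OF nn[of n], of "t - renewal_time S n \<omega>"] n by (simp add: cond_var_eq[OF w n])
qed

lemma nn_integral_exp_reset_area:
  assumes "t \<ge> 0"
  shows "(\<integral>\<^sup>+\<omega>. ennreal (exp (k * reset_area S B t \<omega>)) \<partial>M) = (\<integral>\<^sup>+\<omega>. ennreal (exp (k\<^sup>2 / 2 * cond_var t \<omega>)) \<partial>M)"
proof -
  have "(\<integral>\<^sup>+\<omega>. ennreal (exp (k * reset_area S B t \<omega>)) \<partial>M) =
      (\<integral>\<^sup>+\<omega>. (\<integral>\<^sup>+x. ennreal (exp (k * x)) \<partial>gauss (cond_var t \<omega>)) \<partial>M)"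
    by (rule nn_integral_reset_area) (use assms in auto)
  also have "\<dots> = (\<integral>\<^sup>+\<omega>. ennreal (exp (k\<^sup>2 / 2 * cond_var t \<omega>)) \<partial>M)"
  proof (rule nn_integral_cong_AE)
    show "AE \<omega> in M. (\<integral>\<^sup>+x. ennreal (exp (k * x)) \<partial>gauss (cond_var t \<omega>)) = ennreal (exp (k\<^sup>2 / 2 * cond_var t \<omega>))"
      using AE_current_renewal[OF assms]
    proof eventually_elim
      case (elim \<omega>)
      then have "cond_var t \<omega> \<ge> 0"
        using cond_var_ge[of \<omega> _ t 0] assms by (auto simp: renewal_time_0)
      then show ?case by (rule nn_integral_exp_gauss)
    qed
  qed
  finally show ?thesis .
qed

lemma tilt_less_one:
  assumes "(\<integral>\<^sup>+ \<omega>. ennreal (tilt \<zeta>' \<theta> (S 1 \<omega>)) \<partial>M) \<le> 1" "\<zeta> < \<zeta>'"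
  shows "(\<integral>\<^sup>+ \<omega>. ennreal (tilt \<zeta> \<theta> (S 1 \<omega>)) \<partial>M) < 1"
proof -
  have [measurable]: "S 1 \<in> borel_measurable M" by (rule S_measurable) simp
  have le: "ennreal (tilt \<zeta> \<theta> s) \<le> ennreal (tilt \<zeta>' \<theta> s)" if "s \<ge> 0" for s
    using that assms(2) by (auto simp: tilt_def intro!: ennreal_leI mult_right_mono)
  have "(\<integral>\<^sup>+ \<omega>. ennreal (tilt \<zeta> \<theta> (S 1 \<omega>)) \<partial>M) \<le> (\<integral>\<^sup>+ \<omega>. ennreal (tilt \<zeta>' \<theta> (S 1 \<omega>)) \<partial>M)"
    using le S_nonneg[of 1] by (intro nn_integral_mono) auto
  also note assms(1)
  finally have "(\<integral>\<^sup>+ \<omega>. ennreal (tilt \<zeta> \<theta> (S 1 \<omega>)) \<partial>M) < \<infinity>"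
    by (rule le_less_trans) simp
  then have "(\<integral>\<^sup>+ \<omega>. ennreal (tilt \<zeta> \<theta> (S 1 \<omega>)) \<partial>M) < (\<integral>\<^sup>+ \<omega>. ennreal (tilt \<zeta>' \<theta> (S 1 \<omega>)) \<partial>M)"
    using le assms(2) by (intro nn_integral_S_strict_mono) (auto simp: tilt_def ennreal_less_iff)
  with assms(1) show ?thesis by order
qed

lemma tilt_zero_nonpos:
  assumes "(\<integral>\<^sup>+ \<omega>. ennreal (tilt \<zeta> 0 (S 1 \<omega>)) \<partial>M) \<le> 1"
  shows "\<zeta> \<le> 0"
proof (rule ccontr)
  assume "\<not> \<zeta> \<le> 0"
  then have "(\<integral>\<^sup>+ \<omega>. ennreal (tilt 0 0 (S 1 \<omega>)) \<partial>M) < 1"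
    using tilt_less_one[OF assms] by simp
  then show False by (simp add: tilt_def emeasure_space_1)
qed

text \<open>If the cycle in progress has age \<open>\<rho>\<close> and total length \<open>\<rho> + d\<close>, then \<open>\<theta> \<rho>\<^sup>3/3\<close> is bounded by a constant plus
\<open>\<zeta> d + \<theta> (\<rho> + d)\<^sup>3/3\<close>, because the cubic term in \<open>d\<close> dominates \<open>- \<zeta> d\<close>. So the whole exponent is bounded by
that of the tilt of the completed cycles, whose expectations form a geometric series. For \<open>k = 0\<close> there is no cubic
term, but then \<open>\<zeta> < 0\<close>.\<close>

lemma mgf_upper_bound:
  assumes le1: "(\<integral>\<^sup>+ \<omega>. ennreal (tilt \<zeta>' (k\<^sup>2 / 2) (S 1 \<omega>)) \<partial>M) \<le> 1" and less: "\<zeta> < \<zeta>'"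
  obtains C where "C > 0"
    "\<And>t. t \<ge> 0 \<Longrightarrow> (\<integral>\<^sup>+\<omega>. ennreal (exp (k * reset_area S B t \<omega>)) \<partial>M) \<le> ennreal (C * exp (- \<zeta> * t))"
proof (cases "k = 0")
  case True
  with le1 have "\<zeta>' \<le> 0" using tilt_zero_nonpos by simp
  show ?thesis
  proof (rule that[of 1])
    fix t :: real assume "t \<ge> 0"
    then have "exp (- \<zeta> * t) \<ge> 1" using less \<open>\<zeta>' \<le> 0\<close> by (simp add: mult_nonpos_nonneg)
    then show "(\<integral>\<^sup>+\<omega>. ennreal (exp (k * reset_area S B t \<omega>)) \<partial>M) \<le> ennreal (1 * exp (- \<zeta> * t))"
      using True by (simp add: emeasure_space_1)
  qed simp
next
  case False
  define \<theta> where "\<theta> = k\<^sup>2 / 2"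
  have \<theta>: "\<theta> > 0" using False by (simp add: \<theta>_def)
  \<comment> \<open>Beyond \<open>d0\<close> the cubic term dominates the linear one.\<close>
  define d0 where "d0 = sqrt (3 * \<bar>\<zeta>\<bar> / \<theta>)"
  have d0: "d0 \<ge> 0" "d0\<^sup>2 = 3 * \<bar>\<zeta>\<bar> / \<theta>" using \<theta> by (auto simp: d0_def)
  have C': "- \<zeta> * d - \<theta> * (d ^ 3 / 3) \<le> \<bar>\<zeta>\<bar> * d0" if d: "d \<ge> 0" for d
  proof (cases "d \<le> d0")
    case True
    have "- \<zeta> * d \<le> \<bar>\<zeta>\<bar> * d" using d by (intro mult_right_mono) auto
    also have "\<dots> \<le> \<bar>\<zeta>\<bar> * d0" using True by (rule mult_left_mono) simp
    moreover have "\<theta> * (d ^ 3 / 3) \<ge> 0" using \<theta> d by simp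
    ultimately show ?thesis by linarith
  next
    case False
    then have "d0\<^sup>2 \<le> d\<^sup>2" using d0 by (intro power_mono) auto
    then have "\<bar>\<zeta>\<bar> \<le> \<theta> * (d\<^sup>2 / 3)" using d0(2) \<theta> by (simp add: field_simps)
    then have "\<bar>\<zeta>\<bar> * d \<le> \<theta> * (d\<^sup>2 / 3) * d" using d by (rule mult_right_mono)
    moreover have "- \<zeta> * d \<le> \<bar>\<zeta>\<bar> * d" using d by (intro mult_right_mono) auto
    ultimately have "- \<zeta> * d - \<theta> * (d ^ 3 / 3) \<le> 0" by (simp add: power2_eq_square power3_eq_cube)
    also have "0 \<le> \<bar>\<zeta>\<bar> * d0" using d0 by simp
    finally show ?thesis .
  qed
  define m where "m = (\<integral>\<^sup>+ \<omega>. ennreal (tilt \<zeta> \<theta> (S 1 \<omega>)) \<partial>M)"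
  have "m < 1" unfolding m_def using le1 less unfolding \<theta>_def by (rule tilt_less_one)
  then obtain r where r: "m = ennreal r" "0 \<le> r" "r < 1"
    by (cases m) (auto simp: ennreal_less_one_iff)
  define K where "K = (\<Sum>n. r ^ Suc n)"
  have sm: "summable (\<lambda>n. r ^ Suc n)" 
    unfolding power_Suc using r by (intro summable_mult summable_geometric) simp
  have K: "(\<Sum>n. m ^ Suc n) = ennreal K"
    unfolding K_def r(1) ennreal_power[OF r(2)] using r(2) by (intro suminf_ennreal2 sm zero_le_power)
  have K0: "K \<ge> 0"
    unfolding K_def using r(2) by (intro suminf_nonneg sm zero_le_power)
  show ?thesis
  proof (rule that[of "exp (\<bar>\<zeta>\<bar> * d0) * (K + 1)"])
    show "exp (\<bar>\<zeta>\<bar> * d0) * (K + 1) > 0" using K0 by simp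
    fix t :: real assume t: "t \<ge> 0"
    define c where "c = exp (\<bar>\<zeta>\<bar> * d0) * exp (- \<zeta> * t)"
    have pm[measurable]: "(\<lambda>\<omega>. \<Prod>i=1..n. ennreal (tilt \<zeta> \<theta> (S i \<omega>))) \<in> borel_measurable M" for n
      by (rule borel_measurable_prod_ennreal) (rule measurable_compose[OF S_measurable], auto)
    have "(\<integral>\<^sup>+\<omega>. ennreal (exp (k * reset_area S B t \<omega>)) \<partial>M) = (\<integral>\<^sup>+\<omega>. ennreal (exp (\<theta> * cond_var t \<omega>)) \<partial>M)"
      unfolding \<theta>_def by (rule nn_integral_exp_reset_area[OF t])
    also have "\<dots> \<le> (\<integral>\<^sup>+\<omega>. ennreal c * (\<Sum>n. \<Prod>i=1..Suc n. ennreal (tilt \<zeta> \<theta> (S i \<omega>))) \<partial>M)"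
    proof (rule nn_integral_mono_AE)
      show "AE \<omega> in M. ennreal (exp (\<theta> * cond_var t \<omega>)) \<le> ennreal c * (\<Sum>n. \<Prod>i=1..Suc n. ennreal (tilt \<zeta> \<theta> (S i \<omega>)))"
        using AE_current_renewal[OF t]
      proof eventually_elim
        case (elim \<omega>)
        then obtain n where w: "\<omega> \<in> space M" and n: "renewal_time S n \<omega> \<le> t" "t < renewal_time S (Suc n) \<omega>"
          by auto
        define \<rho> where "\<rho> = t - renewal_time S n \<omega>"
        define d where "d = S (Suc n) \<omega> - \<rho>"
        have rd: "\<rho> \<ge> 0" "d \<ge> 0" using n by (auto simp: \<rho>_def d_def renewal_time_Suc)
        have s: "S (Suc n) \<omega> = \<rho> + d" by (simp add: d_def)
        have tt: "t = renewal_time S n \<omega> + \<rho>" by (simp add: \<rho>_def)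
        have "\<theta> * (\<rho> ^ 3 + d ^ 3) \<le> \<theta> * (\<rho> + d) ^ 3"
          using \<theta> by (intro mult_left_mono cube_add_le rd) auto
        then have "\<theta> * \<rho> ^ 3 / 3 \<le> \<bar>\<zeta>\<bar> * d0 + \<zeta> * d + \<theta> * ((\<rho> + d) ^ 3 / 3)"
          using C'[OF rd(2)] by (simp add: algebra_simps)
        then have "\<theta> * cond_var t \<omega> \<le> (\<bar>\<zeta>\<bar> * d0 + - \<zeta> * t) +
            (\<zeta> * renewal_time S (Suc n) \<omega> + \<theta> * ((\<Sum>i=1..Suc n. S i \<omega> ^ 3) / 3))"
          unfolding cond_var_eq[OF w n] \<rho>_def[symmetric] unfolding renewal_time_Suc tt s
          by (simp add: s algebra_simps add_divide_distrib)
        then have "exp (\<theta> * cond_var t \<omega>) \<le> c * (\<Prod>i=1..Suc n. tilt \<zeta> \<theta> (S i \<omega>))"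
          unfolding prod_tilt c_def exp_add[symmetric] by simp
        then have "ennreal (exp (\<theta> * cond_var t \<omega>)) \<le> ennreal c * (\<Prod>i=1..Suc n. ennreal (tilt \<zeta> \<theta> (S i \<omega>)))"
          by (subst prod_ennreal) (auto simp: ennreal_mult'[symmetric] c_def less_imp_le intro!: ennreal_leI)
        also have "\<dots> \<le> ennreal c * (\<Sum>n. \<Prod>i=1..Suc n. ennreal (tilt \<zeta> \<theta> (S i \<omega>)))"
          using sum_le_suminf[of "\<lambda>n. \<Prod>i=1..Suc n. ennreal (tilt \<zeta> \<theta> (S i \<omega>))" "{n}"]
          by (intro mult_left_mono) auto
        finally show ?case .
      qed
    qed
    also have "\<dots> = ennreal c * (\<Sum>n. (\<integral>\<^sup>+\<omega>. (\<Prod>i=1..Suc n. ennreal (tilt \<zeta> \<theta> (S i \<omega>))) \<partial>M))"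
      by (subst nn_integral_cmult) (measurable, subst nn_integral_suminf, rule pm, rule refl)
    also have "\<dots> = ennreal c * ennreal K"
    proof -
      have "(\<integral>\<^sup>+\<omega>. (\<Prod>i=1..n. ennreal (tilt \<zeta> \<theta> (S i \<omega>))) \<partial>M) = m ^ n" for n
        unfolding m_def by (rule nn_integral_prod_S) simp
      then show ?thesis by (simp only: K)
    qed
    also have "\<dots> \<le> ennreal (exp (\<bar>\<zeta>\<bar> * d0) * (K + 1) * exp (- \<zeta> * t))"
      using K0 by (subst ennreal_mult''[symmetric]) (auto simp: c_def algebra_simps intro!: ennreal_leI)
    finally show "(\<integral>\<^sup>+\<omega>. ennreal (exp (k * reset_area S B t \<omega>)) \<partial>M) \<le>
        ennreal (exp (\<bar>\<zeta>\<bar> * d0) * (K + 1) * exp (- \<zeta> * t))" .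
  qed
qed

end

section \<open>Concentration under a tilted law\<close>

lemma exp_le_quadratic:
  fixes x :: real
  assumes "\<bar>x\<bar> \<le> 1"
  shows "exp x \<le> 1 + x + x\<^sup>2"
proof (cases "x \<ge> 0")
  case True
  then show ?thesis using exp_bound[of x] assms by simp
next
  case False
  \<comment> \<open>For negative \<open>x\<close> bound \<open>exp (-x)\<close> from below and take reciprocals.\<close>
  have "1 + (-x) + (-x)\<^sup>2 / 2 \<le> exp (-x)"
    using False by (intro exp_lower_Taylor_quadratic) simp
  then have "1 / exp (-x) \<le> 1 / (1 - x + x\<^sup>2 / 2)"
    using False by (intro divide_left_mono mult_pos_pos add_pos_nonneg) auto
  then have "exp x \<le> 1 / (1 - x + x\<^sup>2 / 2)" by (simp add: exp_minus inverse_eq_divide)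
  also have "\<dots> \<le> 1 + x + x\<^sup>2"
  proof -
    have "0 \<le> x\<^sup>2 * (1 - x + x\<^sup>2) / 2" using False by (intro divide_nonneg_pos mult_nonneg_nonneg) auto
    also have "\<dots> = (1 + x + x\<^sup>2) * (1 - x + x\<^sup>2 / 2) - 1"
      by (simp add: power2_eq_square field_simps)
    finally show ?thesis
      using False by (subst pos_divide_le_eq) (auto intro!: add_pos_nonneg)
  qed
  finally show ?thesis .
qed

context resetting
begin

text \<open>Exponential concentration of \<open>\<Sum> f(S\<^sub>i)\<close> under the tilted law with density \<open>\<Prod> p(S\<^sub>i)\<close>, formulated as a weighted
expectation so that no new probability space is needed. Exponential Markov with a parameter \<open>l\<close> so small that
\<open>E[p exp (l (f - a - \<delta>))] \<le> 1 - l \<delta> + l\<^sup>2 c\<^sup>2 < 1\<close>.\<close>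

lemma weighted_chernoff:
  fixes p f :: "real \<Rightarrow> real" and a \<delta> C P :: real
  assumes [measurable]: "p \<in> borel_measurable borel" "f \<in> borel_measurable borel"
    and p0: "\<And>s. p s \<ge> 0" and pb: "\<And>s. p s \<le> P"
    and f: "\<And>s. p s \<noteq> 0 \<Longrightarrow> s \<ge> 0 \<Longrightarrow> \<bar>f s\<bar> \<le> C"
    and one: "expectation (\<lambda>\<omega>. p (S 1 \<omega>)) = 1"
    and a: "expectation (\<lambda>\<omega>. p (S 1 \<omega>) * f (S 1 \<omega>)) = a"
    and \<delta>: "\<delta> > 0"
  shows "\<exists>q\<ge>0. q < 1 \<and> (\<forall>n::nat. (\<integral>\<^sup>+\<omega>. ennreal (\<Prod>i=1..n. p (S i \<omega>)) * indicator {\<omega>. n * (a + \<delta>) \<le> (\<Sum>i=1..n. f (S i \<omega>))} \<omega> \<partial>M) \<le> ennreal (q ^ n))"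
proof -
  have S1[measurable]: "S 1 \<in> borel_measurable M" by (rule S_measurable) simp
  define c where "c = \<bar>C\<bar> + \<bar>a\<bar> + \<delta>"
  have c: "c > 0" using \<delta> by (simp add: c_def)
  define g where "g s = f s - a - \<delta>" for s
  have g: "\<bar>g s\<bar> \<le> c" if "p s \<noteq> 0" "s \<ge> 0" for s
    using f[OF that] \<delta> unfolding g_def c_def by linarith
  \<comment> \<open>The first bound makes \<open>\<bar>l g\<bar> \<le> 1\<close>, the second makes the quadratic term at most half of the linear gain.\<close>
  define l where "l = min (1 / c) (\<delta> / (2 * c\<^sup>2))"
  have l: "l > 0" "l * c \<le> 1" "l * c\<^sup>2 \<le> \<delta> / 2"
  proof -
    show "l > 0" using c \<delta> by (simp add: l_def)
    have "l * c \<le> 1 / c * c" using c by (intro mult_right_mono) (auto simp: l_def)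
    then show "l * c \<le> 1" using c by simp
    have "l * c\<^sup>2 \<le> \<delta> / (2 * c\<^sup>2) * c\<^sup>2" by (intro mult_right_mono) (auto simp: l_def)
    then show "l * c\<^sup>2 \<le> \<delta> / 2" using c by simp
  qed
  define q where "q = expectation (\<lambda>\<omega>. p (S 1 \<omega>) * exp (l * g (S 1 \<omega>)))"
  have [measurable]: "g \<in> borel_measurable borel" unfolding g_def[abs_def] by measurable
  have pw: "p s * exp (l * g s) \<le> p s * (1 + l * g s + l\<^sup>2 * c\<^sup>2)" if "s \<ge> 0" for s
  proof (cases "p s = 0")
    case False
    have "\<bar>l * g s\<bar> \<le> l * c" using g[OF False that] l(1) by (simp add: abs_mult)
    then have "\<bar>l * g s\<bar> \<le> 1" using l(2) by simp
    then have "exp (l * g s) \<le> 1 + l * g s + (l * g s)\<^sup>2" by (rule exp_le_quadratic)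
    also have "(g s)\<^sup>2 \<le> c\<^sup>2" using g[OF False that] c by (subst abs_le_square_iff[symmetric]) simp
    then have "(l * g s)\<^sup>2 \<le> l\<^sup>2 * c\<^sup>2" by (simp add: power_mult_distrib mult_left_mono)
    finally show ?thesis using p0 by (intro mult_left_mono) auto
  qed simp
  have P: "\<bar>p s\<bar> \<le> P" for s using p0[of s] pb[of s] by simp
  have ip: "integrable M (\<lambda>\<omega>. p (S 1 \<omega>))"
    by (rule integrable_const_bound[where B = P]) (use P in auto)
  have ipf: "integrable M (\<lambda>\<omega>. p (S 1 \<omega>) * f (S 1 \<omega>))"
  proof (rule integrable_const_bound[where B = "P * \<bar>C\<bar>"])
    show "AE \<omega> in M. norm (p (S 1 \<omega>) * f (S 1 \<omega>)) \<le> P * \<bar>C\<bar>"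
    proof (rule AE_I2)
      fix \<omega> assume "\<omega> \<in> space M"
      then have "S 1 \<omega> \<ge> 0" by (intro S_nonneg) auto
      then show "norm (p (S 1 \<omega>) * f (S 1 \<omega>)) \<le> P * \<bar>C\<bar>"
      proof (cases "p (S 1 \<omega>) = 0")
        case True
        then show ?thesis using P[of 0] by (simp add: order_trans[OF abs_ge_zero P])
      next
        case False
        then show ?thesis unfolding real_norm_def abs_mult
          using P f[OF False \<open>S 1 \<omega> \<ge> 0\<close>] by (intro mult_mono) (auto intro: order_trans[OF abs_ge_zero])
      qed
    qed
  qed measurable
  have ipe: "integrable M (\<lambda>\<omega>. p (S 1 \<omega>) * exp (l * g (S 1 \<omega>)))"
  proof (rule integrable_const_bound[where B = "P * exp 1"])
    show "AE \<omega> in M. norm (p (S 1 \<omega>) * exp (l * g (S 1 \<omega>))) \<le> P * exp 1"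
    proof (rule AE_I2)
      fix \<omega> assume "\<omega> \<in> space M"
      then have s: "S 1 \<omega> \<ge> 0" by (intro S_nonneg) auto
      show "norm (p (S 1 \<omega>) * exp (l * g (S 1 \<omega>))) \<le> P * exp 1"
      proof (cases "p (S 1 \<omega>) = 0")
        case True
        then show ?thesis by (simp add: order_trans[OF abs_ge_zero P])
      next
        case False
        have "l * g (S 1 \<omega>) \<le> l * c" using g[OF False s] l(1) by (intro mult_left_mono) auto
        then have "exp (l * g (S 1 \<omega>)) \<le> exp 1" using l(2) by simp
        then show ?thesis unfolding real_norm_def abs_mult
          using P by (intro mult_mono) (auto intro: order_trans[OF abs_ge_zero])
      qed
    qed
  qed measurable
  have "q \<le> expectation (\<lambda>\<omega>. (1 - l * a - l * \<delta> + l\<^sup>2 * c\<^sup>2) * p (S 1 \<omega>) + l * (p (S 1 \<omega>) * f (S 1 \<omega>)))"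
    unfolding q_def
  proof (rule integral_mono[OF ipe])
    show "integrable M (\<lambda>\<omega>. (1 - l * a - l * \<delta> + l\<^sup>2 * c\<^sup>2) * p (S 1 \<omega>) + l * (p (S 1 \<omega>) * f (S 1 \<omega>)))"
      using ip ipf by auto
    fix \<omega> assume "\<omega> \<in> space M"
    then have "S 1 \<omega> \<ge> 0" by (intro S_nonneg) auto
    then show "p (S 1 \<omega>) * exp (l * g (S 1 \<omega>)) \<le>
        (1 - l * a - l * \<delta> + l\<^sup>2 * c\<^sup>2) * p (S 1 \<omega>) + l * (p (S 1 \<omega>) * f (S 1 \<omega>))"
      using pw[of "S 1 \<omega>"] by (simp add: g_def algebra_simps)
  qed
  also have "\<dots> = 1 - l * \<delta> + l\<^sup>2 * c\<^sup>2"
    using ip ipf by (simp add: one a)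
  also have "l\<^sup>2 * c\<^sup>2 \<le> l * (\<delta> / 2)"
    using l by (simp add: power2_eq_square mult.assoc mult_left_mono)
  finally have "q \<le> 1 - l * \<delta> / 2" by (simp add: algebra_simps)
  then have q1: "q < 1" using l(1) \<delta> mult_pos_pos[OF l(1) \<delta>] by linarith
  have q0: "q \<ge> 0" unfolding q_def using p0 by (intro integral_nonneg_AE) auto
  show ?thesis
  proof (intro exI[of _ q] conjI allI q0 q1)
    fix n :: nat
    have "(\<integral>\<^sup>+\<omega>. ennreal (\<Prod>i=1..n. p (S i \<omega>)) * indicator {\<omega>. n * (a + \<delta>) \<le> (\<Sum>i=1..n. f (S i \<omega>))} \<omega> \<partial>M)
        \<le> (\<integral>\<^sup>+\<omega>. (\<Prod>i=1..n. ennreal (p (S i \<omega>) * exp (l * g (S i \<omega>)))) \<partial>M)"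
    proof (rule nn_integral_mono)
      fix \<omega>
      have "(\<Prod>i=1..n. ennreal (p (S i \<omega>) * exp (l * g (S i \<omega>)))) =
          ennreal ((\<Prod>i=1..n. p (S i \<omega>)) * exp (l * ((\<Sum>i=1..n. f (S i \<omega>)) - n * (a + \<delta>))))"
        using p0 by (simp add: prod_ennreal prod.distrib exp_sum[symmetric] sum_distrib_left[symmetric]
            g_def sum_subtractf algebra_simps)
      moreover have "(\<Prod>i=1..n. p (S i \<omega>)) * 1 \<le>
          (\<Prod>i=1..n. p (S i \<omega>)) * exp (l * ((\<Sum>i=1..n. f (S i \<omega>)) - n * (a + \<delta>)))"
        if "n * (a + \<delta>) \<le> (\<Sum>i=1..n. f (S i \<omega>))"
        using that p0 l(1) by (intro mult_left_mono) (auto intro!: prod_nonneg)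
      ultimately show "ennreal (\<Prod>i=1..n. p (S i \<omega>)) * indicator {\<omega>. n * (a + \<delta>) \<le> (\<Sum>i=1..n. f (S i \<omega>))} \<omega>
          \<le> (\<Prod>i=1..n. ennreal (p (S i \<omega>) * exp (l * g (S i \<omega>))))"
        by (auto simp: indicator_def intro!: ennreal_leI)
    qed
    also have "\<dots> = (\<integral>\<^sup>+\<omega>. ennreal (p (S 1 \<omega>) * exp (l * g (S 1 \<omega>))) \<partial>M) ^ n"
      by (rule nn_integral_prod_S) measurable
    also have "(\<integral>\<^sup>+\<omega>. ennreal (p (S 1 \<omega>) * exp (l * g (S 1 \<omega>))) \<partial>M) = ennreal q"
      unfolding q_def by (rule nn_integral_eq_integral[OF ipe]) (use p0 in auto)
    also have "ennreal q ^ n = ennreal (q ^ n)" by (rule ennreal_power[OF q0])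
    finally show "(\<integral>\<^sup>+\<omega>. ennreal (\<Prod>i=1..n. p (S i \<omega>)) * indicator {\<omega>. n * (a + \<delta>) \<le> (\<Sum>i=1..n. f (S i \<omega>))} \<omega> \<partial>M) \<le> ennreal (q ^ n)" .
  qed
qed

end

section \<open>Typical blocks of cycles\<close>

context resetting
begin

definition truncated_tilt :: "real \<Rightarrow> real \<Rightarrow> real \<Rightarrow> real \<Rightarrow> real" where
  "truncated_tilt \<zeta> \<theta> A s = tilt \<zeta> \<theta> s * indicator {0..A} s"

lemma measurable_truncated_tilt [measurable]: "truncated_tilt \<zeta> \<theta> A \<in> borel_measurable borel"
  unfolding truncated_tilt_def[abs_def] by measurable

lemma truncated_tilt_nonneg [simp]: "truncated_tilt \<zeta> \<theta> A s \<ge> 0"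
  using tilt_pos[of \<zeta> \<theta> s] by (simp add: truncated_tilt_def less_imp_le del: tilt_pos)

lemma truncated_tilt_le: "truncated_tilt \<zeta> \<theta> A s \<le> exp (\<bar>\<zeta>\<bar> * A + \<bar>\<theta>\<bar> * (A ^ 3 / 3))"
proof (cases "s \<in> {0..A}")
  case True
  have "\<zeta> * s \<le> \<bar>\<zeta>\<bar> * A" using True by (intro mult_mono) auto
  moreover have "\<theta> * (s ^ 3 / 3) \<le> \<bar>\<theta>\<bar> * (A ^ 3 / 3)"
    using True by (intro mult_mono divide_right_mono power_mono) auto
  ultimately show ?thesis using True by (simp add: truncated_tilt_def tilt_def)
qed (simp add: truncated_tilt_def)

text \<open>Completing \<open>n\<close> cycles that collect variance \<open>x t\<close> before time \<open>t\<close> forces the conditional variance at time \<open>t\<close> to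
be at least \<open>x t\<close>.\<close>

definition block_event :: "nat \<Rightarrow> real \<Rightarrow> real \<Rightarrow> 'a set" where
  "block_event n t x = {\<omega>\<in>space M. renewal_time S n \<omega> \<le> t \<and> x * t \<le> (\<Sum>i=1..n. S i \<omega> ^ 3) / 3}"

lemma measurable_sum_cubes [measurable]: "(\<lambda>\<omega>. \<Sum>i=1..n. S i \<omega> ^ 3) \<in> borel_measurable M"
  by (intro borel_measurable_sum borel_measurable_power S_measurable) auto

lemma measurable_renewal_time_M [measurable]: "renewal_time S n \<in> borel_measurable M"
  by (rule measurable_renewal_time) (rule S_measurable)

lemma sets_block_event [measurable]: "block_event n t x \<in> sets M"
  unfolding block_event_def by measurable

text \<open>On the typical event the tilting density is at most the exponential factor, so the probability of the event under
\<open>M\<close>, multiplied by this factor, is at least its probability under the tilted law, which tends to 1. Normalising by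
\<open>m0 \<ge> 1\<close> only decreases the density.\<close>

lemma tilted_typical_block:
  fixes \<zeta> \<theta> A \<delta> :: real
  defines "D \<equiv> truncated_tilt \<zeta> \<theta> A"
  defines "m0 \<equiv> expectation (\<lambda>\<omega>. D (S 1 \<omega>))"
    and "m1 \<equiv> expectation (\<lambda>\<omega>. D (S 1 \<omega>) * S 1 \<omega>)"
    and "m2 \<equiv> expectation (\<lambda>\<omega>. D (S 1 \<omega>) * (S 1 \<omega> ^ 3 / 3))"
  assumes m0: "m0 \<ge> 1" and \<delta>: "\<delta> > 0"
  shows "\<forall>\<^sub>F n in sequentially. 1/2 \<le> exp (n * (\<zeta> * (m1 / m0) + \<theta> * (m2 / m0) + (\<bar>\<zeta>\<bar> + \<bar>\<theta>\<bar>) * \<delta>)) *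
      prob {\<omega>\<in>space M. \<bar>renewal_time S n \<omega> - n * (m1 / m0)\<bar> < n * \<delta> \<and>
        \<bar>(\<Sum>i=1..n. S i \<omega> ^ 3) / 3 - n * (m2 / m0)\<bar> < n * \<delta>}"
proof -
  have S1[measurable]: "S 1 \<in> borel_measurable M" by (rule S_measurable) simp
  define p where "p s = D s / m0" for s
  define P where "P = exp (\<bar>\<zeta>\<bar> * A + \<bar>\<theta>\<bar> * (A ^ 3 / 3))"
  have [measurable]: "D \<in> borel_measurable borel" by (simp add: D_def)
  have p[measurable]: "p \<in> borel_measurable borel" unfolding p_def[abs_def] by simp
  have p0: "p s \<ge> 0" for s using m0 by (simp add: p_def D_def)
  have p_le: "p s \<le> D s" for s
    using m0 truncated_tilt_nonneg[of \<zeta> \<theta> A s] mult_left_mono[of 1 m0 "D s"]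
    by (simp add: p_def D_def[symmetric] field_simps)
  have pb: "p s \<le> P" for s
    using p_le[of s] truncated_tilt_le[of \<zeta> \<theta> A s] by (simp add: P_def D_def)
  have supp: "0 \<le> s \<and> s \<le> A" if "p s \<noteq> 0" for s
    using that by (auto simp: p_def D_def truncated_tilt_def indicator_def split: if_splits)
  have one: "expectation (\<lambda>\<omega>. p (S 1 \<omega>)) = 1"
    using m0 by (simp add: p_def m0_def)
  have e1: "expectation (\<lambda>\<omega>. p (S 1 \<omega>) * S 1 \<omega>) = m1 / m0"
    by (simp add: p_def m1_def)
  have e2: "expectation (\<lambda>\<omega>. p (S 1 \<omega>) * (S 1 \<omega> ^ 3 / 3)) = m2 / m0"
    by (simp add: p_def m2_def)
  have e3: "expectation (\<lambda>\<omega>. p (S 1 \<omega>) * (- S 1 \<omega>)) = - (m1 / m0)"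
    by (simp add: p_def m1_def)
  have e4: "expectation (\<lambda>\<omega>. p (S 1 \<omega>) * (- (S 1 \<omega> ^ 3 / 3))) = - (m2 / m0)"
    by (simp add: p_def m2_def)
  let ?I = "\<lambda>(n::nat) (f :: real \<Rightarrow> real) (a :: real). \<integral>\<^sup>+\<omega>. ennreal (\<Prod>i=1..n. p (S i \<omega>)) *
      indicator {\<omega>. real n * (a + \<delta>) \<le> (\<Sum>i=1..n. f (S i \<omega>))} \<omega> \<partial>M"
  have "\<exists>q\<ge>0. q < 1 \<and> (\<forall>n. ?I n (\<lambda>s. s) (m1 / m0) \<le> ennreal (q ^ n))"
    by (rule weighted_chernoff[where P = P and C = "A"]) (use p0 pb one e1 \<delta> in \<open>auto dest: supp\<close>)
  then obtain q1 where q1: "0 \<le> q1" "q1 < 1" "\<And>n. ?I n (\<lambda>s. s) (m1 / m0) \<le> ennreal (q1 ^ n)"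
    by blast
  have "\<exists>q\<ge>0. q < 1 \<and> (\<forall>n. ?I n (\<lambda>s. s ^ 3 / 3) (m2 / m0) \<le> ennreal (q ^ n))"
    by (rule weighted_chernoff[where P = P and C = "A ^ 3 / 3"]) (use p0 pb one e2 \<delta> in \<open>auto dest: supp intro!: power_mono\<close>)
  then obtain q2 where q2: "0 \<le> q2" "q2 < 1" "\<And>n. ?I n (\<lambda>s. s ^ 3 / 3) (m2 / m0) \<le> ennreal (q2 ^ n)"
    by blast
  have "\<exists>q\<ge>0. q < 1 \<and> (\<forall>n. ?I n (\<lambda>s. - s) (- (m1 / m0)) \<le> ennreal (q ^ n))"
    by (rule weighted_chernoff[where P = P and C = "A"]) (use p0 pb one e3 \<delta> in \<open>auto dest: supp\<close>)
  then obtain q3 where q3: "0 \<le> q3" "q3 < 1" "\<And>n. ?I n (\<lambda>s. - s) (- (m1 / m0)) \<le> ennreal (q3 ^ n)"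
    by blast
  have "\<exists>q\<ge>0. q < 1 \<and> (\<forall>n. ?I n (\<lambda>s. - (s ^ 3 / 3)) (- (m2 / m0)) \<le> ennreal (q ^ n))"
    by (rule weighted_chernoff[where P = P and C = "A ^ 3 / 3"]) (use p0 pb one e4 \<delta> in \<open>auto dest: supp intro!: power_mono\<close>)
  then obtain q4 where q4: "0 \<le> q4" "q4 < 1" "\<And>n. ?I n (\<lambda>s. - (s ^ 3 / 3)) (- (m2 / m0)) \<le> ennreal (q4 ^ n)"
    by blast
  define \<alpha> where "\<alpha> = \<zeta> * (m1 / m0) + \<theta> * (m2 / m0) + (\<bar>\<zeta>\<bar> + \<bar>\<theta>\<bar>) * \<delta>"
  define G where "G n = {\<omega>\<in>space M. \<bar>renewal_time S n \<omega> - n * (m1 / m0)\<bar> < n * \<delta> \<and>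
        \<bar>(\<Sum>i=1..n. S i \<omega> ^ 3) / 3 - n * (m2 / m0)\<bar> < n * \<delta>}" for n :: nat
  have [measurable]: "G n \<in> sets M" for n unfolding G_def by measurable
  have key: "1 \<le> exp (n * \<alpha>) * prob (G n) + (q1 ^ n + q2 ^ n + q3 ^ n + q4 ^ n)" for n
  proof -
    have Sm: "S i \<in> borel_measurable M" if "i \<in> {1..n}" for i using that by (intro S_measurable) auto
    have Pm[measurable]: "(\<lambda>\<omega>. \<Prod>i=1..n. p (S i \<omega>)) \<in> borel_measurable M"
      by (intro borel_measurable_prod measurable_compose[OF Sm p])
    have Bm: "(\<lambda>\<omega>. indicator {\<omega>. c \<le> (\<Sum>i=1..n. f (S i \<omega>))} \<omega> :: ennreal) \<in> borel_measurable M"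
      if f: "f \<in> borel_measurable borel" for f and c :: real
    proof -
      have "(\<lambda>\<omega>. \<Sum>i=1..n. f (S i \<omega>)) \<in> borel_measurable M"
        by (intro borel_measurable_sum measurable_compose[OF Sm f])
      then show ?thesis unfolding indicator_def by measurable
    qed
    have Jm: "(\<lambda>\<omega>. ennreal (\<Prod>i=1..n. p (S i \<omega>)) * indicator {\<omega>. c \<le> (\<Sum>i=1..n. f (S i \<omega>))} \<omega>) \<in> borel_measurable M"
      if "f \<in> borel_measurable borel" for f and c :: real
      using Bm[OF that] Pm by (intro borel_measurable_times_ennreal measurable_compose[OF Pm]) auto
    have add5: "(\<integral>\<^sup>+\<omega>. h0 \<omega> + (h1 \<omega> + (h2 \<omega> + (h3 \<omega> + h4 \<omega>))) \<partial>M) =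
        integral\<^sup>N M h0 + (integral\<^sup>N M h1 + (integral\<^sup>N M h2 + (integral\<^sup>N M h3 + integral\<^sup>N M h4)))"
      if "h0 \<in> borel_measurable M" "h1 \<in> borel_measurable M" "h2 \<in> borel_measurable M"
        "h3 \<in> borel_measurable M" "h4 \<in> borel_measurable M" for h0 h1 h2 h3 h4 :: "'a \<Rightarrow> ennreal"
      using that by (simp add: nn_integral_add)
    have P_le: "(\<Prod>i=1..n. p (S i \<omega>)) \<le> exp (n * \<alpha>)" if "\<omega> \<in> G n" for \<omega>
    proof -
      have "(\<Prod>i=1..n. p (S i \<omega>)) \<le> (\<Prod>i=1..n. tilt \<zeta> \<theta> (S i \<omega>))"
      proof (rule prod_mono)
        fix i
        have "D (S i \<omega>) \<le> tilt \<zeta> \<theta> (S i \<omega>)"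
          using tilt_pos[of \<zeta> \<theta> "S i \<omega>"] by (auto simp: D_def truncated_tilt_def indicator_def simp del: tilt_pos)
        then show "0 \<le> p (S i \<omega>) \<and> p (S i \<omega>) \<le> tilt \<zeta> \<theta> (S i \<omega>)"
          using p0[of "S i \<omega>"] p_le[of "S i \<omega>"] by auto
      qed
      also have "\<dots> = exp (\<zeta> * renewal_time S n \<omega> + \<theta> * ((\<Sum>i=1..n. S i \<omega> ^ 3) / 3))"
        by (rule prod_tilt)
      also have "\<dots> \<le> exp (n * \<alpha>)"
      proof -
        have *: "u * v \<le> u * c + \<bar>u\<bar> * d" if "\<bar>v - c\<bar> < d" for u v c d :: real
        proof -
          have "u * (v - c) \<le> \<bar>u\<bar> * \<bar>v - c\<bar>" by (metis abs_ge_self abs_mult)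
          also have "\<dots> \<le> \<bar>u\<bar> * d" using that by (intro mult_left_mono) auto
          finally show ?thesis by (simp add: algebra_simps)
        qed
        have "\<zeta> * renewal_time S n \<omega> + \<theta> * ((\<Sum>i=1..n. S i \<omega> ^ 3) / 3) \<le>
            (\<zeta> * (n * (m1 / m0)) + \<bar>\<zeta>\<bar> * (n * \<delta>)) + (\<theta> * (n * (m2 / m0)) + \<bar>\<theta>\<bar> * (n * \<delta>))"
          using that by (intro add_mono *) (auto simp: G_def)
        also have "\<dots> = n * \<alpha>" by (simp add: \<alpha>_def algebra_simps)
        finally show ?thesis by simp
      qed
      finally show ?thesis .
    qed
    \<comment> \<open>Split the total tilted mass 1 into the typical event and the four ways to deviate from it.\<close>
    have "1 = (\<integral>\<^sup>+\<omega>. ennreal (p (S 1 \<omega>)) \<partial>M) ^ n"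
    proof -
      have "integrable M (\<lambda>\<omega>. p (S 1 \<omega>))"
        by (rule integrable_const_bound[where B = P]) (use p0 pb in auto)
      then have "(\<integral>\<^sup>+\<omega>. ennreal (p (S 1 \<omega>)) \<partial>M) = 1"
        using p0 one by (subst nn_integral_eq_integral) auto
      then show ?thesis by simp
    qed
    also have "\<dots> = (\<integral>\<^sup>+\<omega>. (\<Prod>i=1..n. ennreal (p (S i \<omega>))) \<partial>M)"
      by (rule nn_integral_prod_S[symmetric]) simp
    also have "\<dots> = (\<integral>\<^sup>+\<omega>. ennreal (\<Prod>i=1..n. p (S i \<omega>)) \<partial>M)"
      using p0 by (simp add: prod_ennreal)
    also have "\<dots> \<le> (\<integral>\<^sup>+\<omega>. ennreal (exp (n * \<alpha>)) * indicator (G n) \<omega> +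
        (ennreal (\<Prod>i=1..n. p (S i \<omega>)) * indicator {\<omega>. n * (m1 / m0 + \<delta>) \<le> (\<Sum>i=1..n. S i \<omega>)} \<omega> +
        (ennreal (\<Prod>i=1..n. p (S i \<omega>)) * indicator {\<omega>. n * (m2 / m0 + \<delta>) \<le> (\<Sum>i=1..n. S i \<omega> ^ 3 / 3)} \<omega> +
        (ennreal (\<Prod>i=1..n. p (S i \<omega>)) * indicator {\<omega>. n * (- (m1 / m0) + \<delta>) \<le> (\<Sum>i=1..n. - S i \<omega>)} \<omega> +
        ennreal (\<Prod>i=1..n. p (S i \<omega>)) * indicator {\<omega>. n * (- (m2 / m0) + \<delta>) \<le> (\<Sum>i=1..n. - (S i \<omega> ^ 3 / 3))} \<omega>))) \<partial>M)"
    proof (rule nn_integral_mono)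
      fix \<omega> assume w: "\<omega> \<in> space M"
      have dis: "(\<bar>T - x\<bar> < y \<and> \<bar>Q - z\<bar> < y) \<or> x + y \<le> T \<or> z + y \<le> Q \<or> y - x \<le> - T \<or> y - z \<le> - Q"
        for T Q x y z :: real by arith
      define T Q x y z where "T = (\<Sum>i=1..n. S i \<omega>)" and "Q = (\<Sum>i=1..n. S i \<omega> ^ 3) / 3"
        and "x = n * (m1 / m0)" and "y = n * \<delta>" and "z = n * (m2 / m0)"
      note defs = this
      have 1: "\<omega> \<in> G n" if "\<bar>T - x\<bar> < y \<and> \<bar>Q - z\<bar> < y"
        using that w by (simp add: G_def renewal_time_def defs)
      have 2: "n * (m1 / m0 + \<delta>) \<le> (\<Sum>i=1..n. S i \<omega>)" if "x + y \<le> T"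
        using that unfolding defs distrib_left .
      have 3: "n * (m2 / m0 + \<delta>) \<le> (\<Sum>i=1..n. S i \<omega> ^ 3 / 3)" if "z + y \<le> Q"
        using that unfolding defs distrib_left sum_divide_distrib .
      have 4: "n * (- (m1 / m0) + \<delta>) \<le> (\<Sum>i=1..n. - S i \<omega>)" if "y - x \<le> - T"
        using that unfolding defs sum_negf by (simp add: right_diff_distrib)
      have 5: "n * (- (m2 / m0) + \<delta>) \<le> (\<Sum>i=1..n. - (S i \<omega> ^ 3 / 3))" if "y - z \<le> - Q"
        using that unfolding defs sum_negf sum_divide_distrib by (simp add: right_diff_distrib)
      consider "\<omega> \<in> G n" | "n * (m1 / m0 + \<delta>) \<le> (\<Sum>i=1..n. S i \<omega>)"
        | "n * (m2 / m0 + \<delta>) \<le> (\<Sum>i=1..n. S i \<omega> ^ 3 / 3)"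
        | "n * (- (m1 / m0) + \<delta>) \<le> (\<Sum>i=1..n. - S i \<omega>)"
        | "n * (- (m2 / m0) + \<delta>) \<le> (\<Sum>i=1..n. - (S i \<omega> ^ 3 / 3))"
        using dis[of T x y Q z] 1 2 3 4 5 by blast
      then show "ennreal (\<Prod>i=1..n. p (S i \<omega>)) \<le> ennreal (exp (n * \<alpha>)) * indicator (G n) \<omega> +
        (ennreal (\<Prod>i=1..n. p (S i \<omega>)) * indicator {\<omega>. n * (m1 / m0 + \<delta>) \<le> (\<Sum>i=1..n. S i \<omega>)} \<omega> +
        (ennreal (\<Prod>i=1..n. p (S i \<omega>)) * indicator {\<omega>. n * (m2 / m0 + \<delta>) \<le> (\<Sum>i=1..n. S i \<omega> ^ 3 / 3)} \<omega> +
        (ennreal (\<Prod>i=1..n. p (S i \<omega>)) * indicator {\<omega>. n * (- (m1 / m0) + \<delta>) \<le> (\<Sum>i=1..n. - S i \<omega>)} \<omega> +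
        ennreal (\<Prod>i=1..n. p (S i \<omega>)) * indicator {\<omega>. n * (- (m2 / m0) + \<delta>) \<le> (\<Sum>i=1..n. - (S i \<omega> ^ 3 / 3))} \<omega>)))"
      proof cases
        case 1
        then have "ennreal (\<Prod>i=1..n. p (S i \<omega>)) \<le> ennreal (exp (n * \<alpha>)) * indicator (G n) \<omega>"
          using P_le by (auto intro!: ennreal_leI)
        then show ?thesis by (rule order_trans) simp
      qed (auto intro: add_increasing add_increasing2)
    qed
    also have "\<dots> = ennreal (exp (n * \<alpha>)) * emeasure M (G n) + (?I n (\<lambda>s. s) (m1 / m0) +
        (?I n (\<lambda>s. s ^ 3 / 3) (m2 / m0) + (?I n (\<lambda>s. - s) (- (m1 / m0)) + ?I n (\<lambda>s. - (s ^ 3 / 3)) (- (m2 / m0)))))"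
    proof (subst add5)
      show "(\<lambda>\<omega>. ennreal (exp (n * \<alpha>)) * indicator (G n) \<omega>) \<in> borel_measurable M" by measurable
    qed (simp_all add: nn_integral_cmult_indicator Jm[of "\<lambda>s. s"] Jm[of "\<lambda>s. s ^ 3 / 3"] Jm[of "\<lambda>s. - s"]
        Jm[of "\<lambda>s. - (s ^ 3 / 3)"])
    also have "\<dots> \<le> ennreal (exp (n * \<alpha>)) * emeasure M (G n) + (ennreal (q1 ^ n) + (ennreal (q2 ^ n) + (ennreal (q3 ^ n) + ennreal (q4 ^ n))))"
      by (intro add_mono q1 q2 q3 q4 order_refl)
    also have "\<dots> = ennreal (exp (n * \<alpha>) * prob (G n) + (q1 ^ n + q2 ^ n + q3 ^ n + q4 ^ n))"
      using q1(1) q2(1) q3(1) q4(1)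
      by (simp add: emeasure_eq_measure ennreal_mult'[symmetric] ennreal_plus[symmetric] add.assoc del: ennreal_plus)
    finally show ?thesis by simp
  qed
  have "(\<lambda>n. q1 ^ n + q2 ^ n + q3 ^ n + q4 ^ n) \<longlonglongrightarrow> 0 + 0 + 0 + 0"
    by (intro tendsto_add LIMSEQ_realpow_zero q1 q2 q3 q4)
  then have "\<forall>\<^sub>F n in sequentially. q1 ^ n + q2 ^ n + q3 ^ n + q4 ^ n < 1/2"
    by (intro order_tendstoD(2)) auto
  then show ?thesis unfolding \<alpha>_def[symmetric] G_def[symmetric]
  proof eventually_elim
    case (elim n)
    then show ?case using key[of n] by linarith
  qed
qed

text \<open>The cost of a block per unit of time: \<open>t m\<^sub>0/m\<^sub>1\<close> cycles fit into time \<open>t\<close>, and the exponential factor of the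
typical block is \<open>\<zeta> + \<theta> m\<^sub>2/m\<^sub>1\<close> per unit of time.\<close>

lemma block_event_lower_bound:
  fixes \<zeta> \<theta> A :: real
  defines "D \<equiv> truncated_tilt \<zeta> \<theta> A"
  defines "m0 \<equiv> expectation (\<lambda>\<omega>. D (S 1 \<omega>))"
    and "m1 \<equiv> expectation (\<lambda>\<omega>. D (S 1 \<omega>) * S 1 \<omega>)"
    and "m2 \<equiv> expectation (\<lambda>\<omega>. D (S 1 \<omega>) * (S 1 \<omega> ^ 3 / 3))"
  assumes m0: "m0 \<ge> 1" and m1: "m1 > 0" and x: "x < m2 / m1" and y: "\<zeta> + \<theta> * (m2 / m1) < y"
  shows "\<forall>\<^sub>F t in at_top. \<exists>n. exp (- y * t) \<le> prob (block_event n t x)"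
proof -
  define a1 a2 where "a1 = m1 / m0" and "a2 = m2 / m0"
  have a1: "a1 > 0" using m0 m1 by (simp add: a1_def)
  have r: "a2 / a1 = m2 / m1" using m0 by (simp add: a1_def a2_def)
  define \<alpha> where "\<alpha> d = \<zeta> * a1 + \<theta> * a2 + (\<bar>\<zeta>\<bar> + \<bar>\<theta>\<bar>) * d" for d
  have "((\<lambda>d. (a2 - d) / (a1 + d)) \<longlongrightarrow> (a2 - 0) / (a1 + 0)) (at_right 0)"
    using a1 by (intro tendsto_intros) auto
  then have ev1: "\<forall>\<^sub>F d in at_right 0. x < (a2 - d) / (a1 + d)"
    by (rule order_tendstoD(1)) (use x r in simp)
  have "((\<lambda>d. \<alpha> d / (a1 + d)) \<longlongrightarrow> (\<zeta> * a1 + \<theta> * a2 + (\<bar>\<zeta>\<bar> + \<bar>\<theta>\<bar>) * 0) / (a1 + 0)) (at_right 0)"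
    unfolding \<alpha>_def using a1 by (intro tendsto_intros) auto
  moreover have "(\<zeta> * a1 + \<theta> * a2 + (\<bar>\<zeta>\<bar> + \<bar>\<theta>\<bar>) * 0) / (a1 + 0) = \<zeta> + \<theta> * (a2 / a1)"
    using a1 by (simp add: add_divide_distrib)
  ultimately have ev2: "\<forall>\<^sub>F d in at_right 0. \<alpha> d / (a1 + d) < y"
    using y r by (intro order_tendstoD(2)) auto
  have "\<forall>\<^sub>F d in at_right (0::real). d > 0" by (simp add: eventually_at_right_less)
  with ev1 ev2 have "\<forall>\<^sub>F d in at_right 0. d > 0 \<and> x < (a2 - d) / (a1 + d) \<and> \<alpha> d / (a1 + d) < y"
    by eventually_elim auto
  then obtain d where d: "d > 0" "x < (a2 - d) / (a1 + d)" "\<alpha> d / (a1 + d) < y"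
    using eventually_happens[of _ "at_right (0::real)"] by auto
  \<comment> \<open>A typical block of \<open>N t\<close> cycles ends before \<open>N t * b \<le> t\<close>.\<close>
  define b where "b = a1 + d"
  have b: "b > 0" using a1 d by (simp add: b_def)
  define N where "N t = nat \<lfloor>t / b\<rfloor>" for t :: real
  have N: "real (N t) \<le> t / b" "t / b - 1 \<le> real (N t)" if "t \<ge> 0" for t
  proof -
    have "t / b \<ge> 0" using that b by simp
    then have "real (N t) = \<lfloor>t / b\<rfloor>" by (simp add: N_def)
    then show "real (N t) \<le> t / b" "t / b - 1 \<le> real (N t)" by linarith+
  qed
  have ev0: "\<forall>\<^sub>F t in at_top. t > (0::real)" by (rule eventually_gt_at_top)
  have lim: "((\<lambda>t. real (N t) / t) \<longlongrightarrow> 1 / b) at_top"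
  proof (rule real_tendsto_sandwich[where f = "\<lambda>t. 1 / b - 1 / t" and h = "\<lambda>_. 1 / b"])
    show "\<forall>\<^sub>F t in at_top. 1 / b - 1 / t \<le> real (N t) / t"
      using ev0
    proof eventually_elim
      case (elim t)
      then show ?case using divide_right_mono[OF N(2)[of t], of t] by (simp add: diff_divide_distrib)
    qed
    show "\<forall>\<^sub>F t in at_top. real (N t) / t \<le> 1 / b"
      using ev0
    proof eventually_elim
      case (elim t)
      then show ?case using divide_right_mono[OF N(1)[of t], of t] by simp
    qed
    show "((\<lambda>t. 1 / b - 1 / t) \<longlongrightarrow> 1 / b) at_top" by real_asymp
  qed simp
  have Ntop: "filterlim N sequentially at_top"
  proof -
    have "filterlim (\<lambda>t. t / b - 1) at_top at_top" using b by real_asymp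
    then have "filterlim (\<lambda>t. real (N t)) at_top at_top"
      by (rule filterlim_at_top_mono) (rule eventually_mono[OF ev0], rule N(2), simp)
    then show ?thesis by (simp add: filterlim_sequentially_iff_filterlim_real)
  qed
  have "((\<lambda>t. real (N t) / t * (a2 - d)) \<longlongrightarrow> 1 / b * (a2 - d)) at_top"
    by (intro tendsto_intros lim)
  then have ev3: "\<forall>\<^sub>F t in at_top. x < real (N t) / t * (a2 - d)"
    using d(2) by (intro order_tendstoD(1)) (auto simp: b_def)
  have "((\<lambda>t. real (N t) / t * \<alpha> d + ln 2 / t) \<longlongrightarrow> 1 / b * \<alpha> d + 0) at_top"
    by (intro tendsto_intros lim tendsto_divide_0[OF tendsto_const] filterlim_at_top_imp_at_infinity filterlim_ident)
  then have ev4: "\<forall>\<^sub>F t in at_top. real (N t) / t * \<alpha> d + ln 2 / t < y"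
    using d(3) by (intro order_tendstoD(2)) (auto simp: b_def)
  have ev5: "\<forall>\<^sub>F t in at_top. 1/2 \<le> exp (N t * \<alpha> d) *
      prob {\<omega>\<in>space M. \<bar>renewal_time S (N t) \<omega> - N t * a1\<bar> < N t * d \<and>
        \<bar>(\<Sum>i=1..N t. S i \<omega> ^ 3) / 3 - N t * a2\<bar> < N t * d}"
    using tilted_typical_block[where \<zeta> = \<zeta> and \<theta> = \<theta> and A = A and \<delta> = d, folded D_def, folded m0_def m1_def m2_def, OF m0 d(1)]
    unfolding a1_def[symmetric] a2_def[symmetric] \<alpha>_def[symmetric]
    by (rule eventually_compose_filterlim[OF _ Ntop])
  from ev0 ev3 ev4 ev5 show ?thesis
  proof eventually_elim
    case (elim t)
    let ?G = "{\<omega>\<in>space M. \<bar>renewal_time S (N t) \<omega> - N t * a1\<bar> < N t * d \<and>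
        \<bar>(\<Sum>i=1..N t. S i \<omega> ^ 3) / 3 - N t * a2\<bar> < N t * d}"
    have Nb: "real (N t) * b \<le> t" using N(1)[of t] elim(1) b by (simp add: field_simps)
    have xt: "x * t \<le> real (N t) * (a2 - d)" using elim(1,2) by (simp add: field_simps)
    have "?G \<subseteq> block_event (N t) t x"
    proof
      fix \<omega> assume w: "\<omega> \<in> ?G"
      then have "renewal_time S (N t) \<omega> < N t * a1 + N t * d" "N t * a2 - N t * d < (\<Sum>i=1..N t. S i \<omega> ^ 3) / 3"
        by (auto simp: abs_less_iff)
      then show "\<omega> \<in> block_event (N t) t x"
        using w Nb xt by (simp add: block_event_def b_def algebra_simps)
    qed
    then have "prob ?G \<le> prob (block_event (N t) t x)" by (intro finite_measure_mono) auto
    moreover have "exp (- y * t) \<le> prob ?G"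
    proof -
      have "N t * \<alpha> d + ln 2 \<le> y * t" using elim(1,3) by (simp add: field_simps)
      then have "exp (- y * t) \<le> exp (- (N t * \<alpha> d + ln 2))" by simp
      also have "\<dots> = exp (- (N t * \<alpha> d)) * (1/2)"
        by (simp add: exp_diff exp_minus field_simps)
      also have "\<dots> \<le> exp (- (N t * \<alpha> d)) * (exp (N t * \<alpha> d) * prob ?G)"
        by (rule mult_left_mono[OF elim(4)]) simp
      also have "\<dots> = prob ?G" by (simp add: exp_minus)
      finally show ?thesis .
    qed
    ultimately show ?case by (intro exI[of _ "N t"]) simp
  qed
qed

end

section \<open>The optimal tilt\<close>

context resetting
begin

lemma integrable_bounded_times_truncated_tilt:
  assumes [measurable]: "f \<in> borel_measurable borel"
    and f: "\<And>s. 0 \<le> s \<Longrightarrow> s \<le> A \<Longrightarrow> \<bar>f s\<bar> \<le> C"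
  shows "integrable M (\<lambda>\<omega>. truncated_tilt \<zeta> \<theta> A (S 1 \<omega>) * f (S 1 \<omega>))"
proof -
  have [measurable]: "S 1 \<in> borel_measurable M" by (rule S_measurable) simp
  define P where "P = exp (\<bar>\<zeta>\<bar> * A + \<bar>\<theta>\<bar> * (A ^ 3 / 3))"
  have "\<bar>truncated_tilt \<zeta> \<theta> A s * f s\<bar> \<le> P * \<bar>C\<bar>" for s
  proof (cases "s \<in> {0..A}")
    case True
    then show ?thesis
      unfolding abs_mult using f[of s] truncated_tilt_le[of \<zeta> \<theta> A s]
      by (intro mult_mono) (auto simp: P_def)
  qed (simp add: truncated_tilt_def P_def)
  then show ?thesis
    by (intro integrable_const_bound[where B = "P * \<bar>C\<bar>"]) auto
qed

lemma integrable_truncated_tilt: "integrable M (\<lambda>\<omega>. truncated_tilt \<zeta> \<theta> A (S 1 \<omega>))"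
  using integrable_bounded_times_truncated_tilt[of "\<lambda>_. 1" A 1 \<zeta> \<theta>] by simp

lemma integrable_truncated_tilt_S: "integrable M (\<lambda>\<omega>. truncated_tilt \<zeta> \<theta> A (S 1 \<omega>) * S 1 \<omega>)"
  by (rule integrable_bounded_times_truncated_tilt[of "\<lambda>s. s" A A]) auto

lemma integrable_truncated_tilt_S3: "integrable M (\<lambda>\<omega>. truncated_tilt \<zeta> \<theta> A (S 1 \<omega>) * (S 1 \<omega> ^ 3 / 3))"
  by (rule integrable_bounded_times_truncated_tilt[of "\<lambda>s. s ^ 3 / 3" A "A ^ 3 / 3"]) (auto intro!: power_mono)

lemma truncated_tilt_tendsto:
  "(\<lambda>n. ennreal (expectation (\<lambda>\<omega>. truncated_tilt \<zeta> \<theta> (real n) (S 1 \<omega>)))) \<longlonglongrightarrow>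
     (\<integral>\<^sup>+\<omega>. ennreal (tilt \<zeta> \<theta> (S 1 \<omega>)) \<partial>M)"
proof -
  have [measurable]: "S 1 \<in> borel_measurable M" by (rule S_measurable) simp
  have "(\<lambda>n. \<integral>\<^sup>+\<omega>. ennreal (truncated_tilt \<zeta> \<theta> (real n) (S 1 \<omega>)) \<partial>M) \<longlonglongrightarrow>
     (\<integral>\<^sup>+\<omega>. ennreal (tilt \<zeta> \<theta> (S 1 \<omega>) * indicator {0..} (S 1 \<omega>)) \<partial>M)"
  proof (rule nn_integral_LIMSEQ)
    show "incseq (\<lambda>n \<omega>. ennreal (truncated_tilt \<zeta> \<theta> (real n) (S 1 \<omega>)))"
      using tilt_pos[of \<zeta> \<theta>] by (auto simp: incseq_def le_fun_def truncated_tilt_def indicator_def less_imp_le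
          intro!: ennreal_leI simp del: tilt_pos)
  next
    fix \<omega>
    obtain N where N: "S 1 \<omega> \<le> real N" using real_arch_simple by blast
    have "\<forall>\<^sub>F n in sequentially. ennreal (truncated_tilt \<zeta> \<theta> (real n) (S 1 \<omega>)) =
        ennreal (tilt \<zeta> \<theta> (S 1 \<omega>) * indicator {0..} (S 1 \<omega>))"
      using eventually_ge_at_top[of N]
    proof eventually_elim
      case (elim n)
      then have "S 1 \<omega> \<le> real n" using N by (meson of_nat_mono order_trans)
      then show ?case by (simp add: truncated_tilt_def indicator_def)
    qed
    then show "(\<lambda>n. ennreal (truncated_tilt \<zeta> \<theta> (real n) (S 1 \<omega>))) \<longlonglongrightarrow>
        ennreal (tilt \<zeta> \<theta> (S 1 \<omega>) * indicator {0..} (S 1 \<omega>))"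
      by (rule tendsto_eventually)
  qed auto
  also have "(\<integral>\<^sup>+\<omega>. ennreal (tilt \<zeta> \<theta> (S 1 \<omega>) * indicator {0..} (S 1 \<omega>)) \<partial>M) =
      (\<integral>\<^sup>+\<omega>. ennreal (tilt \<zeta> \<theta> (S 1 \<omega>)) \<partial>M)"
    using S_nonneg[of 1] by (intro nn_integral_cong) auto
  finally show ?thesis
    by (subst nn_integral_eq_integral[symmetric, OF integrable_truncated_tilt]) auto
qed

lemma truncated_tilt_mono:
  assumes "A \<le> A'"
  shows "expectation (\<lambda>\<omega>. truncated_tilt \<zeta> \<theta> A (S 1 \<omega>)) \<le> expectation (\<lambda>\<omega>. truncated_tilt \<zeta> \<theta> A' (S 1 \<omega>))"
proof (rule integral_mono[OF integrable_truncated_tilt integrable_truncated_tilt])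
  fix \<omega>
  show "truncated_tilt \<zeta> \<theta> A (S 1 \<omega>) \<le> truncated_tilt \<zeta> \<theta> A' (S 1 \<omega>)"
    using assms tilt_pos[of \<zeta> \<theta> "S 1 \<omega>"]
    by (auto simp: truncated_tilt_def indicator_def simp del: tilt_pos)
qed

lemma eventually_truncated_tilt_gt_1:
  assumes "(\<integral>\<^sup>+\<omega>. ennreal (tilt \<zeta> \<theta> (S 1 \<omega>)) \<partial>M) > 1"
  shows "\<forall>\<^sub>F n in sequentially. expectation (\<lambda>\<omega>. truncated_tilt \<zeta> \<theta> (real n) (S 1 \<omega>)) > 1"
  using order_tendstoD(1)[OF truncated_tilt_tendsto assms]
proof eventually_elim
  case (elim n)
  then have "ennreal 1 < ennreal (expectation (\<lambda>\<omega>. truncated_tilt \<zeta> \<theta> (real n) (S 1 \<omega>)))" by simp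
  then show ?case by (subst (asm) ennreal_less_iff) auto
qed

lemma exists_positive_mass_interval:
  obtains n0 :: nat where "n0 > 0" "prob {\<omega>\<in>space M. 1 / real n0 \<le> S 1 \<omega> \<and> S 1 \<omega> \<le> real n0} > 0"
proof -
  have [measurable]: "S 1 \<in> borel_measurable M" by (rule S_measurable) simp
  let ?E = "\<lambda>n. {\<omega>\<in>space M. 1 / real (Suc n) \<le> S 1 \<omega> \<and> S 1 \<omega> \<le> real (Suc n)}"
  have "\<exists>n. prob (?E n) > 0"
  proof (rule ccontr)
    assume "\<not> ?thesis"
    then have "prob (?E n) = 0" for n by (metis measure_nonneg less_le)
    then have "AE \<omega> in M. \<omega> \<notin> ?E n" for n
      by (intro AE_not_in) (auto simp: null_sets_def emeasure_eq_measure)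
    then have "AE \<omega> in M. \<forall>n. \<omega> \<notin> ?E n" by (simp add: AE_all_countable)
    then have "AE \<omega> in M. \<not> S 1 \<omega> > 0" using AE_space
    proof eventually_elim
      case (elim \<omega>)
      show ?case
      proof
        assume pos: "S 1 \<omega> > 0"
        obtain a where a: "inverse (real (Suc a)) < S 1 \<omega>" using reals_Archimedean[OF pos] by blast
        obtain b where b: "S 1 \<omega> \<le> real b" using real_arch_simple by blast
        have "1 / real (Suc (max a b)) \<le> inverse (real (Suc a))"
          by (simp add: inverse_eq_divide frac_le)
        then have "\<omega> \<in> ?E (max a b)" using a b elim(2) by auto
        then show False using elim(1) by blast
      qed
    qed
    then have "prob {\<omega>\<in>space M. S 1 \<omega> > 0} = 0" by (subst prob_eq_0) auto
    then show False using prob_S_pos by simp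
  qed
  then show ?thesis using that[of "Suc _"] by blast
qed

lemma tilt_along_line: "tilt (c - k * w) (k\<^sup>2 / 2) s = exp (c * s + (k\<^sup>2 / 2 * (s ^ 3 / 3) - k * w * s))"
  by (simp add: tilt_def algebra_simps)

text \<open>Restrict to waiting times in \<open>[1/a, A]\<close> and use \<open>1 + x \<le> exp x\<close>: the resulting lower bound is quadratic in \<open>k\<close>
and does not depend on the truncation level \<open>A'\<close>.\<close>

lemma truncated_tilt_coercive:
  assumes A: "A \<ge> 1 / a" "A \<le> A'" and a: "a > 0"
    and q: "q = prob {\<omega>\<in>space M. 1 / a \<le> S 1 \<omega> \<and> S 1 \<omega> \<le> A}"
  shows "q * (1 - \<bar>c\<bar> * A - \<bar>w\<bar> * A * \<bar>k\<bar> + (1 / a) ^ 3 / 6 * k\<^sup>2) \<le>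
    expectation (\<lambda>\<omega>. truncated_tilt (c - k * w) (k\<^sup>2 / 2) A' (S 1 \<omega>))"
proof -
  have [measurable]: "S 1 \<in> borel_measurable M" by (rule S_measurable) simp
  define L where "L = 1 - \<bar>c\<bar> * A - \<bar>w\<bar> * A * \<bar>k\<bar> + (1 / a) ^ 3 / 6 * k\<^sup>2"
  let ?E = "{\<omega>\<in>space M. 1 / a \<le> S 1 \<omega> \<and> S 1 \<omega> \<le> A}"
  have "q * L = expectation (\<lambda>\<omega>. L * indicator ?E \<omega>)"
    by (simp add: q)
  also have "\<dots> \<le> expectation (\<lambda>\<omega>. truncated_tilt (c - k * w) (k\<^sup>2 / 2) A' (S 1 \<omega>))"
  proof (rule integral_mono[OF _ integrable_truncated_tilt])
    fix \<omega> assume w: "\<omega> \<in> space M"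
    show "L * indicator ?E \<omega> \<le> truncated_tilt (c - k * w) (k\<^sup>2 / 2) A' (S 1 \<omega>)"
    proof (cases "\<omega> \<in> ?E")
      case True
      define s where "s = S 1 \<omega>"
      have s: "1 / a \<le> s" "s \<le> A" "0 \<le> s" using True a by (auto simp: s_def intro: order_trans[of 0 "1 / a"])
      have "\<bar>c * s\<bar> \<le> \<bar>c\<bar> * A" unfolding abs_mult using s by (intro mult_left_mono) auto
      moreover have "\<bar>k * w * s\<bar> \<le> \<bar>w\<bar> * A * \<bar>k\<bar>"
      proof -
        have "\<bar>k * w * s\<bar> = \<bar>k\<bar> * \<bar>w\<bar> * s" using s by (simp add: abs_mult)
        also have "\<dots> \<le> \<bar>k\<bar> * \<bar>w\<bar> * A" using s by (intro mult_left_mono) auto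
        finally show ?thesis by (simp add: algebra_simps)
      qed
      moreover have "(1 / a) ^ 3 / 6 * k\<^sup>2 \<le> k\<^sup>2 / 2 * (s ^ 3 / 3)"
      proof -
        have "(1 / a) ^ 3 \<le> s ^ 3" using s a by (intro power_mono) auto
        then have "k\<^sup>2 * (1 / a) ^ 3 \<le> k\<^sup>2 * s ^ 3" by (rule mult_left_mono) simp
        then show ?thesis by (simp add: algebra_simps)
      qed
      ultimately have "L \<le> 1 + (c * s + (k\<^sup>2 / 2 * (s ^ 3 / 3) - k * w * s))"
        unfolding L_def by linarith
      also have "\<dots> \<le> tilt (c - k * w) (k\<^sup>2 / 2) s"
        unfolding tilt_along_line by (rule exp_ge_add_one_self)
      finally show ?thesis using True s A(2) by (simp add: truncated_tilt_def s_def)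
    qed simp
  next
    have "?E \<in> sets M" by measurable
    then show "integrable M (\<lambda>\<omega>. L * indicat_real ?E \<omega>)"
      by (intro integrable_mult_right integrable_real_indicator) (auto simp: emeasure_eq_measure)
  qed
  finally show ?thesis by (simp add: L_def)
qed

text \<open>The exponent is a convex function of \<open>k\<close> for every \<open>s \<ge> 0\<close>. Convexity serves here to get continuity in \<open>k\<close>.\<close>

lemma convex_truncated_tilt_along_line:
  "convex_on UNIV (\<lambda>k. expectation (\<lambda>\<omega>. truncated_tilt (c - k * w) (k\<^sup>2 / 2) A (S 1 \<omega>)))"
proof (rule convex_onI)
  fix u x y :: real assume u: "0 < u" "u < 1"
  have pw: "truncated_tilt (c - ((1 - u) * x + u * y) * w) (((1 - u) * x + u * y)\<^sup>2 / 2) A s \<le>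
      (1 - u) * truncated_tilt (c - x * w) (x\<^sup>2 / 2) A s + u * truncated_tilt (c - y * w) (y\<^sup>2 / 2) A s" for s
  proof (cases "s \<in> {0..A}")
    case True
    define r where "r = s ^ 3 / 6"
    have r: "r \<ge> 0" using True by (simp add: r_def)
    let ?h = "\<lambda>k. c * s + (k\<^sup>2 * r - k * w * s)"
    have h: "tilt (c - k * w) (k\<^sup>2 / 2) s = exp (?h k)" for k
      unfolding tilt_along_line r_def by simp
    have "0 \<le> u * (1 - u) * (x - y)\<^sup>2 * r" using u r by simp
    also have "\<dots> = (1 - u) * ?h x + u * ?h y - ?h ((1 - u) * x + u * y)"
      by (simp add: power2_eq_square algebra_simps)
    finally have "?h ((1 - u) * x + u * y) \<le> (1 - u) * ?h x + u * ?h y" by simp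
    then have "exp (?h ((1 - u) * x + u * y)) \<le> exp ((1 - u) * ?h x + u * ?h y)" by simp
    also have "\<dots> \<le> (1 - u) * exp (?h x) + u * exp (?h y)"
      using convex_onD[OF exp_convex, of u "?h x" "?h y"] u by simp
    finally show ?thesis using True by (simp add: truncated_tilt_def h)
  qed (simp add: truncated_tilt_def)
  have "expectation (\<lambda>\<omega>. truncated_tilt (c - ((1 - u) * x + u * y) * w) (((1 - u) * x + u * y)\<^sup>2 / 2) A (S 1 \<omega>))
      \<le> expectation (\<lambda>\<omega>. (1 - u) * truncated_tilt (c - x * w) (x\<^sup>2 / 2) A (S 1 \<omega>) + u * truncated_tilt (c - y * w) (y\<^sup>2 / 2) A (S 1 \<omega>))"
    by (rule integral_mono[OF integrable_truncated_tilt _ pw]) 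
      (intro Bochner_Integration.integrable_add integrable_mult_right integrable_truncated_tilt)
  also have "\<dots> = (1 - u) * expectation (\<lambda>\<omega>. truncated_tilt (c - x * w) (x\<^sup>2 / 2) A (S 1 \<omega>)) +
      u * expectation (\<lambda>\<omega>. truncated_tilt (c - y * w) (y\<^sup>2 / 2) A (S 1 \<omega>))"
    using integrable_truncated_tilt by simp
  finally show "expectation (\<lambda>\<omega>. truncated_tilt (c - ((1 - u) *\<^sub>R x + u *\<^sub>R y) * w) (((1 - u) *\<^sub>R x + u *\<^sub>R y)\<^sup>2 / 2) A (S 1 \<omega>))
      \<le> (1 - u) * expectation (\<lambda>\<omega>. truncated_tilt (c - x * w) (x\<^sup>2 / 2) A (S 1 \<omega>)) +
      u * expectation (\<lambda>\<omega>. truncated_tilt (c - y * w) (y\<^sup>2 / 2) A (S 1 \<omega>))"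
    by simp
qed simp

lemma quadratic_eventually_gt:
  fixes a b d e :: real assumes "d > 0"
  obtains K where "K \<ge> 0" "\<And>k. \<bar>k\<bar> \<ge> K \<Longrightarrow> e < a - b * \<bar>k\<bar> + d * k\<^sup>2"
proof -
  have "filterlim (\<lambda>x. a - b * x + d * x\<^sup>2) at_top at_top" using assms by real_asymp
  then have "\<forall>\<^sub>F x in at_top. e < a - b * x + d * x\<^sup>2" by (simp add: filterlim_at_top_dense)
  then obtain K where K: "\<And>x. x \<ge> K \<Longrightarrow> e < a - b * x + d * x\<^sup>2"
    by (auto simp: eventually_at_top_linorder)
  show ?thesis
  proof (rule that[of "max K 0"])
    fix k :: real assume "\<bar>k\<bar> \<ge> max K 0"
    then show "e < a - b * \<bar>k\<bar> + d * k\<^sup>2" using K[of "\<bar>k\<bar>"] by simp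
  qed simp
qed

text \<open>The truncated means increase with the truncation level, exceed 1 eventually for every \<open>k\<close>, and do so uniformly for
large \<open>\<bar>k\<bar>\<close> by coercivity; compactness handles the remaining \<open>k\<close>. Outside \<open>[-K, K]\<close> the truncated mean
exceeds its value at \<open>k = 0\<close>, which confines its minimisers.\<close>

lemma uniform_truncation:
  assumes gt: "\<And>k. (\<integral>\<^sup>+\<omega>. ennreal (tilt (c - k * w) (k\<^sup>2 / 2) (S 1 \<omega>)) \<partial>M) > 1"
  obtains A K where "\<And>k. expectation (\<lambda>\<omega>. truncated_tilt (c - k * w) (k\<^sup>2 / 2) A (S 1 \<omega>)) > 1"
    "\<And>k. \<bar>k\<bar> \<ge> K \<Longrightarrow> expectation (\<lambda>\<omega>. truncated_tilt (c - 0 * w) (0\<^sup>2 / 2) A (S 1 \<omega>)) <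
        expectation (\<lambda>\<omega>. truncated_tilt (c - k * w) (k\<^sup>2 / 2) A (S 1 \<omega>))"
    "K \<ge> 0" "prob {\<omega>\<in>space M. 0 < S 1 \<omega> \<and> S 1 \<omega> \<le> A} > 0"
proof -
  have [measurable]: "S 1 \<in> borel_measurable M" by (rule S_measurable) simp
  define N where "N A k = expectation (\<lambda>\<omega>. truncated_tilt (c - k * w) (k\<^sup>2 / 2) A (S 1 \<omega>))" for A k
  have cont: "continuous_on UNIV (N A)" for A
    unfolding N_def[abs_def] by (intro convex_on_continuous convex_truncated_tilt_along_line) simp
  obtain n0 :: nat where n0: "n0 > 0" "prob {\<omega>\<in>space M. 1 / real n0 \<le> S 1 \<omega> \<and> S 1 \<omega> \<le> real n0} > 0"
    by (rule exists_positive_mass_interval)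
  define q where "q = prob {\<omega>\<in>space M. 1 / real n0 \<le> S 1 \<omega> \<and> S 1 \<omega> \<le> real n0}"
  have q: "q > 0" using n0 by (simp add: q_def)
  have n0': "1 / real n0 \<le> real n0"
  proof -
    have "1 / real n0 \<le> 1" "1 \<le> real n0" using n0(1) by auto
    then show ?thesis by linarith
  qed
  have lower: "q * (1 - \<bar>c\<bar> * n0 - \<bar>w\<bar> * n0 * \<bar>k\<bar> + (1 / n0) ^ 3 / 6 * k\<^sup>2) \<le> N A k" if "A \<ge> real n0" for A k
    unfolding N_def by (rule truncated_tilt_coercive[OF n0' that]) (use n0 in \<open>auto simp: q_def\<close>)
  have big: "\<exists>K\<ge>0. \<forall>k A. \<bar>k\<bar> \<ge> K \<longrightarrow> A \<ge> real n0 \<longrightarrow> e < N A k" for e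
  proof -
    obtain K where K: "K \<ge> 0" "\<And>k. \<bar>k\<bar> \<ge> K \<Longrightarrow> e / q < (1 - \<bar>c\<bar> * n0) - \<bar>w\<bar> * n0 * \<bar>k\<bar> + (1 / n0) ^ 3 / 6 * k\<^sup>2"
      by (rule quadratic_eventually_gt[of "(1 / real n0) ^ 3 / 6" "e / q" "1 - \<bar>c\<bar> * n0" "\<bar>w\<bar> * n0"]) (use n0 in auto)
    show ?thesis
    proof (intro exI[of _ K] conjI allI impI K(1))
      fix k A :: real assume "\<bar>k\<bar> \<ge> K" "A \<ge> real n0"
      then show "e < N A k" using K(2)[of k] lower[of A k] q by (simp add: pos_divide_less_eq mult.commute)
    qed
  qed
  obtain K1 where K1: "K1 \<ge> 0" "\<And>k A. \<bar>k\<bar> \<ge> K1 \<Longrightarrow> A \<ge> real n0 \<Longrightarrow> 1 < N A k" using big by metis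
  have "compact {-K1..K1}" by simp
  moreover have "open {k. 1 < N (real n) k}" for n :: nat
    using open_Collect_less[OF continuous_on_const cont[of "real n"]] by simp
  moreover have "{-K1..K1} \<subseteq> (\<Union>n\<in>{n0..}. {k. 1 < N (real n) k})"
  proof
    fix k
    have "\<forall>\<^sub>F n in sequentially. 1 < N (real n) k"
      unfolding N_def by (rule eventually_truncated_tilt_gt_1[OF gt])
    with eventually_ge_at_top[of n0] have "\<forall>\<^sub>F n in sequentially. n \<ge> n0 \<and> 1 < N (real n) k"
      by eventually_elim auto
    then obtain n where "n \<ge> n0 \<and> 1 < N (real n) k" using eventually_happens sequentially_bot by blast
    then show "k \<in> (\<Union>n\<in>{n0..}. {k. 1 < N (real n) k})" by auto
  qed
  ultimately obtain I where I: "I \<subseteq> {n0..}" "finite I" "{-K1..K1} \<subseteq> (\<Union>n\<in>I. {k. 1 < N (real n) k})"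
    by (rule compactE_image)
  define A where "A = real (Max (insert n0 I))"
  have A: "A \<ge> real n0" and AI: "\<And>n. n \<in> I \<Longrightarrow> real n \<le> A" using I(2) by (auto simp: A_def)
  have all: "1 < N A k" for k
  proof (cases "\<bar>k\<bar> \<ge> K1")
    case True
    then show ?thesis by (rule K1(2)[OF _ A])
  next
    case False
    then have "k \<in> {-K1..K1}" by auto
    then obtain n where n: "n \<in> I" "1 < N (real n) k" using I(3) by blast
    then show ?thesis using truncated_tilt_mono[OF AI[OF n(1)]] by (fastforce simp: N_def intro: less_le_trans)
  qed
  obtain K2 where K2: "K2 \<ge> 0" "\<And>k A'. \<bar>k\<bar> \<ge> K2 \<Longrightarrow> A' \<ge> real n0 \<Longrightarrow> N A 0 < N A' k" using big by metis
  have "0 < prob {\<omega>\<in>space M. 1 / real n0 \<le> S 1 \<omega> \<and> S 1 \<omega> \<le> real n0}" by (rule n0(2))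
  also have "\<dots> \<le> prob {\<omega>\<in>space M. 0 < S 1 \<omega> \<and> S 1 \<omega> \<le> A}"
  proof (rule finite_measure_mono)
    show "{\<omega>\<in>space M. 1 / real n0 \<le> S 1 \<omega> \<and> S 1 \<omega> \<le> real n0} \<subseteq> {\<omega>\<in>space M. 0 < S 1 \<omega> \<and> S 1 \<omega> \<le> A}"
      using A n0(1) by (auto intro: less_le_trans[of 0 "1 / real n0"])
  qed measurable
  finally show ?thesis using all K2(2)[OF _ A] K2(1) unfolding N_def by (intro that[of A K2]) auto
qed

lemma truncated_first_moment_pos:
  assumes "prob {\<omega>\<in>space M. 0 < S 1 \<omega> \<and> S 1 \<omega> \<le> A} > 0"
  shows "expectation (\<lambda>\<omega>. truncated_tilt \<zeta> \<theta> A (S 1 \<omega>) * S 1 \<omega>) > 0"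
    and "expectation (\<lambda>\<omega>. truncated_tilt \<zeta> \<theta> A (S 1 \<omega>) * (S 1 \<omega> ^ 3 / 3)) > 0"
proof -
  have [measurable]: "S 1 \<in> borel_measurable M" by (rule S_measurable) simp
  have *: "expectation (\<lambda>\<omega>. truncated_tilt \<zeta> \<theta> A (S 1 \<omega>) * f (S 1 \<omega>)) > 0"
    if int: "integrable M (\<lambda>\<omega>. truncated_tilt \<zeta> \<theta> A (S 1 \<omega>) * f (S 1 \<omega>))"
      and f: "\<And>s. s \<ge> 0 \<Longrightarrow> f s \<ge> 0" "\<And>s. s > 0 \<Longrightarrow> f s > 0" for f :: "real \<Rightarrow> real"
  proof -
    have nn: "AE \<omega> in M. 0 \<le> truncated_tilt \<zeta> \<theta> A (S 1 \<omega>) * f (S 1 \<omega>)"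
      using S_nonneg[of 1] f(1) by (intro AE_I2 mult_nonneg_nonneg) auto
    have "expectation (\<lambda>\<omega>. truncated_tilt \<zeta> \<theta> A (S 1 \<omega>) * f (S 1 \<omega>)) \<noteq> 0"
    proof
      assume "expectation (\<lambda>\<omega>. truncated_tilt \<zeta> \<theta> A (S 1 \<omega>) * f (S 1 \<omega>)) = 0"
      then have "AE \<omega> in M. truncated_tilt \<zeta> \<theta> A (S 1 \<omega>) * f (S 1 \<omega>) = 0"
        using integral_nonneg_eq_0_iff_AE[OF int nn] by simp
      then have "AE \<omega> in M. \<not> (0 < S 1 \<omega> \<and> S 1 \<omega> \<le> A)"
      proof eventually_elim
        case (elim \<omega>)
        then show ?case using f(2)[of "S 1 \<omega>"] tilt_pos[of \<zeta> \<theta> "S 1 \<omega>"]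
          by (auto simp: truncated_tilt_def simp del: tilt_pos)
      qed
      then have "prob {\<omega>\<in>space M. 0 < S 1 \<omega> \<and> S 1 \<omega> \<le> A} = 0" by (subst prob_eq_0) auto
      then show False using assms by simp
    qed
    with integral_nonneg_AE[OF nn] show ?thesis by simp
  qed
  show "expectation (\<lambda>\<omega>. truncated_tilt \<zeta> \<theta> A (S 1 \<omega>) * S 1 \<omega>) > 0"
    by (rule *[OF integrable_truncated_tilt_S]) auto
  show "expectation (\<lambda>\<omega>. truncated_tilt \<zeta> \<theta> A (S 1 \<omega>) * (S 1 \<omega> ^ 3 / 3)) > 0"
    by (rule *[OF integrable_truncated_tilt_S3]) auto
qed

text \<open>The derivative of the truncated mean in \<open>k\<close> vanishes at a minimiser. Instead of differentiating under the integral,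
bound the increment by \<open>h d + h\<^sup>2 R\<close>, where \<open>d\<close> is the candidate derivative; a nonzero \<open>d\<close> would make this
negative for a small \<open>h\<close> of the opposite sign.\<close>

lemma stationary_at_minimum:
  assumes min: "\<And>k'. expectation (\<lambda>\<omega>. truncated_tilt (c - k * w) (k\<^sup>2 / 2) A (S 1 \<omega>)) \<le>
      expectation (\<lambda>\<omega>. truncated_tilt (c - k' * w) (k'\<^sup>2 / 2) A (S 1 \<omega>))"
  shows "w * expectation (\<lambda>\<omega>. truncated_tilt (c - k * w) (k\<^sup>2 / 2) A (S 1 \<omega>) * S 1 \<omega>) =
    k * expectation (\<lambda>\<omega>. truncated_tilt (c - k * w) (k\<^sup>2 / 2) A (S 1 \<omega>) * (S 1 \<omega> ^ 3 / 3))"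
proof -
  define D where "D = truncated_tilt (c - k * w) (k\<^sup>2 / 2) A"
  define f where "f s = k * (s ^ 3 / 3) - w * s" for s :: real
  define C where "C = \<bar>k\<bar> * (\<bar>A\<bar> ^ 3 / 3) + \<bar>w\<bar> * \<bar>A\<bar> + \<bar>A\<bar> ^ 3 / 6 + 1"
  have C1: "C \<ge> 1" by (simp add: C_def)
  have fm[measurable]: "f \<in> borel_measurable borel" unfolding f_def[abs_def] by measurable
  have fC: "\<bar>f s\<bar> + s ^ 3 / 6 \<le> C" if s: "0 \<le> s" "s \<le> A" for s
  proof -
    have "s ^ 3 \<le> \<bar>A\<bar> ^ 3" using s by (intro power_mono) auto
    then have 1: "\<bar>k\<bar> * (s ^ 3 / 3) \<le> \<bar>k\<bar> * (\<bar>A\<bar> ^ 3 / 3)" and 2: "s ^ 3 / 6 \<le> \<bar>A\<bar> ^ 3 / 6"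
      by (auto intro!: mult_left_mono)
    have 3: "\<bar>w\<bar> * s \<le> \<bar>w\<bar> * \<bar>A\<bar>" using s by (intro mult_left_mono) auto
    have "\<bar>f s\<bar> \<le> \<bar>k * (s ^ 3 / 3)\<bar> + \<bar>w * s\<bar>" unfolding f_def by (rule abs_triangle_ineq4)
    also have "\<dots> = \<bar>k\<bar> * (s ^ 3 / 3) + \<bar>w\<bar> * s" using s by (simp add: abs_mult)
    finally show ?thesis using 1 2 3 unfolding C_def by linarith
  qed
  have int0: "integrable M (\<lambda>\<omega>. D (S 1 \<omega>))"
    unfolding D_def by (rule integrable_truncated_tilt)
  have intf: "integrable M (\<lambda>\<omega>. D (S 1 \<omega>) * f (S 1 \<omega>))"
    unfolding D_def
  proof (rule integrable_bounded_times_truncated_tilt[OF fm])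
    fix s :: real assume "0 \<le> s" "s \<le> A"
    then show "\<bar>f s\<bar> \<le> C" using fC[of s] by simp (metis add.commute add_increasing zero_le_power divide_nonneg_pos zero_less_numeral le_add_same_cancel1 order_trans)
  qed
  define m where "m = expectation (\<lambda>\<omega>. D (S 1 \<omega>))"
  define d where "d = expectation (\<lambda>\<omega>. D (S 1 \<omega>) * f (S 1 \<omega>))"
  define R where "R = (C + C\<^sup>2) * m"
  have m0: "m \<ge> 0" unfolding m_def D_def by (rule integral_nonneg_AE) auto
  have expand: "0 \<le> h * d + h\<^sup>2 * R" if h: "\<bar>h\<bar> \<le> 1 / C" for h
  proof -
    have hC: "\<bar>h\<bar> * C \<le> 1" using h C1 by (simp add: field_simps)
    have h1: "\<bar>h\<bar> \<le> 1" using hC C1 mult_left_mono[of 1 C "\<bar>h\<bar>"] by simp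
    have pw: "truncated_tilt (c - (k + h) * w) ((k + h)\<^sup>2 / 2) A s \<le>
        (1 + h\<^sup>2 * (C + C\<^sup>2)) * D s + h * (D s * f s)" for s
    proof (cases "s \<in> {0..A}")
      case True
      then have s: "0 \<le> s" "s \<le> A" by auto
      define x where "x = h * f s + h\<^sup>2 * (s ^ 3 / 6)"
      have s3: "0 \<le> s ^ 3 / 6" using s by simp
      have "\<bar>x\<bar> \<le> \<bar>h\<bar> * \<bar>f s\<bar> + h\<^sup>2 * (s ^ 3 / 6)"
        unfolding x_def using s3 abs_triangle_ineq[of "h * f s" "h\<^sup>2 * (s ^ 3 / 6)"] by (simp add: abs_mult)
      also have "h\<^sup>2 * (s ^ 3 / 6) \<le> \<bar>h\<bar> * (s ^ 3 / 6)"
      proof (rule mult_right_mono[OF _ s3])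
        show "h\<^sup>2 \<le> \<bar>h\<bar>" using mult_left_mono[OF h1, of "\<bar>h\<bar>"] by (simp add: power2_eq_square)
      qed
      finally have "\<bar>x\<bar> \<le> \<bar>h\<bar> * (\<bar>f s\<bar> + s ^ 3 / 6)" by (simp add: algebra_simps)
      also have "\<dots> \<le> \<bar>h\<bar> * C" by (rule mult_left_mono[OF fC[OF s]]) simp
      finally have xC: "\<bar>x\<bar> \<le> \<bar>h\<bar> * C" .
      then have "exp x \<le> 1 + x + x\<^sup>2" using hC by (intro exp_le_quadratic) simp
      also have "x\<^sup>2 \<le> (\<bar>h\<bar> * C)\<^sup>2" using xC C1 by (subst abs_le_square_iff[symmetric]) (simp add: abs_mult)
      also have "(\<bar>h\<bar> * C)\<^sup>2 = h\<^sup>2 * C\<^sup>2" by (simp add: power_mult_distrib)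
      also have "x \<le> h * f s + h\<^sup>2 * C"
        unfolding x_def using fC[OF s] by (intro add_left_mono mult_left_mono) auto
      finally have "exp x \<le> 1 + h\<^sup>2 * (C + C\<^sup>2) + h * f s" by (simp add: algebra_simps)
      then have "tilt (c - k * w) (k\<^sup>2 / 2) s * exp x \<le> tilt (c - k * w) (k\<^sup>2 / 2) s * (1 + h\<^sup>2 * (C + C\<^sup>2) + h * f s)"
        by (rule mult_left_mono) (simp add: less_imp_le)
      moreover have "tilt (c - k * w) (k\<^sup>2 / 2) s * exp x = tilt (c - (k + h) * w) ((k + h)\<^sup>2 / 2) s"
        unfolding tilt_along_line exp_add[symmetric] x_def f_def
        by (simp add: power2_eq_square algebra_simps add_divide_distrib)
      ultimately show ?thesis using True by (simp add: truncated_tilt_def D_def algebra_simps)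
    qed (simp add: truncated_tilt_def D_def)
    have "m \<le> expectation (\<lambda>\<omega>. truncated_tilt (c - (k + h) * w) ((k + h)\<^sup>2 / 2) A (S 1 \<omega>))"
      unfolding m_def D_def by (rule min)
    also have "\<dots> \<le> expectation (\<lambda>\<omega>. (1 + h\<^sup>2 * (C + C\<^sup>2)) * D (S 1 \<omega>) + h * (D (S 1 \<omega>) * f (S 1 \<omega>)))"
      by (rule integral_mono[OF integrable_truncated_tilt _ pw])
        (intro Bochner_Integration.integrable_add integrable_mult_right int0 intf)
    also have "\<dots> = (1 + h\<^sup>2 * (C + C\<^sup>2)) * m + h * d"
      using int0 intf by (simp add: m_def d_def)
    finally show ?thesis by (simp add: R_def algebra_simps)
  qed
  have "d = 0"
  proof (rule ccontr)
    assume d: "d \<noteq> 0"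
    have R0: "R \<ge> 0" using m0 C1 by (simp add: R_def)
    define h where "h = min (1 / C) (\<bar>d\<bar> / (2 * (R + 1)))"
    have h: "h > 0" using C1 d R0 by (simp add: h_def)
    have "h * (2 * (R + 1)) \<le> \<bar>d\<bar>" 
      using R0 by (subst pos_le_divide_eq[symmetric]) (auto simp: h_def)
    then have hR: "h * R < \<bar>d\<bar>" using h R0 mult_nonneg_nonneg[of h R] by (simp add: algebra_simps) 
    have "0 \<le> (- sgn d * h) * d + (- sgn d * h)\<^sup>2 * R"
      by (rule expand) (use h d in \<open>auto simp: abs_mult abs_sgn_eq h_def\<close>)
    also have "(- sgn d * h)\<^sup>2 = h\<^sup>2" using d by (simp add: power_mult_distrib sgn_if)
    also have "(- sgn d * h) * d = - (h * \<bar>d\<bar>)" by (simp add: abs_sgn algebra_simps)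
    finally have "h * \<bar>d\<bar> \<le> h * (h * R)" by (simp add: power2_eq_square algebra_simps)
    then have "\<bar>d\<bar> \<le> h * R" using h by simp
    then show False using hR by simp
  qed
  moreover have "d = k * expectation (\<lambda>\<omega>. D (S 1 \<omega>) * (S 1 \<omega> ^ 3 / 3)) - w * expectation (\<lambda>\<omega>. D (S 1 \<omega>) * S 1 \<omega>)"
  proof -
    have "D s * f s = k * (D s * (s ^ 3 / 3)) - w * (D s * s)" for s
      by (simp add: f_def algebra_simps)
    then have "d = expectation (\<lambda>\<omega>. k * (D (S 1 \<omega>) * (S 1 \<omega> ^ 3 / 3)) - w * (D (S 1 \<omega>) * S 1 \<omega>))"
      unfolding d_def by (simp only:)
    also have "\<dots> = expectation (\<lambda>\<omega>. k * (D (S 1 \<omega>) * (S 1 \<omega> ^ 3 / 3))) - expectation (\<lambda>\<omega>. w * (D (S 1 \<omega>) * S 1 \<omega>))"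
      unfolding D_def
      by (intro Bochner_Integration.integral_diff integrable_mult_right integrable_truncated_tilt_S integrable_truncated_tilt_S3)
    finally show ?thesis by (simp only: integral_mult_right_zero)
  qed
  ultimately show ?thesis by (simp add: D_def)
qed

text \<open>The last conclusion says that the Gaussian slope \<open>w/v\<close> for the variance rate \<open>v = m\<^sub>2/m\<^sub>1\<close> equals \<open>k\<close>: the same
\<open>k\<close> is optimal for the waiting times and for the Gaussian fluctuation.\<close>

lemma exists_optimal_tilt:
  assumes gt: "\<And>k. (\<integral>\<^sup>+\<omega>. ennreal (tilt (c - k * w) (k\<^sup>2 / 2) (S 1 \<omega>)) \<partial>M) > 1"
  obtains k A where
    "expectation (\<lambda>\<omega>. truncated_tilt (c - k * w) (k\<^sup>2 / 2) A (S 1 \<omega>)) \<ge> 1"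
    "expectation (\<lambda>\<omega>. truncated_tilt (c - k * w) (k\<^sup>2 / 2) A (S 1 \<omega>) * S 1 \<omega>) > 0"
    "expectation (\<lambda>\<omega>. truncated_tilt (c - k * w) (k\<^sup>2 / 2) A (S 1 \<omega>) * (S 1 \<omega> ^ 3 / 3)) > 0"
    "w * expectation (\<lambda>\<omega>. truncated_tilt (c - k * w) (k\<^sup>2 / 2) A (S 1 \<omega>) * S 1 \<omega>) =
      k * expectation (\<lambda>\<omega>. truncated_tilt (c - k * w) (k\<^sup>2 / 2) A (S 1 \<omega>) * (S 1 \<omega> ^ 3 / 3))"
proof -
  obtain A K where AK: "\<And>k. expectation (\<lambda>\<omega>. truncated_tilt (c - k * w) (k\<^sup>2 / 2) A (S 1 \<omega>)) > 1"
    "\<And>k. \<bar>k\<bar> \<ge> K \<Longrightarrow> expectation (\<lambda>\<omega>. truncated_tilt (c - 0 * w) (0\<^sup>2 / 2) A (S 1 \<omega>)) <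
        expectation (\<lambda>\<omega>. truncated_tilt (c - k * w) (k\<^sup>2 / 2) A (S 1 \<omega>))"
    "K \<ge> 0" "prob {\<omega>\<in>space M. 0 < S 1 \<omega> \<and> S 1 \<omega> \<le> A} > 0"
    by (rule uniform_truncation[of c w]) (use gt in auto)
  define N where "N k = expectation (\<lambda>\<omega>. truncated_tilt (c - k * w) (k\<^sup>2 / 2) A (S 1 \<omega>))" for k
  have "continuous_on UNIV N"
    unfolding N_def[abs_def] by (intro convex_on_continuous convex_truncated_tilt_along_line) simp
  then have "continuous_on {-K..K} N" by (rule continuous_on_subset) simp
  then obtain k where k: "k \<in> {-K..K}" "\<And>k'. k' \<in> {-K..K} \<Longrightarrow> N k \<le> N k'"
    using continuous_attains_inf[of "{-K..K}" N] AK(3) by auto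
  have "N k \<le> N k'" for k'
  proof (cases "k' \<in> {-K..K}")
    case False
    then have "N 0 < N k'" using AK(2)[of k'] unfolding N_def by auto
    moreover have "N k \<le> N 0" using AK(3) by (intro k(2)) auto
    ultimately show ?thesis by simp
  qed (rule k(2))
  then show ?thesis
    using that[of k A] AK(1)[of k] truncated_first_moment_pos[OF AK(4)] stationary_at_minimum[of c k w A]
    unfolding N_def by (simp add: less_imp_le)
qed

end

section \<open>The large deviation principle\<close>

context resetting
begin

lemma reset_area_measurable: "reset_area S B t \<in> borel_measurable M"
  by (rule measurable_reset_area) (auto intro: S_measurable S_nonneg B_measurable B_continuous)

lemma gt_phi_imp_tilt_gt_1:
  assumes "phi M S B k < ereal \<zeta>"
  shows "(\<integral>\<^sup>+\<omega>. ennreal (tilt \<zeta> (k\<^sup>2 / 2) (S 1 \<omega>)) \<partial>M) > 1"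
proof (rule ccontr)
  assume "\<not> ?thesis"
  then have "ereal \<zeta> \<le> phi M S B k"
    unfolding phi_eq by (intro Sup_upper) auto
  with assms show False by simp
qed

lemma less_phi_imp_mgf_upper_bound:
  assumes "ereal \<zeta> < phi M S B k"
  obtains C where "C > 0"
    "\<And>t. t \<ge> 0 \<Longrightarrow> (\<integral>\<^sup>+\<omega>. ennreal (exp (k * reset_area S B t \<omega>)) \<partial>M) \<le> ennreal (C * exp (- \<zeta> * t))"
proof -
  from assms obtain \<zeta>' where "(\<integral>\<^sup>+ \<omega>. ennreal (tilt \<zeta>' (k\<^sup>2 / 2) (S 1 \<omega>)) \<partial>M) \<le> 1" "\<zeta> < \<zeta>'"
    unfolding phi_eq less_Sup_iff by auto
  then show ?thesis using mgf_upper_bound that by metis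
qed

lemma AE_block_event_cond_var:
  assumes "t \<ge> 0"
  shows "AE \<omega> in M. \<omega> \<in> block_event n t x \<longrightarrow> x * t \<le> cond_var t \<omega> \<and> cond_var t \<omega> \<le> t ^ 3 / 3"
  using AE_current_renewal[OF assms]
proof eventually_elim
  case (elim \<omega>)
  then obtain m where m: "\<omega> \<in> space M" "renewal_time S m \<omega> \<le> t" "t < renewal_time S (Suc m) \<omega>" by blast
  show ?case
    using cond_var_ge[OF m, of n] cond_var_le[OF m] by (auto simp: block_event_def)
qed

text \<open>For the lower bound, the variance \<open>(v - e) t\<close> of a typical block contributes \<open>exp (\<theta> v t)\<close> and has probability about
\<open>exp (-(\<zeta> + \<theta> v) t)\<close>, so that \<open>\<theta> v\<close> cancels.\<close>

lemma mgf_limit: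
  "((\<lambda>t. eln (\<integral>\<^sup>+\<omega>. ennreal (exp (k * reset_area S B t \<omega>)) \<partial>M) / ereal t) \<longlongrightarrow> - phi M S B k) at_top"
proof -
  let ?g = "\<lambda>t. eln (\<integral>\<^sup>+\<omega>. ennreal (exp (k * reset_area S B t \<omega>)) \<partial>M) / ereal t"
  have up: "Limsup at_top ?g \<le> - phi M S B k"
  proof (rule ccontr)
    assume "\<not> ?thesis"
    then have "- Limsup at_top ?g < phi M S B k" by (simp add: ereal_uminus_less_reorder not_le)
    then obtain \<zeta> where z: "- Limsup at_top ?g < ereal \<zeta>" "ereal \<zeta> < phi M S B k"
      using ereal_dense2 by blast
    obtain C where C: "C > 0"
      "\<And>t. t \<ge> 0 \<Longrightarrow> (\<integral>\<^sup>+\<omega>. ennreal (exp (k * reset_area S B t \<omega>)) \<partial>M) \<le> ennreal (C * exp (- \<zeta> * t))"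
      using less_phi_imp_mgf_upper_bound[OF z(2)] by blast
    have "Limsup at_top ?g \<le> ereal (- \<zeta>)"
      by (rule Limsup_eln_le[OF eventually_mono[OF eventually_ge_at_top[of 0]] C(1)]) (rule C(2))
    with z(1) show False by (cases "Limsup at_top ?g") auto
  qed
  have low: "- phi M S B k \<le> Liminf at_top ?g"
  proof (rule ccontr)
    assume "\<not> ?thesis"
    then have "phi M S B k < - Liminf at_top ?g" by (simp add: ereal_less_uminus_reorder not_le)
    then obtain \<zeta> where z: "phi M S B k < ereal \<zeta>" "ereal \<zeta> < - Liminf at_top ?g"
      using ereal_dense2 by blast
    obtain \<zeta>' where z': "ereal \<zeta> < ereal \<zeta>'" "ereal \<zeta>' < - Liminf at_top ?g"
      using ereal_dense2[OF z(2)] by blast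
    define \<theta> where "\<theta> = k\<^sup>2 / 2"
    have th: "\<theta> \<ge> 0" by (simp add: \<theta>_def)
    \<comment> \<open>Chosen such that the losses \<open>\<theta> e\<close> in the variance and \<open>e\<close> in the probability add up to \<open>\<zeta>' - \<zeta>\<close>.\<close>
    define e where "e = (\<zeta>' - \<zeta>) / (\<theta> + 1)"
    have e: "e > 0" using z' th by (simp add: e_def)
    have "(\<theta> + 1) * e = \<zeta>' - \<zeta>" using th by (simp add: e_def)
    then have ee: "\<zeta>' = \<zeta> + \<theta> * e + e" by (simp add: algebra_simps)
    obtain n0 :: nat where n0: "n0 > 0" "prob {\<omega>\<in>space M. 1 / real n0 \<le> S 1 \<omega> \<and> S 1 \<omega> \<le> real n0} > 0"
      by (rule exists_positive_mass_interval)
    from eventually_conj[OF eventually_truncated_tilt_gt_1[OF gt_phi_imp_tilt_gt_1[OF z(1)]] eventually_ge_at_top[of n0]]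
    obtain n where n: "expectation (\<lambda>\<omega>. truncated_tilt \<zeta> \<theta> (real n) (S 1 \<omega>)) > 1" "n \<ge> n0"
      unfolding \<theta>_def using eventually_happens sequentially_bot by blast
    have [measurable]: "S 1 \<in> borel_measurable M" by (rule S_measurable) simp
    have "prob {\<omega>\<in>space M. 0 < S 1 \<omega> \<and> S 1 \<omega> \<le> real n} > 0"
    proof (rule less_le_trans[OF n0(2)], rule finite_measure_mono)
      have "0 < 1 / real n0" using n0(1) by simp
      then show "{\<omega>\<in>space M. 1 / real n0 \<le> S 1 \<omega> \<and> S 1 \<omega> \<le> real n0} \<subseteq> {\<omega>\<in>space M. 0 < S 1 \<omega> \<and> S 1 \<omega> \<le> real n}"
        using n(2) by (auto intro: less_le_trans[of 0 "1 / real n0"] order_trans)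
    qed measurable
    note m1 = truncated_first_moment_pos(1)[OF this, of \<zeta> \<theta>]
    define v where "v = expectation (\<lambda>\<omega>. truncated_tilt \<zeta> \<theta> (real n) (S 1 \<omega>) * (S 1 \<omega> ^ 3 / 3)) /
       expectation (\<lambda>\<omega>. truncated_tilt \<zeta> \<theta> (real n) (S 1 \<omega>) * S 1 \<omega>)"
    have "\<forall>\<^sub>F t in at_top. \<exists>m. exp (- (\<zeta> + \<theta> * v + e) * t) \<le> prob (block_event m t (v - e))"
      by (rule block_event_lower_bound[of \<zeta> \<theta> "real n"]) (use n(1) m1 e in \<open>auto simp: v_def\<close>)
    then have "\<forall>\<^sub>F t in at_top. ennreal (exp (- \<zeta>' * t)) \<le> (\<integral>\<^sup>+\<omega>. ennreal (exp (k * reset_area S B t \<omega>)) \<partial>M)"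
      using eventually_gt_at_top[of 0]
    proof eventually_elim
      case (elim t)
      then obtain m where m: "exp (- (\<zeta> + \<theta> * v + e) * t) \<le> prob (block_event m t (v - e))" by blast
      have t: "t \<ge> 0" using elim by simp
      have "- \<zeta>' * t = \<theta> * ((v - e) * t) + - (\<zeta> + \<theta> * v + e) * t"
        unfolding ee by (simp add: algebra_simps)
      then have "exp (- \<zeta>' * t) = exp (\<theta> * ((v - e) * t)) * exp (- (\<zeta> + \<theta> * v + e) * t)"
        by (simp only: exp_add)
      also have "\<dots> \<le> exp (\<theta> * ((v - e) * t)) * prob (block_event m t (v - e))"
        by (rule mult_left_mono[OF m]) simp
      finally have "ennreal (exp (- \<zeta>' * t)) \<le> ennreal (exp (\<theta> * ((v - e) * t))) * emeasure M (block_event m t (v - e))"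
        by (simp add: emeasure_eq_measure ennreal_mult'[symmetric] ennreal_leI)
      also have "\<dots> = (\<integral>\<^sup>+\<omega>. ennreal (exp (\<theta> * ((v - e) * t))) * indicator (block_event m t (v - e)) \<omega> \<partial>M)"
        by (rule nn_integral_cmult_indicator[symmetric]) simp
      also have "\<dots> \<le> (\<integral>\<^sup>+\<omega>. ennreal (exp (\<theta> * cond_var t \<omega>)) \<partial>M)"
      proof (rule nn_integral_mono_AE)
        show "AE \<omega> in M. ennreal (exp (\<theta> * ((v - e) * t))) * indicator (block_event m t (v - e)) \<omega> \<le> ennreal (exp (\<theta> * cond_var t \<omega>))"
          using AE_block_event_cond_var[OF t, of m "v - e"]
          by eventually_elim (auto simp: indicator_def intro!: ennreal_leI mult_left_mono th)
      qed
      also have "\<dots> = (\<integral>\<^sup>+\<omega>. ennreal (exp (k * reset_area S B t \<omega>)) \<partial>M)"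
        unfolding \<theta>_def by (rule nn_integral_exp_reset_area[OF t, symmetric])
      finally show ?case .
    qed
    then have "ereal (- \<zeta>') \<le> Liminf at_top ?g" by (rule Liminf_eln_ge)
    with z'(2) show False by (cases "Liminf at_top ?g") auto
  qed
  show ?thesis
    using Liminf_le_Limsup[of at_top ?g] up low
    by (intro Liminf_eq_Limsup) (auto intro: antisym order_trans)
qed

lemma lower_semicont_rate: "lower_semicont (rate M S B)"
  unfolding lower_semicont_def rate_def
proof (intro allI SUP_least)
  fix w k :: real
  have "((\<lambda>w. ereal (w * k) + phi M S B k) \<longlongrightarrow> ereal (w * k) + phi M S B k) (at w)"
    by (cases "phi M S B k") (auto intro!: tendsto_intros)
  then have "ereal (w * k) + phi M S B k = Liminf (at w) (\<lambda>w. ereal (w * k) + phi M S B k)"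
    by (rule lim_imp_Liminf[symmetric, rotated]) simp
  also have "\<dots> \<le> Liminf (at w) (\<lambda>w. SUP k. ereal (w * k) + phi M S B k)"
    by (intro Liminf_mono always_eventually allI SUP_upper) simp
  finally show "ereal (w * k) + phi M S B k \<le> Liminf (at w) (\<lambda>w. SUP k. ereal (w * k) + phi M S B k)" .
qed

lemma rate_even: "rate M S B (- w) = rate M S B w"
proof -
  have "rate M S B (- w) \<le> rate M S B w" for w
    unfolding rate_def
  proof (rule SUP_least)
    fix k :: real
    have "ereal (- w * k) + phi M S B k = ereal (w * (- k)) + phi M S B (- k)"
      by (simp add: phi_even)
    also have "\<dots> \<le> (SUP k. ereal (w * k) + phi M S B k)"
      by (rule SUP_upper) simp
    finally show "ereal (- w * k) + phi M S B k \<le> (SUP k. ereal (w * k) + phi M S B k)" .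
  qed
  from this[of w] this[of "- w"] show ?thesis by simp
qed

text \<open>Only the distance of \<open>K\<close> to 0 matters: the point \<open>w0\<close> of \<open>K\<close> closest to 0 bounds the probability of \<open>K\<close> by that of
\<open>\<bar>F\<^sub>t\<bar> \<ge> \<bar>w0\<bar> t\<close>, and already \<open>- I(w0)\<close> is at most the right-hand side.\<close>

lemma ldp_upper_bound:
  assumes "closed K"
  shows "Limsup at_top (\<lambda>t. eln (emeasure M {\<omega>\<in>space M. reset_area S B t \<omega> / t \<in> K}) / ereal t)
    \<le> - (INF w\<in>K. rate M S B w)"
proof (cases "K = {}")
  case True
  have "Limsup at_top (\<lambda>t. eln (emeasure M {\<omega>\<in>space M. reset_area S B t \<omega> / t \<in> K}) / ereal t) \<le>
      Limsup at_top (\<lambda>t::real. - \<infinity> :: ereal)"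
    using eventually_gt_at_top[of "0::real"]
    by (intro Limsup_mono) (auto simp: True eln_def elim!: eventually_mono)
  then show ?thesis by (simp add: True Limsup_const)
next
  case False
  then obtain w0 where w0: "w0 \<in> K" "\<And>w. w \<in> K \<Longrightarrow> \<bar>w0\<bar> \<le> \<bar>w\<bar>"
    using distance_attains_inf[OF assms False, of 0] by (auto simp: dist_real_def)
  let ?L = "Limsup at_top (\<lambda>t. eln (emeasure M {\<omega>\<in>space M. reset_area S B t \<omega> / t \<in> K}) / ereal t)"
  have [measurable]: "K \<in> sets borel" using assms by (rule borel_closed)
  note [measurable] = reset_area_measurable
  have main: "ereal (\<bar>w0\<bar> * k) + phi M S B k \<le> - ?L" if k: "k \<ge> 0" for k
  proof (rule ccontr)
    assume "\<not> ?thesis"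
    then have "- ?L < ereal (\<bar>w0\<bar> * k) + phi M S B k" by simp
    then have "- ?L - ereal (\<bar>w0\<bar> * k) < phi M S B k"
      by (cases "?L"; cases "phi M S B k") auto
    then obtain \<zeta> where z: "- ?L - ereal (\<bar>w0\<bar> * k) < ereal \<zeta>" "ereal \<zeta> < phi M S B k"
      using ereal_dense2 by blast
    obtain C1 where C1: "C1 > 0"
      "\<And>t. t \<ge> 0 \<Longrightarrow> (\<integral>\<^sup>+\<omega>. ennreal (exp (k * reset_area S B t \<omega>)) \<partial>M) \<le> ennreal (C1 * exp (- \<zeta> * t))"
      using less_phi_imp_mgf_upper_bound[OF z(2)] by blast
    have "ereal \<zeta> < phi M S B (- k)" using z(2) by (simp add: phi_even)
    then obtain C2 where C2: "C2 > 0"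
      "\<And>t. t \<ge> 0 \<Longrightarrow> (\<integral>\<^sup>+\<omega>. ennreal (exp (- k * reset_area S B t \<omega>)) \<partial>M) \<le> ennreal (C2 * exp (- \<zeta> * t))"
      using less_phi_imp_mgf_upper_bound by blast
    have "emeasure M {\<omega>\<in>space M. reset_area S B t \<omega> / t \<in> K} \<le> ennreal ((C1 + C2) * exp (- (\<bar>w0\<bar> * k + \<zeta>) * t))"
      if t: "t > 0" for t
    proof -
      have "emeasure M {\<omega>\<in>space M. reset_area S B t \<omega> / t \<in> K} =
          (\<integral>\<^sup>+\<omega>. indicator {\<omega>\<in>space M. reset_area S B t \<omega> / t \<in> K} \<omega> \<partial>M)"
        by (rule nn_integral_indicator[symmetric]) measurable
      also have "\<dots> \<le> (\<integral>\<^sup>+\<omega>. ennreal (exp (- (\<bar>w0\<bar> * k * t))) * (ennreal (exp (k * reset_area S B t \<omega>)) + ennreal (exp (- k * reset_area S B t \<omega>))) \<partial>M)"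
      proof (rule nn_integral_mono)
        fix \<omega>
        show "indicator {\<omega>\<in>space M. reset_area S B t \<omega> / t \<in> K} \<omega> \<le>
           ennreal (exp (- (\<bar>w0\<bar> * k * t))) * (ennreal (exp (k * reset_area S B t \<omega>)) + ennreal (exp (- k * reset_area S B t \<omega>)))"
        proof (cases "reset_area S B t \<omega> / t \<in> K")
          case True
          let ?F = "reset_area S B t \<omega>"
          have "\<bar>w0\<bar> \<le> \<bar>?F\<bar> / t" using w0(2)[OF True] t by simp
          then have "\<bar>w0\<bar> * t \<le> \<bar>?F\<bar>" using t by (simp add: pos_le_divide_eq)
          then have "k * (\<bar>w0\<bar> * t) \<le> k * \<bar>?F\<bar>" using k by (rule mult_left_mono)
          then have "exp (\<bar>w0\<bar> * k * t) \<le> exp (k * \<bar>?F\<bar>)" by (simp add: algebra_simps)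
          also have "\<dots> \<le> exp (k * ?F) + exp (- k * ?F)" by (simp add: abs_if)
          finally have "exp (- (\<bar>w0\<bar> * k * t)) * exp (\<bar>w0\<bar> * k * t) \<le> exp (- (\<bar>w0\<bar> * k * t)) * (exp (k * ?F) + exp (- k * ?F))"
            by (rule mult_left_mono) simp
          then have "1 \<le> exp (- (\<bar>w0\<bar> * k * t)) * (exp (k * ?F) + exp (- k * ?F))"
            by (simp add: exp_minus)
          then have "ennreal 1 \<le> ennreal (exp (- (\<bar>w0\<bar> * k * t)) * (exp (k * ?F) + exp (- k * ?F)))"
            by (rule ennreal_leI)
          also have "\<dots> = ennreal (exp (- (\<bar>w0\<bar> * k * t))) * (ennreal (exp (k * ?F)) + ennreal (exp (- k * ?F)))"
            by (simp add: ennreal_mult')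
          finally show ?thesis by (auto simp: indicator_def)
        qed simp
      qed
      also have "\<dots> = ennreal (exp (- (\<bar>w0\<bar> * k * t))) *
          ((\<integral>\<^sup>+\<omega>. ennreal (exp (k * reset_area S B t \<omega>)) \<partial>M) + (\<integral>\<^sup>+\<omega>. ennreal (exp (- k * reset_area S B t \<omega>)) \<partial>M))"
        by (subst nn_integral_cmult, measurable, subst nn_integral_add, measurable)
      also have "\<dots> \<le> ennreal (exp (- (\<bar>w0\<bar> * k * t))) * (ennreal (C1 * exp (- \<zeta> * t)) + ennreal (C2 * exp (- \<zeta> * t)))"
        using t by (intro mult_left_mono add_mono C1(2) C2(2)) auto
      also have "\<dots> = ennreal (exp (- (\<bar>w0\<bar> * k * t)) * (C1 * exp (- \<zeta> * t) + C2 * exp (- \<zeta> * t)))"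
        using C1(1) C2(1) by (simp add: ennreal_mult')
      also have "exp (- (\<bar>w0\<bar> * k * t)) * (C1 * exp (- \<zeta> * t) + C2 * exp (- \<zeta> * t)) = (C1 + C2) * (exp (- (\<bar>w0\<bar> * k * t)) * exp (- \<zeta> * t))"
        by (simp add: algebra_simps)
      also have "exp (- (\<bar>w0\<bar> * k * t)) * exp (- \<zeta> * t) = exp (- (\<bar>w0\<bar> * k + \<zeta>) * t)"
        unfolding exp_add[symmetric] by (simp add: algebra_simps)
      finally show ?thesis .
    qed
    then have "?L \<le> ereal (- (\<bar>w0\<bar> * k + \<zeta>))"
      using C1(1) C2(1) by (intro Limsup_eln_le[of _ "C1 + C2"] eventually_mono[OF eventually_gt_at_top[of 0]]) auto
    with z(1) show False by (cases "?L") auto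
  qed
  have "rate M S B \<bar>w0\<bar> \<le> - ?L"
    unfolding rate_def
  proof (rule SUP_least)
    fix k :: real
    have "ereal (\<bar>w0\<bar> * k) + phi M S B k \<le> ereal (\<bar>w0\<bar> * \<bar>k\<bar>) + phi M S B \<bar>k\<bar>"
      by (intro add_mono) (auto simp: abs_if phi_even mult_left_mono mult_nonneg_nonpos intro: order_trans[of _ 0])
    also have "\<dots> \<le> - ?L" by (rule main) simp
    finally show "ereal (\<bar>w0\<bar> * k) + phi M S B k \<le> - ?L" .
  qed
  moreover have "rate M S B \<bar>w0\<bar> = rate M S B w0" by (simp add: abs_if rate_even)
  moreover have "(INF w\<in>K. rate M S B w) \<le> rate M S B w0" by (rule INF_lower[OF w0(1)])
  ultimately have "(INF w\<in>K. rate M S B w) \<le> - ?L" by simp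
  then show ?thesis by (subst ereal_minus_le_minus[symmetric]) simp
qed

text \<open>If the claim fails, some \<open>c > I(w)\<close> is still smaller than the exponential decay rate. With the optimal tilt for \<open>c\<close>,
the event that the typical block occurs and the Gaussian variable lands in the ball of radius \<open>d\<close> around \<open>w\<close> has
rate \<open>cost d\<close>, which tends to \<open>c\<close> as \<open>d\<close> tends to 0: a contradiction.\<close>

lemma ldp_lower_bound:
  assumes "open G"
  shows "- (INF w\<in>G. rate M S B w) \<le>
    Liminf at_top (\<lambda>t. eln (emeasure M {\<omega>\<in>space M. reset_area S B t \<omega> / t \<in> G}) / ereal t)"
proof -
  let ?L = "Liminf at_top (\<lambda>t. eln (emeasure M {\<omega>\<in>space M. reset_area S B t \<omega> / t \<in> G}) / ereal t)"
  have [measurable]: "G \<in> sets borel" using assms by (rule borel_open)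
  note [measurable] = reset_area_measurable
  have "- ?L \<le> rate M S B w" if w: "w \<in> G" for w
  proof (rule ccontr)
    assume "\<not> ?thesis"
    then have "rate M S B w < - ?L" by simp
    then obtain c where c: "rate M S B w < ereal c" "ereal c < - ?L"
      using ereal_dense2 by blast
    obtain c' where c': "ereal c < ereal c'" "ereal c' < - ?L" using ereal_dense2[OF c(2)] by blast
    have "(\<integral>\<^sup>+\<omega>. ennreal (tilt (c - k * w) (k\<^sup>2 / 2) (S 1 \<omega>)) \<partial>M) > 1" for k
    proof (rule gt_phi_imp_tilt_gt_1)
      have "ereal (w * k) + phi M S B k \<le> rate M S B w" unfolding rate_def by (rule SUP_upper) simp
      also note c(1)
      finally show "phi M S B k < ereal (c - k * w)" by (cases "phi M S B k") (auto simp: algebra_simps)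
    qed
    then obtain k A where kA:
      "expectation (\<lambda>\<omega>. truncated_tilt (c - k * w) (k\<^sup>2 / 2) A (S 1 \<omega>)) \<ge> 1"
      "expectation (\<lambda>\<omega>. truncated_tilt (c - k * w) (k\<^sup>2 / 2) A (S 1 \<omega>) * S 1 \<omega>) > 0"
      "expectation (\<lambda>\<omega>. truncated_tilt (c - k * w) (k\<^sup>2 / 2) A (S 1 \<omega>) * (S 1 \<omega> ^ 3 / 3)) > 0"
      "w * expectation (\<lambda>\<omega>. truncated_tilt (c - k * w) (k\<^sup>2 / 2) A (S 1 \<omega>) * S 1 \<omega>) =
        k * expectation (\<lambda>\<omega>. truncated_tilt (c - k * w) (k\<^sup>2 / 2) A (S 1 \<omega>) * (S 1 \<omega> ^ 3 / 3))"
      by (rule exists_optimal_tilt)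
    define v where "v = expectation (\<lambda>\<omega>. truncated_tilt (c - k * w) (k\<^sup>2 / 2) A (S 1 \<omega>) * (S 1 \<omega> ^ 3 / 3)) /
       expectation (\<lambda>\<omega>. truncated_tilt (c - k * w) (k\<^sup>2 / 2) A (S 1 \<omega>) * S 1 \<omega>)"
    have v: "v > 0" using kA(2,3) by (simp add: v_def)
    \<comment> \<open>Stationarity of the tilt; it makes the limiting cost below equal to \<open>c\<close>.\<close>
    have wkv: "w = k * v" using kA(2,4) by (simp add: v_def field_simps)
    define \<zeta> \<theta> where "\<zeta> = c - k * w" and "\<theta> = k\<^sup>2 / 2"
    define cost where "cost d = (\<bar>w\<bar> + d)\<^sup>2 / (2 * (v - d)) + (\<zeta> + \<theta> * v + d)" for d
    have "(cost \<longlongrightarrow> (\<bar>w\<bar> + 0)\<^sup>2 / (2 * (v - 0)) + (\<zeta> + \<theta> * v + 0)) (at_right 0)"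
      unfolding cost_def using v by (intro tendsto_intros) auto
    moreover have "(\<bar>w\<bar> + 0)\<^sup>2 / (2 * (v - 0)) + (\<zeta> + \<theta> * v + 0) = c"
      using v unfolding \<zeta>_def \<theta>_def wkv by (simp add: power2_eq_square abs_mult field_simps)
    ultimately have ev1: "\<forall>\<^sub>F d in at_right 0. cost d < c'"
      using c'(1) by (intro order_tendstoD(2)) auto
    have ev2: "\<forall>\<^sub>F d in at_right 0. d > 0 \<and> d < v"
      using v by (auto simp: eventually_at_right_field)
    obtain r where r: "r > 0" "ball w r \<subseteq> G" using assms w by (meson open_contains_ball)
    have ev3: "\<forall>\<^sub>F d in at_right 0. d < r"
      using r by (auto simp: eventually_at_right_field)
    from ev1 ev2 ev3 have "\<forall>\<^sub>F d in at_right 0. cost d < c' \<and> d > 0 \<and> d < v \<and> d < r"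
      by eventually_elim auto
    then obtain d where d: "cost d < c'" "d > 0" "d < v" "d < r"
      using eventually_happens[of _ "at_right (0::real)"] by auto
    have ball: "{y. \<bar>y - w\<bar> < d} \<subseteq> G" using r(2) d(4) by (auto simp: dist_real_def subset_eq)
    have ev4: "\<forall>\<^sub>F t in at_top. \<exists>m. exp (- (\<zeta> + \<theta> * v + d) * t) \<le> prob (block_event m t (v - d))"
      by (rule block_event_lower_bound[of \<zeta> \<theta> A]) (use kA(1,2) d in \<open>auto simp: v_def \<zeta>_def \<theta>_def\<close>)
    have "filterlim (\<lambda>t. 2 * d / t / sqrt (2 * pi) * exp ((c' - cost d) * t)) at_top at_top"
    proof -
      define u a where "u = c' - cost d" and "a = 2 * d / sqrt (2 * pi)"
      have "u > 0" "a > 0" using d by (auto simp: u_def a_def)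
      then have "filterlim (\<lambda>t. a / t * exp (u * t)) at_top at_top" by real_asymp
      then show ?thesis by (simp add: u_def a_def field_simps)
    qed
    then have ev5: "\<forall>\<^sub>F t in at_top. 1 \<le> 2 * d / t / sqrt (2 * pi) * exp ((c' - cost d) * t)"
      by (simp add: filterlim_at_top)
    have "\<forall>\<^sub>F t in at_top. ennreal (exp (- c' * t)) \<le> emeasure M {\<omega>\<in>space M. reset_area S B t \<omega> / t \<in> G}"
      using ev4 ev5 eventually_ge_at_top[of 1]
    proof eventually_elim
      case (elim t)
      then obtain m where m: "exp (- (\<zeta> + \<theta> * v + d) * t) \<le> prob (block_event m t (v - d))" by blast
      have t: "t \<ge> 0" "t > 0" using elim(3) by auto
      define p where "p = 2 * d / t / sqrt (2 * pi) * exp (- (t * (\<bar>w\<bar> + d)\<^sup>2 / (2 * (v - d))))"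
      have p0: "p \<ge> 0" using d t by (simp add: p_def)
      have "exp (- c' * t) * 1 \<le> exp (- c' * t) * (2 * d / t / sqrt (2 * pi) * exp ((c' - cost d) * t))"
        by (rule mult_left_mono[OF elim(2)]) simp
      also have "\<dots> = 2 * d / t / sqrt (2 * pi) * (exp (- c' * t) * exp ((c' - cost d) * t))" by simp
      also have "exp (- c' * t) * exp ((c' - cost d) * t) =
          exp (- (t * (\<bar>w\<bar> + d)\<^sup>2 / (2 * (v - d)))) * exp (- (\<zeta> + \<theta> * v + d) * t)"
        unfolding exp_add[symmetric] cost_def by (simp add: algebra_simps)
      finally have "exp (- c' * t) \<le> p * exp (- (\<zeta> + \<theta> * v + d) * t)"
        by (simp add: p_def mult.assoc)
      also have "\<dots> \<le> p * prob (block_event m t (v - d))" by (rule mult_left_mono[OF m p0])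
      finally have "ennreal (exp (- c' * t)) \<le> ennreal p * emeasure M (block_event m t (v - d))"
        using p0 by (simp add: emeasure_eq_measure ennreal_mult'[symmetric] ennreal_leI)
      also have "\<dots> = (\<integral>\<^sup>+\<omega>. ennreal p * indicator (block_event m t (v - d)) \<omega> \<partial>M)"
        by (rule nn_integral_cmult_indicator[symmetric]) simp
      also have "\<dots> \<le> (\<integral>\<^sup>+\<omega>. (\<integral>\<^sup>+y. indicator {y. \<bar>y / t - w\<bar> < d} y \<partial>gauss (cond_var t \<omega>)) \<partial>M)"
      proof (rule nn_integral_mono_AE)
        show "AE \<omega> in M. ennreal p * indicator (block_event m t (v - d)) \<omega> \<le> (\<integral>\<^sup>+y. indicator {y. \<bar>y / t - w\<bar> < d} y \<partial>gauss (cond_var t \<omega>))"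
          using AE_block_event_cond_var[OF t(1), of m "v - d"]
        proof eventually_elim
          case (elim \<omega>)
          have "{y. \<bar>y / t - w\<bar> < d} \<in> sets borel" by measurable
          then have [simp]: "{y. \<bar>y / t - w\<bar> < d} \<in> sets (gauss x)" for x by (simp add: gauss_def)
          show ?case
          proof (cases "\<omega> \<in> block_event m t (v - d)")
            case True
            then show ?thesis
              using elim gauss_ball_lower_bound[of "v - d" t d "cond_var t \<omega>" w] d \<open>t \<ge> 1\<close>
              by (simp add: p_def)
          qed simp
        qed
      qed
      also have "\<dots> = (\<integral>\<^sup>+\<omega>. indicator {y. \<bar>y / t - w\<bar> < d} (reset_area S B t \<omega>) \<partial>M)"
        by (rule nn_integral_reset_area[symmetric]) (use t in auto)
      also have "\<dots> = (\<integral>\<^sup>+\<omega>. indicator {\<omega>\<in>space M. \<bar>reset_area S B t \<omega> / t - w\<bar> < d} \<omega> \<partial>M)"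
        by (rule nn_integral_cong) (simp add: indicator_def)
      also have "\<dots> = emeasure M {\<omega>\<in>space M. \<bar>reset_area S B t \<omega> / t - w\<bar> < d}"
        by (rule nn_integral_indicator) measurable
      also have "\<dots> \<le> emeasure M {\<omega>\<in>space M. reset_area S B t \<omega> / t \<in> G}"
      proof (rule emeasure_mono)
        show "{\<omega>\<in>space M. \<bar>reset_area S B t \<omega> / t - w\<bar> < d} \<subseteq> {\<omega>\<in>space M. reset_area S B t \<omega> / t \<in> G}"
          using ball by auto
        show "{\<omega>\<in>space M. reset_area S B t \<omega> / t \<in> G} \<in> sets M"
          by measurable
      qed
      finally show ?case .
    qed
    then have "ereal (- c') \<le> ?L" by (rule Liminf_eln_ge)
    with c'(2) show False by (cases "?L") auto
  qed
  then have "- ?L \<le> (INF w\<in>G. rate M S B w)" by (rule INF_greatest)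
  then show ?thesis by (simp only: ereal_uminus_le_reorder)
qed

end

theorem proposition4p2:
  fixes M :: "'a measure"
    and S :: "nat \<Rightarrow> 'a \<Rightarrow> real"
    and B :: "nat \<Rightarrow> real \<Rightarrow> 'a \<Rightarrow> real"
  assumes "resetting M S B"
    and "\<exists>l::ereal. 0 \<le> l \<and>
      ((\<lambda>s::real. - eln (emeasure M {\<omega> \<in> space M. S 1 \<omega> > s}) / ereal s) \<longlongrightarrow> l) at_top"
  shows "full_ldp M (reset_area S B) (rate M S B) \<and>
    (\<forall>k::real.
      ((\<lambda>t::real. eln (\<integral>\<^sup>+ \<omega>. ennreal (exp (k * reset_area S B t \<omega>)) \<partial>M) / ereal t)
        \<longlongrightarrow> - phi M S B k) at_top)"
proof -
  interpret resetting M S B by (rule assms(1))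
  show ?thesis
    unfolding full_ldp_def
    using lower_semicont_rate ldp_lower_bound ldp_upper_bound mgf_limit by blast
qed

end
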